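(* For fixed $t\in\mathbb{R}$, let $h_n(t)=\int_{-\infty}^{\infty}P_n^2(x;t)w(x;t)\,dx$ be the square of the $L^2$-norm of the monic orthogonal polynomial $P_n(x;t)$ of degree $n$ with respect to the weight $w(x;t)=\mathrm{e}^{-x^4+tx^2}$ on $\mathbb{R}$. Then, as $n\to\infty$, \begin{align*} \ln h_n(t)=&\ \frac{n\ln n}{2}-\frac{1}{2}(1+\ln 12)n+\frac{n^{1/2}t}{\sqrt{3}}+\frac{\ln n}{4}+\frac{t^2}{12}-\frac{\ln 12}{4}+\ln(2\pi)+\frac{t(t^2+18)}{72\sqrt{3}\,n^{1/2}}\\ &-\frac{t(t^4+20t^2+120)}{5760\sqrt{3}\,n^{3/2}}+\frac{t^2+6}{288n^2}+O\big(n^{-5/2}\big). \end{align*}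
   Context: For $t\in\mathbb{R}$, $P_n(x;t)$, $n=0,1,2,\ldots$, are the monic polynomials of degree $n$ satisfying $\int_{-\infty}^{\infty}P_j(x;t)P_k(x;t)w(x;t)\,dx=h_j(t)\delta_{jk}$ with $w(x;t)=\mathrm{e}^{-x^4+tx^2}$. The implied constant in the $O$-term may depend on $t$. *)

theory Defs
  imports
    "HOL-Analysis.Analysis"
    "HOL-Computational_Algebra.Polynomial"
    "HOL-Library.Landau_Symbols"
begin

definition quartic_weight :: "real \<Rightarrow> real \<Rightarrow> real"
  where "quartic_weight t x = exp (- (x ^ 4) + t * x ^ 2)"

text \<open>
  A polynomial times the weight is integrable for every real \<open>t\<close>, so the default
  value \<open>0\<close> of the Bochner integral never arises in the definitions below.
\<close>

definition norm_sq :: "real \<Rightarrow> real poly \<Rightarrow> real"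
  where "norm_sq t p = (\<integral>x. (poly p x)\<^sup>2 * quartic_weight t x \<partial>lborel)"

text \<open>
  For given \<open>t\<close> there is exactly one such sequence \<open>P\<close>. The diagonal case \<open>j = k\<close> only
  restates the definition of the squared norm, which plays the role of \<open>h\<^sub>j(t)\<close>.
\<close>

definition monic_orthogonal_polys :: "real \<Rightarrow> (nat \<Rightarrow> real poly) \<Rightarrow> bool"
  where "monic_orthogonal_polys t P \<longleftrightarrow>
    (\<forall>n. degree (P n) = n \<and> lead_coeff (P n) = 1) \<and>
    (\<forall>j k. (\<integral>x. poly (P j) x * poly (P k) x * quartic_weight t x \<partial>lborel)
       = (if j = k then norm_sq t (P j) else 0))"

end

theory Submission
  imports Defs "HOL-Probability.Distributions" "HOL-Real_Asymp.Real_Asymp"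
begin

text \<open>
  The recurrence coefficients \<open>\<beta>\<^sub>n = h\<^sub>n / h\<^sub>n\<^sub>-\<^sub>1\<close> satisfy the string equation
  \<open>\<beta>\<^sub>n (4 (\<beta>\<^sub>n\<^sub>+\<^sub>1 + \<beta>\<^sub>n + \<beta>\<^sub>n\<^sub>-\<^sub>1) - 2 t) = n\<close>. Solving it for \<open>\<beta>\<^sub>n\<close> is a contraction for large \<open>n\<close>, because
  \<open>\<beta>\<^sub>n\<close> is a priori at most about \<open>\<surd>n / 2\<close>. Hence every approximate solution with a small residual is close
  to \<open>\<beta>\<close>. This is used twice.

  A truncated formal series in \<open>n\<^sup>-\<^sup>1\<^sup>/\<^sup>2\<close> approximates \<open>\<beta>\<^sub>n\<close> up to \<open>O(n\<^sup>-\<^sup>3)\<close> for fixed \<open>t\<close>; summing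
  \<open>ln \<beta>\<^sub>n\<close> gives the expansion of \<open>ln h\<^sub>n\<close> up to an additive constant.

  The constant is found by deforming to the Gaussian weight. Since \<open>\<partial>\<^sub>s ln h\<^sub>n(s) = \<beta>\<^sub>n + \<beta>\<^sub>n\<^sub>+\<^sub>1\<close>, and since
  \<open>(s + \<surd>(s\<^sup>2 + 12 n)) / 12\<close> approximates \<open>\<beta>\<^sub>n(s)\<close> with an error \<open>O(n\<^sup>-\<^sup>1\<^sup>/\<^sup>2 / (1 + s\<^sup>2))\<close> uniformly in
  \<open>s \<le> t\<close>, one may integrate over \<open>s\<close> from \<open>-\<infinity>\<close>, where \<open>h\<^sub>n(s)\<close> behaves like its Hermite counterpart
  \<open>\<surd>\<pi> n! 2\<^sup>-\<^sup>n \<bar>s\<bar>\<^sup>-\<^sup>n\<^sup>-\<^sup>1\<^sup>/\<^sup>2\<close>; Stirling's formula then yields the constant.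
\<close>

section \<open>Orthogonal polynomials and the string equation\<close>

text \<open>Summing ln beta_n loses one constant that no expansion at large n can recover. Exact
  data for every n are available only as s -> -\<infinity>, so the deformation runs over an infinite
  interval; this is why the planar approximation must carry the integrable factor 1/(1 + s^2). The
  factor integrates to at most pi, and the accumulated error stays O(n^(-1/2)). An error o(1)
  suffices there, since the rate comes from telescoping: knowing beta_n up to O(n^(-3)) means a
  relative error O(n^(-7/2)), and such differences sum to O(n^(-5/2)).

  Derivatives in s of the polynomials are avoided. Minimality of h_n among monic polynomials bounds
  h_n(s') from above by a quadratic expansion at s; having this for both signs of s' - s pins the
  slope from both sides.

  The difference equation has no boundary condition at n = \<infinity>. Its role is played by growth
  of order sqrt n, which a linear barrier beats, so only one starting value has to be
  controlled.\<close>

lemma quartic_weight_pos: "0 < quartic_weight s x"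
  by (simp add: quartic_weight_def)

lemma quartic_weight_nonneg: "0 \<le> quartic_weight s x"
  by (simp add: quartic_weight_def)

lemma continuous_quartic_weight: "continuous_on A (quartic_weight s)"
  unfolding quartic_weight_def by (intro continuous_intros)

lemma borel_measurable_quartic_weight [measurable]: "quartic_weight s \<in> borel_measurable borel"
  by (intro borel_measurable_continuous_onI continuous_quartic_weight)

text \<open>Completing the square in x^2 after moving x^2/2 to the left. The Gaussian majorant
  reduces integrability of all moments to those of the standard normal density.\<close>

lemma quartic_weight_le:
  "quartic_weight s x \<le> sqrt (2 * pi) * exp ((s + 1 / 2)\<^sup>2 / 4) * std_normal_density x"
proof -
  have "0 \<le> (x\<^sup>2 - (s + 1 / 2) / 2)\<^sup>2" by simp
  hence "- (x ^ 4) + s * x\<^sup>2 \<le> (s + 1 / 2)\<^sup>2 / 4 + (- x\<^sup>2 / 2)"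
    by (simp add: power2_eq_square power4_eq_xxxx field_simps)
  hence "quartic_weight s x \<le> exp ((s + 1 / 2)\<^sup>2 / 4) * exp (- x\<^sup>2 / 2)"
    unfolding quartic_weight_def by (simp flip: exp_add)
  thus ?thesis by (simp add: std_normal_density_def)
qed

lemma integrable_power_quartic_weight:
  "integrable lborel (\<lambda>x. x ^ k * quartic_weight s x)"
proof (rule Bochner_Integration.integrable_bound)
  show "integrable lborel (\<lambda>x. sqrt (2 * pi) * exp ((s + 1 / 2)\<^sup>2 / 4) *
      (std_normal_density x * \<bar>x\<bar> ^ k))"
    by (intro integrable_mult_right integrable_std_normal_moment_abs)
  show "AE x in lborel. norm (x ^ k * quartic_weight s x) \<le>
      norm (sqrt (2 * pi) * exp ((s + 1 / 2)\<^sup>2 / 4) * (std_normal_density x * \<bar>x\<bar> ^ k))"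
  proof (rule AE_I2)
    fix x :: real
    have "\<bar>x\<bar> ^ k * quartic_weight s x \<le>
        \<bar>x\<bar> ^ k * (sqrt (2 * pi) * exp ((s + 1 / 2)\<^sup>2 / 4) * std_normal_density x)"
      by (intro mult_left_mono quartic_weight_le) auto
    thus "norm (x ^ k * quartic_weight s x) \<le>
      norm (sqrt (2 * pi) * exp ((s + 1 / 2)\<^sup>2 / 4) * (std_normal_density x * \<bar>x\<bar> ^ k))"
      using quartic_weight_pos[of s x] by (simp add: abs_mult power_abs mult_ac)
  qed
qed simp

lemma integrable_poly_quartic_weight:
  "integrable lborel (\<lambda>x. poly p x * quartic_weight s x)"
proof -
  have "(\<lambda>x. poly p x * quartic_weight s x) =
      (\<lambda>x. \<Sum>i\<le>degree p. coeff p i * (x ^ i * quartic_weight s x))"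
    by (simp add: poly_altdef sum_distrib_right mult.assoc)
  thus ?thesis
    by (simp add: integrable_power_quartic_weight)
qed

section \<open>The weight as a linear functional on polynomials\<close>

definition weighted_integral :: "real \<Rightarrow> real poly \<Rightarrow> real"
  where "weighted_integral s p = (\<integral>x. poly p x * quartic_weight s x \<partial>lborel)"

lemma weighted_integral_add: "weighted_integral s (p + q) = weighted_integral s p + weighted_integral s q"
  by (simp add: weighted_integral_def distrib_right integrable_poly_quartic_weight)

lemma weighted_integral_diff: "weighted_integral s (p - q) = weighted_integral s p - weighted_integral s q"
  by (simp add: weighted_integral_def left_diff_distrib integrable_poly_quartic_weight)

lemma weighted_integral_smult: "weighted_integral s (smult c p) = c * weighted_integral s p"
  by (simp add: weighted_integral_def mult.assoc)

lemma weighted_integral_0: "weighted_integral s 0 = 0"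
  by (simp add: weighted_integral_def)

lemma weighted_integral_odd:
  assumes "\<And>x. poly p (- x) = - poly p x"
  shows "weighted_integral s p = 0"
proof -
  have "weighted_integral s p = (\<integral>x. poly p (0 + (- 1) * x) * quartic_weight s (0 + (- 1) * x) \<partial>lborel)"
    unfolding weighted_integral_def by (subst lborel_integral_real_affine[where c = "- 1" and t = 0]) simp_all
  also have "\<dots> = - weighted_integral s p"
    using assms by (simp add: weighted_integral_def quartic_weight_def)
  finally show ?thesis by simp
qed

lemma weighted_integral_square_nonneg: "0 \<le> weighted_integral s (p\<^sup>2)"
  unfolding weighted_integral_def by (simp add: poly_power quartic_weight_nonneg)

lemma weighted_integral_square_pos:
  assumes "p \<noteq> 0"
  shows "0 < weighted_integral s (p\<^sup>2)"
proof (rule ccontr)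
  assume "\<not> 0 < weighted_integral s (p\<^sup>2)"
  hence "weighted_integral s (p\<^sup>2) = 0" using weighted_integral_square_nonneg[of s p] by simp
  hence "AE x in lborel. poly (p\<^sup>2) x * quartic_weight s x = 0"
    unfolding weighted_integral_def
    by (subst (asm) integral_nonneg_eq_0_iff_AE[OF integrable_poly_quartic_weight])
      (auto simp: poly_power quartic_weight_nonneg)
  hence "AE x in lborel. poly p x = 0"
    by eventually_elim (simp add: poly_power quartic_weight_def)
  moreover have "AE x in lborel. x \<notin> {x. poly p x = 0}"
    using poly_roots_finite[OF assms] by (intro AE_not_in finite_imp_null_set_lborel)
  ultimately have "AE x::real in lborel. False"
    by eventually_elim simp
  thus False
    by (simp add: AE_iff_measurable[OF _ refl] space_lborel)
qed

text \<open>These are the boundary terms of the integration by parts below. The Gaussian majorant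
  depends on x^2/2 only, which tends to infinity at both ends, so one estimate serves both
  limits.\<close>

lemma quartic_weight_times_poly_tendsto:
  "((\<lambda>x. poly p x * quartic_weight s x) \<longlongrightarrow> 0) at_top"
  "((\<lambda>x. poly p x * quartic_weight s x) \<longlongrightarrow> 0) at_bot"
proof -
  have *: "((\<lambda>x. x ^ k * quartic_weight s x) \<longlongrightarrow> 0) F"
    if F: "filterlim (\<lambda>x::real. x\<^sup>2 / 2) at_top F" for k and F :: "real filter"
  proof (rule Lim_null_comparison)
    let ?g = "\<lambda>x. exp ((s + 1 / 2)\<^sup>2 / 4) * 2 ^ k * ((x\<^sup>2 / 2) ^ k / exp (x\<^sup>2 / 2))"
    have "((\<lambda>x. (x\<^sup>2 / 2) ^ k / exp (x\<^sup>2 / 2)) \<longlongrightarrow> 0) F"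
      by (rule filterlim_compose[OF tendsto_power_div_exp_0 F])
    thus "(?g \<longlongrightarrow> 0) F" by (rule tendsto_mult_right_zero)
    have "\<forall>\<^sub>F x in F. 1 \<le> x\<^sup>2 / 2"
      using F unfolding filterlim_at_top by blast
    thus "\<forall>\<^sub>F x in F. norm (x ^ k * quartic_weight s x) \<le> ?g x"
    proof eventually_elim
      case (elim x)
      have "1\<^sup>2 \<le> \<bar>x\<bar>\<^sup>2" using elim by simp
      hence "1 \<le> \<bar>x\<bar>" by (rule power2_le_imp_le) simp
      hence "\<bar>x\<bar> * 1 \<le> \<bar>x\<bar> * \<bar>x\<bar>"
        by (rule mult_left_mono) simp
      hence "\<bar>x\<bar> \<le> x\<^sup>2"
        by (simp add: power2_eq_square)
      hence "\<bar>x\<bar> ^ k \<le> (x\<^sup>2) ^ k"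
        by (rule power_mono) simp
      moreover have "quartic_weight s x \<le> exp ((s + 1 / 2)\<^sup>2 / 4) / exp (x\<^sup>2 / 2)"
        using quartic_weight_le[of s x] by (simp add: std_normal_density_def exp_minus field_simps)
      ultimately have "\<bar>x\<bar> ^ k * quartic_weight s x \<le>
          (x\<^sup>2) ^ k * (exp ((s + 1 / 2)\<^sup>2 / 4) / exp (x\<^sup>2 / 2))"
        by (intro mult_mono) (auto simp: quartic_weight_nonneg)
      thus ?case
        by (simp add: abs_mult power_abs quartic_weight_nonneg power_divide mult_ac)
    qed
  qed
  have 1: "((\<lambda>x. x ^ k * quartic_weight s x) \<longlongrightarrow> 0) at_top" for k
    by (rule *) real_asymp
  have 2: "((\<lambda>x. x ^ k * quartic_weight s x) \<longlongrightarrow> 0) at_bot" for k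
    by (rule *) real_asymp
  have eq: "(\<lambda>x. poly p x * quartic_weight s x) =
      (\<lambda>x. \<Sum>i\<le>degree p. coeff p i * (x ^ i * quartic_weight s x))"
    by (simp add: poly_altdef sum_distrib_right mult.assoc)
  show "((\<lambda>x. poly p x * quartic_weight s x) \<longlongrightarrow> 0) at_top"
    unfolding eq by (intro tendsto_null_sum tendsto_mult_right_zero 1)
  show "((\<lambda>x. poly p x * quartic_weight s x) \<longlongrightarrow> 0) at_bot"
    unfolding eq by (intro tendsto_null_sum tendsto_mult_right_zero 2)
qed

text \<open>Integration by parts: the logarithmic derivative of the weight is 2 s x - 4 x^3, so
  \<open>?q\<close> times the weight is the derivative of \<open>p\<close> times the weight, whose
  integral over the line vanishes.\<close>

lemma weighted_integral_pderiv: "weighted_integral s (pderiv p) = weighted_integral s (p * [:0, - 2 * s, 0, 4:])"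
proof -
  let ?q = "pderiv p - p * [:0, - 2 * s, 0, 4:]"
  have "(LBINT x=-\<infinity>..\<infinity>. poly ?q x * quartic_weight s x) = 0 - 0"
  proof (rule interval_integral_FTC_integrable)
    show "((\<lambda>x. poly p x * quartic_weight s x) has_vector_derivative poly ?q x * quartic_weight s x) (at x)" for x
      unfolding quartic_weight_def
      by (auto intro!: derivative_eq_intros simp flip: has_real_derivative_iff_has_vector_derivative
        simp: algebra_simps power2_eq_square power3_eq_cube)
    show "isCont (\<lambda>x. poly ?q x * quartic_weight s x) x" for x
      unfolding quartic_weight_def by (intro continuous_intros)
    show "set_integrable lborel (einterval (- \<infinity>) \<infinity>) (\<lambda>x. poly ?q x * quartic_weight s x)"
      using integrable_poly_quartic_weight[of ?q s] by (simp add: set_integrable_def)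
    show "(((\<lambda>x. poly p x * quartic_weight s x) \<circ> real_of_ereal) \<longlongrightarrow> 0) (at_right (- \<infinity>))"
      unfolding ereal_tendsto_simps by (rule quartic_weight_times_poly_tendsto)
    show "(((\<lambda>x. poly p x * quartic_weight s x) \<circ> real_of_ereal) \<longlongrightarrow> 0) (at_left \<infinity>)"
      unfolding ereal_tendsto_simps by (rule quartic_weight_times_poly_tendsto)
  qed simp
  hence "weighted_integral s ?q = 0"
    by (simp add: weighted_integral_def interval_lebesgue_integral_def set_lebesgue_integral_def)
  thus ?thesis by (simp add: weighted_integral_diff)
qed

text \<open>The three-term recurrence serves as the definition, with norm ratios as coefficients,
  and orthogonality is derived from it afterwards. The weight is even, so the recurrence has no
  diagonal term.\<close>

fun freud_poly :: "real \<Rightarrow> nat \<Rightarrow> real poly" where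
  "freud_poly s 0 = 1"
| "freud_poly s (Suc 0) = [:0, 1:]"
| "freud_poly s (Suc (Suc n)) = [:0, 1:] * freud_poly s (Suc n) -
     smult (weighted_integral s ((freud_poly s (Suc n))\<^sup>2) / weighted_integral s ((freud_poly s n)\<^sup>2)) (freud_poly s n)"

definition freud_norm :: "real \<Rightarrow> nat \<Rightarrow> real"
  where "freud_norm s n = weighted_integral s ((freud_poly s n)\<^sup>2)"

text \<open>The value 0 at \<open>n = 0\<close> lets the recurrence hold there as well: it cancels
  the term with the truncated index \<open>n - 1\<close>.\<close>

definition freud_beta :: "real \<Rightarrow> nat \<Rightarrow> real"
  where "freud_beta s n = (if n = 0 then 0 else freud_norm s n / freud_norm s (n - 1))"

lemma X_times_freud_poly:
  "[:0, 1:] * freud_poly s n = freud_poly s (Suc n) + smult (freud_beta s n) (freud_poly s (n - 1))"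
  by (cases n) (simp_all add: freud_beta_def freud_norm_def one_pCons)

lemma degree_freud_poly_and_lead_coeff:
  "degree (freud_poly s n) = n \<and> coeff (freud_poly s n) n = 1"
proof (induction n rule: less_induct)
  case (less n)
  consider "n = 0" | "n = 1" | m where "n = Suc (Suc m)"
    by (metis One_nat_def not0_implies_Suc)
  thus ?case
  proof cases
    case 3
    let ?p = "[:0, 1:] * freud_poly s (Suc m)"
    let ?q = "smult (weighted_integral s ((freud_poly s (Suc m))\<^sup>2) / weighted_integral s ((freud_poly s m)\<^sup>2)) (freud_poly s m)"
    have p: "degree (freud_poly s (Suc m)) = Suc m" "coeff (freud_poly s (Suc m)) (Suc m) = 1"
      using less.IH[of "Suc m"] 3 by simp_all
    hence p0: "freud_poly s (Suc m) \<noteq> 0" by force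
    have d: "degree ?p = n" using p p0 3 by simp
    have l: "coeff ?p n = 1" using p 3 by simp
    have "degree ?q \<le> m" using less.IH[of m] 3 by simp
    hence q: "degree ?q < n" using 3 by simp
    have "degree (?p - ?q) = n"
      using d q by (metis degree_add_eq_left degree_minus diff_conv_add_uminus)
    moreover have "coeff (?p - ?q) n = 1"
      using l coeff_eq_0[OF q] by simp
    ultimately show ?thesis using 3 by simp
  qed simp_all
qed

lemma degree_freud_poly: "degree (freud_poly s n) = n"
  and lead_coeff_freud_poly: "coeff (freud_poly s n) n = 1"
  using degree_freud_poly_and_lead_coeff[of s n] by auto

lemma freud_poly_nonzero: "freud_poly s n \<noteq> 0"
  using lead_coeff_freud_poly[of s n] by force

lemma freud_norm_pos: "0 < freud_norm s n"
  unfolding freud_norm_def by (intro weighted_integral_square_pos freud_poly_nonzero)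

lemma freud_beta_pos: "0 < n \<Longrightarrow> 0 < freud_beta s n"
  by (simp add: freud_beta_def freud_norm_pos)

lemma freud_beta_nonneg: "0 \<le> freud_beta s n"
  by (simp add: freud_beta_def freud_norm_pos less_imp_le)

lemma freud_beta_0: "freud_beta s 0 = 0"
  by (simp add: freud_beta_def)

lemma freud_norm_Suc: "freud_norm s (Suc n) = freud_beta s (Suc n) * freud_norm s n"
  using freud_norm_pos[of s n] by (simp add: freud_beta_def)

lemma poly_freud_poly_minus: "poly (freud_poly s n) (- x) = (- 1) ^ n * poly (freud_poly s n) x"
  by (induction s n rule: freud_poly.induct) (simp_all add: algebra_simps)

lemma weighted_integral_X_freud_poly_square: "weighted_integral s (freud_poly s n * ([:0, 1:] * freud_poly s n)) = 0"
  by (rule weighted_integral_odd) (simp add: poly_freud_poly_minus flip: power_mult_distrib)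

declare freud_poly.simps(3) [simp del]

text \<open>Multiplication by X is moved from the factor of index \<open>Suc m\<close> to the one of
  index \<open>j\<close>. For \<open>j = Suc m\<close> the integrand is odd; for
  \<open>j = m\<close> the two remaining terms cancel by the choice of the recurrence coefficient as
  a norm ratio; for smaller \<open>j\<close> every term vanishes by induction.\<close>

lemma freud_poly_orthogonal_less: "j < n \<Longrightarrow> weighted_integral s (freud_poly s n * freud_poly s j) = 0"
proof (induction n arbitrary: j rule: less_induct)
  case (less n)
  consider "n = 1" | m where "n = Suc (Suc m)"
    using less.prems by (metis One_nat_def not0_implies_Suc not_less0)
  thus ?case
  proof cases
    case 1
    thus ?thesis using less.prems by (intro weighted_integral_odd) auto
  next
    case 2
    have orth: "weighted_integral s (freud_poly s a * freud_poly s b) = 0" if "a \<noteq> b" "a < n" "b < n" for a b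
      using less.IH[of a b] less.IH[of b a] that by (cases "a < b") (auto simp: mult.commute)
    have "freud_poly s n = [:0, 1:] * freud_poly s (Suc m) - smult (freud_beta s (Suc m)) (freud_poly s m)"
      using X_times_freud_poly[of s "Suc m"] 2 by simp
    hence "freud_poly s n * freud_poly s j = freud_poly s (Suc m) * ([:0, 1:] * freud_poly s j) -
        smult (freud_beta s (Suc m)) (freud_poly s m * freud_poly s j)"
      by (simp only: left_diff_distrib right_diff_distrib mult_smult_left mult_smult_right mult_ac)
    hence eq: "weighted_integral s (freud_poly s n * freud_poly s j) =
        weighted_integral s (freud_poly s (Suc m) * ([:0, 1:] * freud_poly s j)) -
        freud_beta s (Suc m) * weighted_integral s (freud_poly s m * freud_poly s j)"
      by (simp add: weighted_integral_diff weighted_integral_smult)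
    show ?thesis
    proof (cases "j = Suc m")
      case True
      have "weighted_integral s (freud_poly s m * freud_poly s (Suc m)) = 0" using orth 2 by simp
      thus ?thesis unfolding eq using True by (simp add: weighted_integral_X_freud_poly_square del: mult_pCons_left)
    next
      case False
      have "weighted_integral s (freud_poly s (Suc m) * ([:0, 1:] * freud_poly s j)) =
          weighted_integral s (freud_poly s (Suc m) * freud_poly s (Suc j)) +
          freud_beta s j * weighted_integral s (freud_poly s (Suc m) * freud_poly s (j - 1))"
        unfolding X_times_freud_poly by (simp add: distrib_left weighted_integral_add weighted_integral_smult)
      also have "weighted_integral s (freud_poly s (Suc m) * freud_poly s (j - 1)) = 0"
        using less.prems False 2 by (intro orth) auto
      finally have *: "weighted_integral s (freud_poly s (Suc m) * ([:0, 1:] * freud_poly s j)) =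
          weighted_integral s (freud_poly s (Suc m) * freud_poly s (Suc j))" by simp
      show ?thesis
      proof (cases "j = m")
        case True
        have "freud_norm s (Suc m) = freud_beta s (Suc m) * freud_norm s m" by (rule freud_norm_Suc)
        thus ?thesis unfolding eq * using True
          by (simp add: freud_norm_def power2_eq_square)
      next
        assume "j \<noteq> m"
        thus ?thesis unfolding eq * using orth[of "Suc m" "Suc j"] orth[of m j] less.prems False 2
          by simp
      qed
    qed
  qed
qed

lemma freud_poly_orthogonal: "i \<noteq> j \<Longrightarrow> weighted_integral s (freud_poly s i * freud_poly s j) = 0"
  using freud_poly_orthogonal_less[of i j s] freud_poly_orthogonal_less[of j i s]
  by (cases "i < j") (auto simp: mult.commute)

lemma freud_poly_square: "weighted_integral s (freud_poly s n * freud_poly s n) = freud_norm s n"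
  by (simp add: freud_norm_def power2_eq_square)

text \<open>Monic polynomials of each degree span, so orthogonality to all of the lower ones passes to
  every polynomial of lower degree.\<close>
lemma weighted_integral_orthogonal_lower_degree:
  assumes P: "\<And>n. degree (P n) = n" "\<And>n. coeff (P n) n = 1"
    and orth: "\<And>j. j < n \<Longrightarrow> weighted_integral s (p * P j) = 0"
    and "q = 0 \<or> degree q < n"
  shows "weighted_integral s (p * q) = 0"
  using assms(4)
proof (induction "degree q" arbitrary: q rule: less_induct)
  case less
  show ?case
  proof (cases "q = 0")
    case False
    define d where "d = degree q"
    let ?r = "q - smult (lead_coeff q) (P d)"
    have "weighted_integral s (p * ?r) = 0"
    proof (cases "?r = 0")
      case False
      have "degree ?r \<le> d" using P by (intro degree_diff_le) (auto simp: d_def)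
      moreover have "coeff ?r d = 0" using P(2)[of d] P(1)[of d] by (simp add: d_def)
      ultimately have "degree ?r < d" using False
        by (metis eq_zero_or_degree_less)
      thus ?thesis using less \<open>q \<noteq> 0\<close> d_def by (intro less.hyps) auto
    qed (simp add: weighted_integral_0)
    moreover have "weighted_integral s (p * P d) = 0"
      using less.prems \<open>q \<noteq> 0\<close> d_def by (intro orth) auto
    ultimately show ?thesis
      by (simp add: right_diff_distrib weighted_integral_diff weighted_integral_smult)
  qed (simp add: weighted_integral_0)
qed

lemma freud_poly_orthogonal_degree:
  "q = 0 \<or> degree q < n \<Longrightarrow> weighted_integral s (freud_poly s n * q) = 0"
  by (rule weighted_integral_orthogonal_lower_degree[where P = "freud_poly s"])
    (auto simp: degree_freud_poly lead_coeff_freud_poly freud_poly_orthogonal)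

section \<open>Uniqueness and minimality of the monic orthogonal polynomials\<close>

lemma monic_diff_degree:
  fixes p q :: "real poly"
  assumes "degree p = n" "coeff p n = 1" "degree q = n" "coeff q n = 1"
  shows "p - q = 0 \<or> degree (p - q) < n"
proof -
  have "degree (p - q) \<le> n" "coeff (p - q) n = 0"
    using assms by (auto intro!: degree_diff_le)
  thus ?thesis by (metis eq_zero_or_degree_less)
qed

text \<open>The difference of two monic orthogonal polynomials of degree \<open>n\<close> has lower
  degree, hence is orthogonal to both of them and so to itself.\<close>

lemma monic_orthogonal_polys_unique:
  assumes "monic_orthogonal_polys t P"
  shows "P n = freud_poly t n"
proof -
  have P: "degree (P n) = n" "coeff (P n) n = 1" for n
    using assms unfolding monic_orthogonal_polys_def by metis+
  have orth: "weighted_integral t (P j * P k) = 0" if "j \<noteq> k" for j k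
    using assms that by (simp add: monic_orthogonal_polys_def weighted_integral_def)
  let ?r = "P n - freud_poly t n"
  have r: "?r = 0 \<or> degree ?r < n"
    by (rule monic_diff_degree) (simp_all add: P degree_freud_poly lead_coeff_freud_poly)
  have "weighted_integral t (P n * ?r) = 0"
    by (rule weighted_integral_orthogonal_lower_degree[of P, OF P _ r]) (simp add: orth)
  moreover have "weighted_integral t (freud_poly t n * ?r) = 0"
    using r by (rule freud_poly_orthogonal_degree)
  ultimately have "weighted_integral t (?r\<^sup>2) = 0"
    by (simp add: power2_eq_square left_diff_distrib weighted_integral_diff)
  hence "?r = 0" using weighted_integral_square_pos[of ?r t] by fastforce
  thus ?thesis by simp
qed

lemma norm_sq_eq_freud_norm:
  assumes "monic_orthogonal_polys t P"
  shows "norm_sq t (P n) = freud_norm t n"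
  unfolding monic_orthogonal_polys_unique[OF assms]
  by (simp add: norm_sq_def freud_norm_def weighted_integral_def poly_power)

text \<open>Pythagoras: \<open>q\<close> is the orthogonal polynomial plus an orthogonal remainder
  of lower degree. The extremal property permits comparison of norms at different parameters by
  using the polynomial of one parameter as a competitor at the other.\<close>

lemma freud_norm_minimal:
  assumes "degree q = n" "coeff q n = 1"
  shows "freud_norm s n \<le> weighted_integral s (q\<^sup>2)"
proof -
  define r where "r = q - freud_poly s n"
  have "r = 0 \<or> degree r < n"
    unfolding r_def
    by (rule monic_diff_degree) (simp_all add: assms degree_freud_poly lead_coeff_freud_poly)
  hence "weighted_integral s (freud_poly s n * r) = 0" by (rule freud_poly_orthogonal_degree)
  moreover have "q\<^sup>2 = (freud_poly s n)\<^sup>2 + (freud_poly s n * r + freud_poly s n * r) + r\<^sup>2"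
  proof -
    have "q = freud_poly s n + r" by (simp add: r_def)
    thus ?thesis by (simp add: power2_eq_square algebra_simps)
  qed
  ultimately have "weighted_integral s (q\<^sup>2) = freud_norm s n + weighted_integral s (r\<^sup>2)"
    by (simp only: weighted_integral_add freud_norm_def)
  thus ?thesis using weighted_integral_square_nonneg[of s r] by simp
qed

text \<open>The weight has s-derivative x^2 times itself, so this is the first-order change of the
  squared norm with the polynomial held fixed.\<close>

lemma weighted_integral_X_freud_poly_squared:
  "weighted_integral s (([:0, 1:] * freud_poly s n)\<^sup>2) = (freud_beta s (Suc n) + freud_beta s n) * freud_norm s n"
proof (cases n)
  case 0
  have "weighted_integral s (([:0, 1:] * freud_poly s n)\<^sup>2) = freud_norm s (Suc 0)"
    using 0 by (simp add: freud_norm_def)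
  thus ?thesis using 0 by (simp add: freud_norm_Suc freud_beta_0)
next
  case (Suc m)
  show ?thesis
    unfolding X_times_freud_poly power2_eq_square using freud_norm_Suc[of s m] Suc
    by (simp add: distrib_left distrib_right weighted_integral_add weighted_integral_smult freud_poly_orthogonal
        freud_poly_square freud_norm_Suc)
qed

text \<open>The integral of (p_n p_(n-1))' against the weight is computed in two ways. Comparing
  leading coefficients gives n h_(n-1); integrating by parts gives the factor 4 x^3 - 2 s x, which
  the recurrence reduces to norms.\<close>

theorem freud_string_equation:
  assumes "0 < n"
  shows "freud_beta s n * (4 * (freud_beta s (Suc n) + freud_beta s n + freud_beta s (n - 1)) - 2 * s)
    = real n"
proof -
  obtain m where n: "n = Suc m" using assms by (cases n) auto
  let ?p = "freud_poly s" and ?h = "freud_norm s" and ?b = "freud_beta s" and ?X = "[:0, 1:] :: real poly"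
  have X: "?X * ?p k = ?p (Suc k) + smult (?b k) (?p (k - 1))" for k
    by (rule X_times_freud_poly)
  have dm: "pderiv (?p m) = 0 \<or> degree (pderiv (?p m)) < n"
    using degree_pderiv[of "?p m"] degree_freud_poly[of s m] n by auto
  have dn: "pderiv (?p n) - smult (real n) (?p m) = 0 \<or> degree (pderiv (?p n) - smult (real n) (?p m)) < m"
  proof -
    have "degree (pderiv (?p n) - smult (real n) (?p m)) \<le> m"
      using degree_pderiv[of "?p n"] degree_freud_poly n by (intro degree_diff_le) auto
    moreover have "coeff (pderiv (?p n) - smult (real n) (?p m)) m = 0"
      using lead_coeff_freud_poly[of s n] lead_coeff_freud_poly[of s m] n by (simp add: coeff_pderiv)
    ultimately show ?thesis by (metis eq_zero_or_degree_less)
  qed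
  have "weighted_integral s (?p m * (pderiv (?p n) - smult (real n) (?p m))) = 0"
    by (rule freud_poly_orthogonal_degree[OF dn])
  hence "weighted_integral s (?p m * pderiv (?p n)) = real n * ?h m"
    by (simp add: right_diff_distrib weighted_integral_diff weighted_integral_smult freud_poly_square)
  moreover have "weighted_integral s (?p n * pderiv (?p m)) = 0"
    by (rule freud_poly_orthogonal_degree[OF dm])
  ultimately have "weighted_integral s (pderiv (?p n * ?p m)) = real n * ?h m"
    by (simp add: pderiv_mult weighted_integral_add)
  moreover have "?p n * ?p m * [:0, - 2 * s, 0, 4:] =
      smult 4 ((?X * (?X * ?p n)) * (?X * ?p m)) - smult (2 * s) (?p n * (?X * ?p m))"
  proof -
    have "[:0, - 2 * s, 0, 4:] = smult 4 (?X * ?X * ?X) - smult (2 * s) ?X" by simp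
    thus ?thesis by (simp only: right_diff_distrib mult_smult_right mult_smult_left mult_ac)
  qed
  moreover have "weighted_integral s (?p n * (?X * ?p m)) = ?h n"
    unfolding X using n by (simp add: distrib_left weighted_integral_add weighted_integral_smult freud_poly_orthogonal freud_poly_square)
  moreover have "weighted_integral s ((?X * (?X * ?p n)) * (?X * ?p m)) = (?b (Suc n) + ?b n + ?b m) * ?h n"
  proof -
    have "?X * (?X * ?p n) = ?X * ?p (Suc n) + smult (?b n) (?X * ?p (n - 1))"
      unfolding X[of n] by (simp only: distrib_left mult_smult_right)
    also have "\<dots> = ?p (Suc (Suc n)) + smult (?b (Suc n) + ?b n) (?p n) + smult (?b n * ?b m) (?p (m - 1))"
      unfolding X using n by (simp add: smult_add_left smult_add_right)
    finally have 1: "?X * (?X * ?p n) = \<dots>" .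
    \<comment> \<open>For \<open>m = 0\<close> the index \<open>m - 1\<close> is truncated; both
      sides are then 0 because beta_0 = 0.\<close>
    have "?b n * ?b m * (?b m * ?h (m - 1)) = ?b m * (?b n * ?h m)"
      using freud_norm_Suc[of s "m - 1"] by (cases m) (simp_all add: freud_beta_0)
    also have "?b n * ?h m = ?h n" using n by (simp add: freud_norm_Suc)
    finally show ?thesis
      unfolding 1 unfolding X using n
      by (simp add: distrib_left distrib_right weighted_integral_add weighted_integral_smult freud_poly_orthogonal
        freud_poly_square mult.assoc)
  qed
  ultimately have "4 * ((?b (Suc n) + ?b n + ?b m) * ?h n) - 2 * s * ?h n = real n * ?h m"
    using weighted_integral_pderiv[of s "?p n * ?p m"] by (simp only: weighted_integral_diff weighted_integral_smult)
  also have "?h n = ?b n * ?h m" using n by (simp add: freud_norm_Suc)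
  finally have "(?b n * (4 * (?b (Suc n) + ?b n + ?b m) - 2 * s)) * ?h m = real n * ?h m"
    by (simp add: algebra_simps)
  thus ?thesis using freud_norm_pos[of s m] n by simp
qed

section \<open>Dependence on the parameter\<close>

text \<open>Dropping the nonnegative neighbours from the string equation leaves a quadratic
  inequality for beta_n alone. The bound overshoots the true size sqrt(n/12) but is uniform in
  \<open>s \<le> t\<close> and small enough for the contraction.\<close>

lemma freud_beta_le:
  assumes "s \<le> t" "0 \<le> t"
  shows "freud_beta s n \<le> (t + sqrt (real n)) / 2"
proof (cases "n = 0")
  case False
  let ?b = "freud_beta s n"
  have b: "0 < ?b" using False by (simp add: freud_beta_pos)
  have "?b * (4 * ?b - 2 * t) \<le>
      ?b * (4 * (freud_beta s (Suc n) + ?b + freud_beta s (n - 1)) - 2 * s)"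
    using b assms freud_beta_nonneg[of s "Suc n"] freud_beta_nonneg[of s "n - 1"]
    by (intro mult_left_mono) auto
  also have "\<dots> = real n" using False by (intro freud_string_equation) simp
  finally have le: "?b * (4 * ?b - 2 * t) \<le> sqrt (real n) * sqrt (real n)" by simp
  show ?thesis
  proof (rule ccontr)
    assume "\<not> ?thesis"
    hence *: "t + sqrt (real n) < 2 * ?b" by simp
    have "0 < sqrt (real n)" using False by simp
    hence "sqrt (real n) * sqrt (real n) < (2 * ?b) * (2 * ?b - t)"
      using * assms b by (intro mult_strict_mono) auto
    thus False using le by (simp add: algebra_simps)
  qed
qed (use assms in \<open>simp add: freud_beta_0\<close>)

text \<open>The recurrence coefficients are bounded uniformly in \<open>s \<le> t\<close>, so one
  constant serves the whole half-line of parameters. This supplies a remainder bound independent of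
  \<open>s\<close> in the variation of the norm.\<close>

lemma freud_poly_square_le:
  assumes "0 \<le> t"
  shows "\<exists>C\<ge>0. \<forall>s\<le>t. \<forall>x. (poly (freud_poly s n) x)\<^sup>2 \<le> C * (1 + x\<^sup>2) ^ n"
proof (induction n rule: less_induct)
  case (less n)
  consider "n = 0" | "n = 1" | m where "n = Suc (Suc m)"
    by (metis One_nat_def not0_implies_Suc)
  thus ?case
  proof cases
    case 1
    thus ?thesis by (intro exI[of _ 1]) auto
  next
    case 2
    thus ?thesis by (intro exI[of _ 1]) auto
  next
    case 3
    obtain C1 where C1: "0 \<le> C1" "\<And>s x. s \<le> t \<Longrightarrow> (poly (freud_poly s (Suc m)) x)\<^sup>2 \<le> C1 * (1 + x\<^sup>2) ^ Suc m"
      using less.IH[of "Suc m"] 3 by auto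
    obtain C0 where C0: "0 \<le> C0" "\<And>s x. s \<le> t \<Longrightarrow> (poly (freud_poly s m) x)\<^sup>2 \<le> C0 * (1 + x\<^sup>2) ^ m"
      using less.IH[of m] 3 by auto
    define B where "B = (t + sqrt (real (Suc m))) / 2"
    have "(poly (freud_poly s n) x)\<^sup>2 \<le> (2 * C1 + 2 * B\<^sup>2 * C0) * (1 + x\<^sup>2) ^ n" if "s \<le> t" for s x
    proof -
      let ?b = "freud_beta s (Suc m)" and ?p = "\<lambda>k. poly (freud_poly s k) x" and ?y = "1 + x\<^sup>2"
      have y: "1 \<le> ?y" by simp
      have eq: "?p n = x * ?p (Suc m) - ?b * ?p m"
        using arg_cong[OF X_times_freud_poly[of s "Suc m"], of "\<lambda>q. poly q x"] 3 by simp
      \<comment> \<open>The identity (a - b)^2 = 2 a^2 + 2 b^2 - (a + b)^2, from which the last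
        square is dropped.\<close>
      have "(?p n)\<^sup>2 = 2 * (x\<^sup>2 * (?p (Suc m))\<^sup>2) + 2 * (?b\<^sup>2 * (?p m)\<^sup>2) - (x * ?p (Suc m) + ?b * ?p m)\<^sup>2"
        unfolding eq by (simp add: power2_eq_square algebra_simps)
      hence "(?p n)\<^sup>2 \<le> 2 * (x\<^sup>2 * (?p (Suc m))\<^sup>2) + 2 * (?b\<^sup>2 * (?p m)\<^sup>2)"
        by simp
      moreover have "x\<^sup>2 * (?p (Suc m))\<^sup>2 \<le> ?y * (C1 * ?y ^ Suc m)"
        using C1(2)[OF that] by (intro mult_mono) auto
      moreover have "?b\<^sup>2 * (?p m)\<^sup>2 \<le> B\<^sup>2 * (C0 * ?y ^ n)"
      proof (intro mult_mono power_mono)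
        show "?b \<le> B" unfolding B_def using that assms by (rule freud_beta_le)
        have "(?p m)\<^sup>2 \<le> C0 * ?y ^ m" using C0(2)[OF that] .
        also have "\<dots> \<le> C0 * ?y ^ n"
          using 3 y C0(1) by (intro mult_left_mono power_increasing) auto
        finally show "(?p m)\<^sup>2 \<le> C0 * ?y ^ n" .
      qed (auto simp: freud_beta_nonneg)
      moreover have "?y * (C1 * ?y ^ Suc m) = C1 * ?y ^ n" using 3 by simp
      ultimately show ?thesis by (simp only: distrib_right)
    qed
    moreover have "0 \<le> 2 * C1 + 2 * B\<^sup>2 * C0" using C0(1) C1(1) by simp
    ultimately show ?thesis by blast
  qed
qed

lemma exp_le_quadratic:
  fixes y :: real
  shows "exp y \<le> 1 + y + y\<^sup>2 * exp \<bar>y\<bar>"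
proof -
  obtain z where z: "\<bar>z\<bar> \<le> \<bar>y\<bar>" "exp y = (\<Sum>m<2. y ^ m / fact m) + exp z / fact 2 * y ^ 2"
    by (rule exE[OF Maclaurin_exp_le[of y 2]]) blast
  have "exp z / 2 \<le> exp \<bar>y\<bar>"
    by (rule order_trans[of _ "exp z"]) (use z(1) in auto)
  hence "exp z / 2 * y\<^sup>2 \<le> exp \<bar>y\<bar> * y\<^sup>2" by (rule mult_right_mono) simp
  thus ?thesis using z(2) by (simp add: numeral_2_eq_2 mult.commute)
qed

text \<open>The polynomial at \<open>s\<close> competes at \<open>s'\<close>, and the quotient of
  the weights is expanded to second order. Only an upper bound results, but it holds for both signs
  of \<open>s' - s\<close>.\<close>

lemma freud_norm_variation:
  assumes "0 \<le> t"
  shows "\<exists>M\<ge>0. \<forall>s s'. s \<le> t \<longrightarrow> \<bar>s' - s\<bar> \<le> 1 \<longrightarrow>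
    freud_norm s' n \<le> freud_norm s n +
      (s' - s) * ((freud_beta s (Suc n) + freud_beta s n) * freud_norm s n) + M * (s' - s)\<^sup>2"
proof -
  obtain C where C: "0 \<le> C" "\<And>s x. s \<le> t \<Longrightarrow> (poly (freud_poly s n) x)\<^sup>2 \<le> C * (1 + x\<^sup>2) ^ n"
    using freud_poly_square_le[OF assms] by blast
  define R where "R = smult C ([:1, 0, 1:] ^ n * [:0, 0, 0, 0, 1:])"
  have R: "poly R x = C * (1 + x\<^sup>2) ^ n * x ^ 4" for x
    by (simp add: R_def power2_eq_square power4_eq_xxxx algebra_simps)
  have "freud_norm s' n \<le> freud_norm s n +
      (s' - s) * ((freud_beta s (Suc n) + freud_beta s n) * freud_norm s n) + weighted_integral (t + 1) R * (s' - s)\<^sup>2"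
    if s: "s \<le> t" "\<bar>s' - s\<bar> \<le> 1" for s s'
  proof -
    define d where "d = s' - s"
    let ?p = "freud_poly s n" and ?w = quartic_weight
    let ?q = "?p\<^sup>2 + smult d (([:0, 1:] * ?p)\<^sup>2)"
    have "freud_norm s' n \<le> weighted_integral s' (?p\<^sup>2)"
      by (intro freud_norm_minimal degree_freud_poly lead_coeff_freud_poly)
    also have "\<dots> \<le> (\<integral>x. poly ?q x * ?w s x + d\<^sup>2 * (poly R x * ?w (t + 1) x) \<partial>lborel)"
      unfolding weighted_integral_def
    proof (rule integral_mono)
      show "integrable lborel (\<lambda>x. poly ?q x * ?w s x + d\<^sup>2 * (poly R x * ?w (t + 1) x))"
        by (intro Bochner_Integration.integrable_add integrable_mult_right integrable_poly_quartic_weight)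
      fix x :: real
      \<comment> \<open>The exponential in the Taylor remainder is absorbed by raising the
        parameter: s + |d| is at most t + 1.\<close>
      have w: "?w s x * exp \<bar>d * x\<^sup>2\<bar> \<le> ?w (t + 1) x"
      proof -
        have "s * x\<^sup>2 + \<bar>d\<bar> * x\<^sup>2 \<le> (t + 1) * x\<^sup>2"
          using s unfolding d_def distrib_right[symmetric] by (intro mult_right_mono) auto
        thus ?thesis by (simp add: quartic_weight_def abs_mult flip: exp_add)
      qed
      have "?w s' x = ?w s x * exp (d * x\<^sup>2)"
        by (simp add: quartic_weight_def d_def algebra_simps flip: exp_add)
      also have "\<dots> \<le> ?w s x * (1 + d * x\<^sup>2 + (d * x\<^sup>2)\<^sup>2 * exp \<bar>d * x\<^sup>2\<bar>)"
        by (intro mult_left_mono exp_le_quadratic quartic_weight_nonneg)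
      also have "\<dots> = ?w s x * (1 + d * x\<^sup>2) + (d * x\<^sup>2)\<^sup>2 * (?w s x * exp \<bar>d * x\<^sup>2\<bar>)"
        by (simp add: algebra_simps)
      also have "\<dots> \<le> ?w s x * (1 + d * x\<^sup>2) + (d * x\<^sup>2)\<^sup>2 * ?w (t + 1) x"
        by (intro add_left_mono mult_left_mono w) simp
      finally have "(poly ?p x)\<^sup>2 * ?w s' x \<le>
          (poly ?p x)\<^sup>2 * (?w s x * (1 + d * x\<^sup>2) + (d * x\<^sup>2)\<^sup>2 * ?w (t + 1) x)"
        by (rule mult_left_mono) simp
      also have "\<dots> = poly ?q x * ?w s x + d\<^sup>2 * (((poly ?p x)\<^sup>2 * x ^ 4) * ?w (t + 1) x)"
        by (simp add: poly_power power_mult_distrib algebra_simps)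
      also have "\<dots> \<le> poly ?q x * ?w s x + d\<^sup>2 * (poly R x * ?w (t + 1) x)"
        unfolding R using C(2)[OF s(1)]
        by (intro add_left_mono mult_left_mono mult_right_mono) (auto simp: quartic_weight_nonneg)
      finally show "poly (?p\<^sup>2) x * ?w s' x \<le> poly ?q x * ?w s x + d\<^sup>2 * (poly R x * ?w (t + 1) x)"
        by (simp add: poly_power)
    qed (rule integrable_poly_quartic_weight)
    also have "\<dots> = weighted_integral s ?q + d\<^sup>2 * weighted_integral (t + 1) R"
      unfolding weighted_integral_def
      by (subst Bochner_Integration.integral_add) (simp_all only: integral_mult_right_zero integrable_mult_right integrable_poly_quartic_weight)
    also have "weighted_integral s ?q = freud_norm s n + d * ((freud_beta s (Suc n) + freud_beta s n) * freud_norm s n)"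
      unfolding weighted_integral_add weighted_integral_smult weighted_integral_X_freud_poly_squared freud_norm_def ..
    finally show ?thesis by (simp add: d_def mult.commute)
  qed
  moreover have "0 \<le> weighted_integral (t + 1) R"
    unfolding weighted_integral_def R using C(1) by (intro Bochner_Integration.integral_nonneg) (simp add: quartic_weight_nonneg)
  ultimately show ?thesis by blast
qed

lemma quartic_weight_mono: "s \<le> s' \<Longrightarrow> quartic_weight s x \<le> quartic_weight s' x"
  by (simp add: quartic_weight_def mult_right_mono)

text \<open>The polynomial at \<open>s'\<close> competes at \<open>s\<close>. On an interval
  starting at \<open>a\<close> the norm at \<open>a\<close> is therefore a positive lower bound,
  which is what dividing by the norm requires.\<close>

lemma freud_norm_mono:
  assumes "s \<le> s'"
  shows "freud_norm s n \<le> freud_norm s' n"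
proof -
  have "freud_norm s n \<le> weighted_integral s ((freud_poly s' n)\<^sup>2)"
    by (intro freud_norm_minimal degree_freud_poly lead_coeff_freud_poly)
  also have "\<dots> \<le> freud_norm s' n"
    unfolding weighted_integral_def freud_norm_def using assms
    by (intro integral_mono integrable_poly_quartic_weight mult_left_mono)
      (auto simp: poly_power quartic_weight_mono)
  finally show ?thesis .
qed

text \<open>The bound ln y <= y - 1 has the direction needed to carry the one-sided estimate from
  the norm to its logarithm.\<close>

lemma ln_freud_norm_variation:
  assumes "0 \<le> t"
  shows "\<exists>M. \<forall>s\<in>{a..t}. \<forall>s'\<in>{a..t}. \<bar>s' - s\<bar> \<le> 1 \<longrightarrow>
    ln (freud_norm s' n) - ln (freud_norm s n) \<le>
      (freud_beta s (Suc n) + freud_beta s n) * (s' - s) + M * (s' - s)\<^sup>2"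
proof -
  obtain M where M: "0 \<le> M" "\<And>s s'. s \<le> t \<Longrightarrow> \<bar>s' - s\<bar> \<le> 1 \<Longrightarrow>
    freud_norm s' n \<le> freud_norm s n +
      (s' - s) * ((freud_beta s (Suc n) + freud_beta s n) * freud_norm s n) + M * (s' - s)\<^sup>2"
    using freud_norm_variation[OF assms, of n] by blast
  have "ln (freud_norm s' n) - ln (freud_norm s n) \<le>
      (freud_beta s (Suc n) + freud_beta s n) * (s' - s) + M / freud_norm a n * (s' - s)\<^sup>2"
    if s: "a \<le> s" "s \<le> t" "\<bar>s' - s\<bar> \<le> 1" for s s'
  proof -
    let ?h = "freud_norm s n"
    have h: "0 < ?h" by (rule freud_norm_pos)
    have "ln (freud_norm s' n) - ln ?h = ln (freud_norm s' n / ?h)"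
      by (simp add: ln_divide_pos freud_norm_pos)
    also have "\<dots> \<le> freud_norm s' n / ?h - 1"
      by (intro ln_le_minus_one divide_pos_pos freud_norm_pos)
    also have "\<dots> \<le> (?h + (s' - s) * ((freud_beta s (Suc n) + freud_beta s n) * ?h) + M * (s' - s)\<^sup>2) / ?h - 1"
      using M(2)[OF s(2,3)] h by (intro diff_right_mono divide_right_mono) auto
    also have "\<dots> = (freud_beta s (Suc n) + freud_beta s n) * (s' - s) + M * (s' - s)\<^sup>2 / ?h"
      using h by (simp add: add_divide_distrib)
    also have "M * (s' - s)\<^sup>2 / ?h \<le> M * (s' - s)\<^sup>2 / freud_norm a n"
      using freud_norm_mono[OF s(1)] M(1) freud_norm_pos by (intro divide_left_mono) auto
    finally show ?thesis by simp
  qed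
  thus ?thesis by (intro exI[of _ "M / freud_norm a n"]) auto
qed

text \<open>The one-sided increments compared at every scale replace differentiability of \<open>L\<close>: on a
  subdivision of mesh \<open>\<eta>\<close> the errors add up to at most \<open>\<epsilon> (b - a)\<close>.\<close>
lemma nonincreasing_from_small_increments:
  fixes f :: "real \<Rightarrow> real"
  assumes "a \<le> b"
    and incr: "\<And>e. 0 < e \<Longrightarrow> \<exists>\<eta>>0. \<forall>s s'. a \<le> s \<longrightarrow> s \<le> s' \<longrightarrow> s' \<le> b \<longrightarrow> s' - s < \<eta> \<longrightarrow>
      f s' - f s \<le> e * (s' - s)"
  shows "f b \<le> f a"
proof (rule field_le_epsilon)
  fix e :: real
  assume e: "0 < e"
  define e' where "e' = e / (b - a + 1)"
  have e': "0 < e'" using e assms(1) by (simp add: e'_def)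
  obtain \<eta> where \<eta>: "0 < \<eta>" "\<And>s s'. a \<le> s \<Longrightarrow> s \<le> s' \<Longrightarrow> s' \<le> b \<Longrightarrow> s' - s < \<eta> \<Longrightarrow>
      f s' - f s \<le> e' * (s' - s)"
    using incr[OF e'] by blast
  obtain N :: nat where N: "(b - a) / \<eta> < real N"
    using reals_Archimedean2 by blast
  have N0: "0 < real N"
    using N assms(1) \<eta>(1) by (intro le_less_trans[OF _ N]) simp
  define u where "u k = a + (b - a) * (real k / real N)" for k
  have step: "u (Suc k) - u k = (b - a) / real N" for k
    using N0 by (simp add: u_def field_simps)
  have "f (u k) - f a \<le> e' * (u k - a)" if "k \<le> N" for k
    using that
  proof (induction k)
    case 0
    thus ?case by (simp add: u_def)
  next
    case (Suc k)
    have "u (Suc k) \<le> a + (b - a) * 1"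
      unfolding u_def using Suc.prems N0 assms(1) by (intro add_left_mono mult_left_mono) auto
    moreover have "a \<le> u k" using assms(1) by (simp add: u_def)
    moreover have "u k \<le> u (Suc k)" using step[of k] assms(1) N0 by (smt (verit) divide_nonneg_nonneg)
    moreover have "(b - a) / real N < \<eta>"
      using N \<eta>(1) N0 by (simp add: field_simps)
    ultimately have "f (u (Suc k)) - f (u k) \<le> e' * (u (Suc k) - u k)"
      using step[of k] by (intro \<eta>(2)) auto
    thus ?case using Suc by (simp add: algebra_simps)
  qed
  from this[of N] have "f b - f a \<le> e' * (b - a)"
    using N0 by (simp add: u_def)
  also have "\<dots> \<le> e' * (b - a + 1)" using e' by simp
  also have "\<dots> = e" using assms(1) by (simp add: e'_def)
  finally show "f b \<le> f a + e" by simp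
qed

text \<open>The mean value theorem turns the increment of \<open>G\<close> into a value of
  \<open>g\<close>, and uniform continuity moves that value back to the left end of the subinterval.
  Thus \<open>L - G\<close> has increments of at most \<open>e\<close> times the step.\<close>

lemma increment_le_of_slope_le:
  fixes L G d g :: "real \<Rightarrow> real"
  assumes ab: "a \<le> b"
    and L: "\<And>s s'. s \<in> {a..b} \<Longrightarrow> s' \<in> {a..b} \<Longrightarrow> \<bar>s' - s\<bar> \<le> 1 \<Longrightarrow>
      L s' - L s \<le> d s * (s' - s) + M * (s' - s)\<^sup>2"
    and G: "\<And>s. s \<in> {a..b} \<Longrightarrow> (G has_real_derivative g s) (at s)"
    and g: "continuous_on {a..b} g"
    and d: "\<And>s. s \<in> {a..b} \<Longrightarrow> d s \<le> g s"
  shows "L b - L a \<le> G b - G a"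
proof -
  have "L b - G b \<le> L a - G a"
  proof (rule nonincreasing_from_small_increments[where f = "\<lambda>s. L s - G s", OF ab])
    fix e :: real
    assume e: "0 < e"
    have "uniformly_continuous_on {a..b} g"
      using g by (intro compact_uniformly_continuous) auto
    then obtain \<eta>1 where \<eta>1: "0 < \<eta>1" "\<And>x y. x \<in> {a..b} \<Longrightarrow> y \<in> {a..b} \<Longrightarrow> dist x y < \<eta>1 \<Longrightarrow> dist (g x) (g y) < e / 2"
      using e unfolding uniformly_continuous_on_def by (metis half_gt_zero)
    \<comment> \<open>The error \<open>e\<close> is split in halves: \<open>\<eta>1\<close> controls
      the oscillation of \<open>g\<close>, and the last entry makes the quadratic term at most e/2
      per unit length.\<close>
    define \<eta> where "\<eta> = Min {\<eta>1, 1, e / (2 * (\<bar>M\<bar> + 1))}"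
    have \<eta>: "0 < \<eta>" "\<eta> \<le> \<eta>1" "\<eta> \<le> 1" "\<eta> \<le> e / (2 * (\<bar>M\<bar> + 1))"
      using \<eta>1 e by (auto simp: \<eta>_def)
    have "L s' - G s' - (L s - G s) \<le> e * (s' - s)"
      if s: "a \<le> s" "s \<le> s'" "s' \<le> b" "s' - s < \<eta>" for s s'
    proof (cases "s = s'")
      case False
      hence lt: "s < s'" using s by simp
      obtain z where z: "s < z" "z < s'" "G s' - G s = (s' - s) * g z"
        using MVT2[OF lt, of G g] G s by auto
      have "dist (g s) (g z) < e / 2"
        using z s \<eta> by (intro \<eta>1(2)) (auto simp: dist_real_def)
      hence gz: "g s - g z \<le> e / 2" unfolding dist_real_def by linarith
      have "M * (s' - s) \<le> (\<bar>M\<bar> + 1) * (e / (2 * (\<bar>M\<bar> + 1)))"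
        using s \<eta> lt by (intro mult_mono) auto
      also have "\<dots> = e / 2" by (simp add: field_simps)
      finally have M: "M * (s' - s) \<le> e / 2" .
      have "L s' - G s' - (L s - G s) \<le> d s * (s' - s) + M * (s' - s)\<^sup>2 - (s' - s) * g z"
        using L[of s s'] s \<eta> z(3) by auto
      also have "\<dots> = (d s - g z + M * (s' - s)) * (s' - s)"
        by (simp add: power2_eq_square algebra_simps)
      also have "\<dots> \<le> e * (s' - s)"
        using gz M d[of s] s by (intro mult_right_mono) auto
      finally show ?thesis .
    qed simp
    thus "\<exists>\<eta>>0. \<forall>s s'. a \<le> s \<longrightarrow> s \<le> s' \<longrightarrow> s' \<le> b \<longrightarrow> s' - s < \<eta> \<longrightarrow>
      L s' - G s' - (L s - G s) \<le> e * (s' - s)"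
      using \<eta>(1) by blast
  qed
  thus ?thesis by simp
qed

text \<open>Reflection of the parameter turns the upper estimate into a lower one. Forward steps of
  the reflected function are backward steps of \<open>L\<close>, so here the hypothesis on
  \<open>L\<close> is used with \<open>s' - s\<close> negative.\<close>

lemma increment_ge_of_slope_ge:
  fixes L G d g :: "real \<Rightarrow> real"
  assumes ab: "a \<le> b"
    and L: "\<And>s s'. s \<in> {a..b} \<Longrightarrow> s' \<in> {a..b} \<Longrightarrow> \<bar>s' - s\<bar> \<le> 1 \<Longrightarrow>
      L s' - L s \<le> d s * (s' - s) + M * (s' - s)\<^sup>2"
    and G: "\<And>s. s \<in> {a..b} \<Longrightarrow> (G has_real_derivative g s) (at s)"
    and g: "continuous_on {a..b} g"
    and d: "\<And>s. s \<in> {a..b} \<Longrightarrow> g s \<le> d s"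
  shows "G b - G a \<le> L b - L a"
proof -
  have "L (- (- a)) - L (- (- b)) \<le> G (- (- a)) - G (- (- b))"
  proof (rule increment_le_of_slope_le[where L = "\<lambda>s. L (- s)" and d = "\<lambda>s. - d (- s)" and G = "\<lambda>s. G (- s)"
        and g = "\<lambda>s. - g (- s)" and a = "- b" and b = "- a"])
    fix s s' assume s: "s \<in> {- b..- a}" "s' \<in> {- b..- a}" "\<bar>s' - s\<bar> \<le> 1"
    have "L (- s') - L (- s) \<le> d (- s) * (- s' - - s) + M * (- s' - - s)\<^sup>2"
      using s by (intro L) auto
    thus "L (- s') - L (- s) \<le> - d (- s) * (s' - s) + M * (s' - s)\<^sup>2"
      by (simp add: algebra_simps power2_commute)
  next
    fix s assume "s \<in> {- b..- a}"
    hence "(G has_real_derivative g (- s)) (at (- s))" by (intro G) auto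
    thus "((\<lambda>s. G (- s)) has_real_derivative - g (- s)) (at s)" by (simp add: DERIV_mirror)
  next
    show "continuous_on {- b..- a} (\<lambda>s. - g (- s))"
      by (intro continuous_on_minus continuous_on_compose2[OF g] continuous_intros) auto
  qed (use ab d in auto)
  thus ?thesis by simp
qed

section \<open>Limits of the norms as the parameter tends to minus infinity\<close>

lemma gaussian_moments:
  assumes "0 < T"
  shows "integrable lborel (\<lambda>x. exp (- T * x\<^sup>2))"
    and "(\<integral>x. exp (- T * x\<^sup>2) \<partial>lborel) = sqrt (pi / T)"
    and "integrable lborel (\<lambda>x. x ^ 4 * exp (- T * x\<^sup>2))"
    and "(\<integral>x. x ^ 4 * exp (- T * x\<^sup>2) \<partial>lborel) = sqrt (pi / T) * (3 / (4 * T\<^sup>2))"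
proof -
  \<comment> \<open>With variance 1/(2T) the Gaussian is a multiple of the normal density; its
    fourth moment is 3 \<sigma>^4 = 3/(4 T^2).\<close>
  define \<sigma> where "\<sigma> = sqrt (1 / (2 * T))"
  have \<sigma>: "0 < \<sigma>" "\<sigma>\<^sup>2 = 1 / (2 * T)" using assms by (simp_all add: \<sigma>_def)
  have eq: "exp (- T * x\<^sup>2) = sqrt (pi / T) * normal_density 0 \<sigma> x" for x
    using assms \<sigma>(2) by (simp add: normal_density_def)
  have m: "has_bochner_integral lborel (\<lambda>x. normal_density 0 \<sigma> x * x ^ 4) (3 / (4 * T\<^sup>2))"
    using normal_moment_even[OF \<sigma>(1), of 0 2] \<sigma>(2) by (simp add: fact_numeral power_mult_distrib)
  show "integrable lborel (\<lambda>x. exp (- T * x\<^sup>2))"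
    unfolding eq using \<sigma> by simp
  show "(\<integral>x. exp (- T * x\<^sup>2) \<partial>lborel) = sqrt (pi / T)"
    unfolding eq using \<sigma> by simp
  have eq4: "x ^ 4 * exp (- T * x\<^sup>2) = sqrt (pi / T) * (normal_density 0 \<sigma> x * x ^ 4)" for x
    unfolding eq by (simp add: mult_ac)
  show "integrable lborel (\<lambda>x. x ^ 4 * exp (- T * x\<^sup>2))"
    unfolding eq4 using m by (intro integrable_mult_right) (rule integrable.intros)
  show "(\<integral>x. x ^ 4 * exp (- T * x\<^sup>2) \<partial>lborel) = sqrt (pi / T) * (3 / (4 * T\<^sup>2))"
    unfolding eq4 integral_mult_right_zero using m by (simp add: has_bochner_integral_integral_eq)
qed

text \<open>The quartic factor lies between 1 - x^4 and 1, so the two bounds are Gaussian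
  moments.\<close>

lemma freud_norm_0_bounds:
  assumes "0 < T"
  shows "freud_norm (- T) 0 \<le> sqrt (pi / T)"
    and "sqrt (pi / T) * (1 - 3 / (4 * T\<^sup>2)) \<le> freud_norm (- T) 0"
proof -
  have h: "freud_norm (- T) 0 = (\<integral>x. quartic_weight (- T) x \<partial>lborel)"
    by (simp add: freud_norm_def weighted_integral_def)
  have int: "integrable lborel (quartic_weight (- T))"
    using integrable_power_quartic_weight[of 0 "- T"] by simp
  note g = gaussian_moments[OF assms]
  show "freud_norm (- T) 0 \<le> sqrt (pi / T)"
    unfolding h g(2)[symmetric] by (intro integral_mono int g) (simp add: quartic_weight_def)
  have "(\<integral>x. exp (- T * x\<^sup>2) - x ^ 4 * exp (- T * x\<^sup>2) \<partial>lborel) \<le> freud_norm (- T) 0"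
    unfolding h
  proof (intro integral_mono int Bochner_Integration.integrable_diff g)
    fix x :: real
    have "(1 - x ^ 4) * exp (- T * x\<^sup>2) \<le> exp (- (x ^ 4)) * exp (- T * x\<^sup>2)"
      using exp_ge_add_one_self[of "- (x ^ 4)"] by (intro mult_right_mono) auto
    thus "exp (- T * x\<^sup>2) - x ^ 4 * exp (- T * x\<^sup>2) \<le> quartic_weight (- T) x"
      by (simp add: quartic_weight_def exp_add[symmetric] left_diff_distrib)
  qed
  also have "(\<integral>x. exp (- T * x\<^sup>2) - x ^ 4 * exp (- T * x\<^sup>2) \<partial>lborel) = sqrt (pi / T) * (1 - 3 / (4 * T\<^sup>2))"
    by (subst Bochner_Integration.integral_diff[OF g(1,3)]) (simp only: g right_diff_distrib mult_1_right)
  finally show "sqrt (pi / T) * (1 - 3 / (4 * T\<^sup>2)) \<le> freud_norm (- T) 0" .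
qed

lemma ln_freud_norm_0_at_minus_infinity:
  "((\<lambda>T. ln (freud_norm (- T) 0) + ln T / 2) \<longlongrightarrow> ln pi / 2) at_top"
proof -
  have "((\<lambda>T. freud_norm (- T) 0 * sqrt T) \<longlongrightarrow> sqrt pi) at_top"
  proof (rule tendsto_sandwich)
    show "\<forall>\<^sub>F T in at_top. sqrt pi * (1 - 3 / (4 * T\<^sup>2)) \<le> freud_norm (- T) 0 * sqrt T"
      using eventually_gt_at_top[of 0]
    proof eventually_elim
      case (elim T)
      have "sqrt (pi / T) * sqrt T = sqrt pi" using elim by (simp add: real_sqrt_divide)
      hence "sqrt pi * (1 - 3 / (4 * T\<^sup>2)) = sqrt (pi / T) * (1 - 3 / (4 * T\<^sup>2)) * sqrt T"
        by (metis mult.assoc mult.commute)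
      also have "\<dots> \<le> freud_norm (- T) 0 * sqrt T"
        using freud_norm_0_bounds(2)[OF elim] elim by (intro mult_right_mono) auto
      finally show ?case .
    qed
    show "\<forall>\<^sub>F T in at_top. freud_norm (- T) 0 * sqrt T \<le> sqrt pi"
      using eventually_gt_at_top[of 0]
    proof eventually_elim
      case (elim T)
      thus ?case using mult_right_mono[OF freud_norm_0_bounds(1)[OF elim], of "sqrt T"]
        by (simp add: real_sqrt_divide)
    qed
    have "((\<lambda>T::real. 1 - 3 / (4 * T\<^sup>2)) \<longlongrightarrow> 1) at_top"
      by real_asymp
    from tendsto_mult_left[OF this, of "sqrt pi"]
    show "((\<lambda>T::real. sqrt pi * (1 - 3 / (4 * T\<^sup>2))) \<longlongrightarrow> sqrt pi) at_top"
      by simp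
  qed simp
  hence "((\<lambda>T. ln (freud_norm (- T) 0 * sqrt T)) \<longlongrightarrow> ln (sqrt pi)) at_top"
    by (intro tendsto_ln) auto
  moreover have "\<forall>\<^sub>F T in at_top. ln (freud_norm (- T) 0 * sqrt T) = ln (freud_norm (- T) 0) + ln T / 2"
    using eventually_gt_at_top[of 0]
    by eventually_elim (simp add: ln_mult_pos freud_norm_pos ln_sqrt)
  moreover have "ln (sqrt pi) = ln pi / 2" by (rule ln_sqrt) simp
  ultimately show ?thesis
    using Lim_transform_eventually by fastforce
qed

text \<open>For s = -T the linear term 2 T beta_n dominates the string equation. Dropping the
  quadratic part gives the upper bound; inserting that bound into the quadratic part gives the lower
  one.\<close>

lemma freud_beta_bounds_negative:
  assumes "0 < T"
  shows "freud_beta (- T) n \<le> real n / (2 * T)"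
    and "real n / (2 * T) - 3 * (real n + 1)\<^sup>2 / (2 * T ^ 3) \<le> freud_beta (- T) n"
proof -
  let ?b = "freud_beta (- T)"
  have le: "?b k \<le> real k / (2 * T)" for k
  proof (cases "k = 0")
    case False
    have "?b k * (2 * T) \<le> ?b k * (4 * (?b (Suc k) + ?b k + ?b (k - 1)) - 2 * (- T))"
      using freud_beta_nonneg by (intro mult_left_mono) (auto intro!: add_nonneg_nonneg)
    also have "\<dots> = real k" using False by (intro freud_string_equation) simp
    finally show ?thesis using assms by (simp add: field_simps)
  qed (simp add: freud_beta_0)
  show "?b n \<le> real n / (2 * T)" by (rule le)
  show "real n / (2 * T) - 3 * (real n + 1)\<^sup>2 / (2 * T ^ 3) \<le> ?b n"
  proof (cases "n = 0")
    case False
    \<comment> \<open>A common upper bound for the three coefficients of index n - 1, n and n +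
      1.\<close>
    let ?c = "(real n + 1) / (2 * T)"
    have c: "?b (Suc n) \<le> ?c" "?b n \<le> ?c" "?b (n - 1) \<le> ?c"
      using le[of "Suc n"] le[of n] le[of "n - 1"] assms
      by (auto intro!: order_trans[OF le] divide_right_mono)
    have "real n = ?b n * (4 * (?b (Suc n) + ?b n + ?b (n - 1)) - 2 * (- T))"
      using False by (intro freud_string_equation[symmetric]) simp
    also have "\<dots> = 2 * T * ?b n + 4 * (?b n * (?b (Suc n) + ?b n + ?b (n - 1)))"
      by (simp add: algebra_simps)
    also have "?b n * (?b (Suc n) + ?b n + ?b (n - 1)) \<le> ?c * (3 * ?c)"
    proof (rule mult_mono)
      show "?b (Suc n) + ?b n + ?b (n - 1) \<le> 3 * ?c" using c by linarith
    qed (use c assms in \<open>auto intro!: add_nonneg_nonneg freud_beta_nonneg\<close>)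
    also have "4 * (?c * (3 * ?c)) = 12 * ?c\<^sup>2"
      by (simp only: power2_eq_square mult_ac)
    finally have "real n \<le> 2 * T * ?b n + 12 * ?c\<^sup>2" by simp
    hence "real n / (2 * T) \<le> (2 * T * ?b n + 12 * ?c\<^sup>2) / (2 * T)"
      using assms by (intro divide_right_mono) auto
    also have "\<dots> = ?b n + 3 * (real n + 1)\<^sup>2 / (2 * T ^ 3)"
      using assms by (simp add: field_simps power2_eq_square power3_eq_cube)
    finally show ?thesis by simp
  qed (use assms in \<open>simp add: freud_beta_0\<close>)
qed

lemma freud_beta_at_minus_infinity:
  assumes "0 < n"
  shows "((\<lambda>T. ln (freud_beta (- T) n) + ln T) \<longlongrightarrow> ln (real n / 2)) at_top"
proof -
  have "((\<lambda>T. freud_beta (- T) n * T) \<longlongrightarrow> real n / 2) at_top"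
  proof (rule tendsto_sandwich)
    show "\<forall>\<^sub>F T in at_top. (real n / (2 * T) - 3 * (real n + 1)\<^sup>2 / (2 * T ^ 3)) * T \<le> freud_beta (- T) n * T"
      using eventually_gt_at_top[of 0]
      by eventually_elim (intro mult_right_mono freud_beta_bounds_negative, auto)
    show "\<forall>\<^sub>F T in at_top. freud_beta (- T) n * T \<le> real n / (2 * T) * T"
      using eventually_gt_at_top[of 0]
      by eventually_elim (intro mult_right_mono freud_beta_bounds_negative, auto)
    show "((\<lambda>T. (real n / (2 * T) - 3 * (real n + 1)\<^sup>2 / (2 * T ^ 3)) * T) \<longlongrightarrow> real n / 2) at_top"
      by real_asymp
    show "((\<lambda>T. real n / (2 * T) * T) \<longlongrightarrow> real n / 2) at_top"
      by real_asymp
  qed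
  hence "((\<lambda>T. ln (freud_beta (- T) n * T)) \<longlongrightarrow> ln (real n / 2)) at_top"
    using assms by (intro tendsto_ln) auto
  moreover have "\<forall>\<^sub>F T in at_top. ln (freud_beta (- T) n * T) = ln (freud_beta (- T) n) + ln T"
    using eventually_gt_at_top[of 0]
    by eventually_elim (simp add: ln_mult_pos freud_beta_pos assms)
  ultimately show ?thesis
    by (simp add: filterlim_cong[OF refl refl])
qed

lemma ln_freud_norm_Suc:
  "ln (freud_norm s (Suc n)) = ln (freud_norm s n) + ln (freud_beta s (Suc n))"
  by (simp add: freud_norm_Suc ln_mult_pos freud_norm_pos freud_beta_pos)

lemma ln_freud_norm_at_minus_infinity:
  "((\<lambda>T. ln (freud_norm (- T) n) + (real n + 1 / 2) * ln T) \<longlongrightarrow>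
     ln pi / 2 + ln (fact n) - real n * ln 2) at_top"
proof (induction n)
  case 0
  show ?case using ln_freud_norm_0_at_minus_infinity by simp
next
  case (Suc n)
  have "((\<lambda>T. (ln (freud_norm (- T) n) + (real n + 1 / 2) * ln T) + (ln (freud_beta (- T) (Suc n)) + ln T)) \<longlongrightarrow>
     (ln pi / 2 + ln (fact n) - real n * ln 2) + ln (real (Suc n) / 2)) at_top"
    by (intro tendsto_add Suc freud_beta_at_minus_infinity) simp
  also have "(\<lambda>T. (ln (freud_norm (- T) n) + (real n + 1 / 2) * ln T) + (ln (freud_beta (- T) (Suc n)) + ln T)) =
      (\<lambda>T. ln (freud_norm (- T) (Suc n)) + (real (Suc n) + 1 / 2) * ln T)"
    by (simp add: ln_freud_norm_Suc fun_eq_iff algebra_simps)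
  also have "(ln pi / 2 + ln (fact n) - real n * ln 2) + ln (real (Suc n) / 2) =
      ln pi / 2 + ln (fact (Suc n)) - real (Suc n) * ln 2"
    by (simp add: ln_mult_pos ln_divide_pos algebra_simps del: of_nat_Suc)
      (simp add: algebra_simps)
  finally show ?case .
qed

section \<open>The string equation as a contraction\<close>

text \<open>A maximum principle. The barrier \<open>\<delta> * real (n + 1)\<close> satisfies the
  homogeneous inequality because 2 q < 1, and it outgrows sqrt n, so \<open>e - \<phi>\<close> minus
  the barrier is eventually nonpositive. A positive maximum would lie in the interior and be at most
  2 q times itself. Finally \<open>\<delta>\<close> tends to 0.\<close>

lemma discrete_comparison:
  fixes e \<phi> \<rho> :: "nat \<Rightarrow> real"
  assumes q: "0 \<le> q" "2 * q < 1" and N: "0 < N"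
    and e: "\<And>n. n \<ge> N \<Longrightarrow> e n \<le> q * (e (Suc n) + e (n - 1)) + \<rho> n"
    and \<phi>: "\<And>n. n \<ge> N \<Longrightarrow> q * (\<phi> (Suc n) + \<phi> (n - 1)) + \<rho> n \<le> \<phi> n"
    and \<phi>0: "\<And>n. 0 \<le> \<phi> n"
    and bdry: "e (N - 1) \<le> \<phi> (N - 1)"
    and growth: "\<And>n. n \<ge> N \<Longrightarrow> e n \<le> C * (1 + sqrt (real n))"
    and n: "n \<ge> N - 1"
  shows "e n \<le> \<phi> n"
proof -
  have *: "e n - \<phi> n \<le> \<delta> * real (n + 1)" if \<delta>: "0 < \<delta>" for \<delta>
  proof -
    define v where "v k = e k - \<phi> k - \<delta> * real (k + 1)" for k
    have v: "v k \<le> q * (v (Suc k) + v (k - 1))" if "k \<ge> N" for k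
    proof -
      have "real (k - 1) = real k - 1" using that N by (simp add: of_nat_diff)
      hence "q * (v (Suc k) + v (k - 1)) =
          q * (e (Suc k) + e (k - 1)) - q * (\<phi> (Suc k) + \<phi> (k - 1)) - (2 * q) * (\<delta> * real (k + 1))"
        using that N by (simp add: v_def algebra_simps)
      moreover have "(2 * q) * (\<delta> * real (k + 1)) \<le> 1 * (\<delta> * real (k + 1))"
        using q \<delta> by (intro mult_right_mono) auto
      ultimately show ?thesis using e[OF that] \<phi>[OF that] by (simp add: v_def)
    qed
    have lim: "(\<lambda>k. C * ((1 + sqrt (real k)) / real (k + 1))) \<longlonglongrightarrow> C * 0"
      by (intro tendsto_mult tendsto_const) real_asymp
    have "\<forall>\<^sub>F k in sequentially. C * ((1 + sqrt (real k)) / real (k + 1)) < \<delta>"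
      using order_tendstoD(2)[OF lim, of \<delta>] \<delta> by simp
    hence "\<forall>\<^sub>F k in sequentially. v k \<le> 0"
      using eventually_ge_at_top[of N]
    proof eventually_elim
      case (elim k)
      have "C * (1 + sqrt (real k)) / real (k + 1) * real (k + 1) \<le> \<delta> * real (k + 1)"
        using elim by (intro mult_right_mono) auto
      hence "C * (1 + sqrt (real k)) \<le> \<delta> * real (k + 1)" by simp
      thus ?case using growth[of k] elim \<phi>0[of k] by (simp add: v_def)
    qed
    then obtain K where K: "\<And>k. k \<ge> K \<Longrightarrow> v k \<le> 0"
      by (auto simp: eventually_sequentially)
    have "v n \<le> 0"
    proof (rule ccontr)
      assume "\<not> v n \<le> 0"
      hence vn: "0 < v n" by simp
      hence "n < K" using K[of n] by force
      have ne: "{N - 1..K} \<noteq> {}" using n \<open>n < K\<close> by auto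
      \<comment> \<open>Outside this range, and at its left end, \<open>v\<close> is nonpositive; a
        positive maximum over the range thus dominates both neighbours of the point where it is
        attained.\<close>
      have "Max (v ` {N - 1..K}) \<in> v ` {N - 1..K}"
        using ne by (intro Max_in) auto
      then obtain m where m0: "m \<in> {N - 1..K}" "Max (v ` {N - 1..K}) = v m"
        by (rule imageE) blast
      have m: "m \<in> {N - 1..K}" "\<And>k. k \<in> {N - 1..K} \<Longrightarrow> v k \<le> v m"
        using m0 Max_ge[of "v ` {N - 1..K}"] by auto
      have vm: "0 < v m" using m(2)[of n] n \<open>n < K\<close> vn by auto
      have "0 \<le> \<delta> * real (N - 1 + 1)" using \<delta> by simp
      hence "v (N - 1) \<le> 0" using bdry unfolding v_def by linarith
      hence "m \<noteq> N - 1" using vm by auto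
      hence mN: "N \<le> m" using m(1) by auto
      have "v (Suc m) \<le> v m"
      proof (cases "Suc m \<le> K")
        case False
        thus ?thesis using K[of "Suc m"] vm by simp
      qed (use m mN in auto)
      moreover have "v (m - 1) \<le> v m" using m mN by (intro m(2)) auto
      ultimately have "q * (v (Suc m) + v (m - 1)) \<le> q * (2 * v m)"
        using q by (intro mult_left_mono) auto
      hence "v m \<le> (2 * q) * v m" using v[OF mN] by simp
      moreover have "(2 * q) * v m < 1 * v m" using q vm by (intro mult_strict_right_mono) auto
      ultimately show False by simp
    qed
    thus ?thesis by (simp add: v_def)
  qed
  show ?thesis
  proof (rule field_le_epsilon)
    fix \<epsilon> :: real assume "0 < \<epsilon>"
    thus "e n \<le> \<phi> n + \<epsilon>" using *[of "\<epsilon> / real (n + 1)"] by simp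
  qed
qed

text \<open>Subtracting the recurrences for \<open>\<beta>\<close> and for \<open>b\<close> gives
  \<open>e\<^sub>n (n / \<beta>\<^sub>n + 4 b\<^sub>n) = - r\<^sub>n - 4 b\<^sub>n (e\<^sub>n\<^sub>+\<^sub>1 + e\<^sub>n\<^sub>-\<^sub>1)\<close> for \<open>e = \<beta> - b\<close>.\<close>
lemma freud_beta_contraction:
  fixes b :: "nat \<Rightarrow> real"
  assumes n: "0 < n" and b: "0 < b n" "b n * freud_beta s n \<le> real n / 6"
  defines "e \<equiv> \<lambda>k. \<bar>freud_beta s k - b k\<bar>"
  defines "r \<equiv> b n * (4 * (b (Suc n) + b n + b (n - 1)) - 2 * s) - real n"
  shows "e n \<le> 2 / 5 * (e (Suc n) + e (n - 1)) + \<bar>r\<bar> / (4 * b n)"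
proof -
  let ?B = "freud_beta s"
  define d where "d k = ?B k - b k" for k
  have Bn: "0 < ?B n" using n by (rule freud_beta_pos)
  define D where "D = real n / ?B n + 4 * b n"
  \<comment> \<open>The hypothesis b beta <= n/6 says n/beta >= 6 b. Hence D >= 10 b, and the weight
    4 b / D of each neighbour is at most 2/5.\<close>
  have "b n \<le> real n / ?B n / 6" using b Bn by (simp add: field_simps)
  hence D10: "10 * b n \<le> D" by (simp add: D_def)
  hence D: "4 * b n \<le> D" "0 < D" using b by auto
  have S: "4 * (?B (Suc n) + ?B n + ?B (n - 1)) - 2 * s = real n / ?B n"
    using freud_string_equation[OF n, of s] Bn by (simp add: field_simps)
  have "d n * D = d n * (4 * (?B (Suc n) + ?B n + ?B (n - 1)) - 2 * s) + 4 * b n * d n"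
    unfolding S by (simp add: D_def algebra_simps)
  also have "\<dots> = ?B n * (4 * (?B (Suc n) + ?B n + ?B (n - 1)) - 2 * s)
     - b n * (4 * (b (Suc n) + b n + b (n - 1)) - 2 * s) - 4 * b n * (d (Suc n) + d (n - 1))"
    by (simp add: d_def algebra_simps)
  also have "\<dots> = - r - 4 * b n * (d (Suc n) + d (n - 1))"
    using freud_string_equation[OF n, of s] by (simp add: r_def)
  finally have eq: "d n * D = - r - 4 * b n * (d (Suc n) + d (n - 1))" .
  have "\<bar>d n\<bar> * D = \<bar>d n * D\<bar>" using D by (simp add: abs_mult)
  also have "\<dots> \<le> \<bar>r\<bar> + \<bar>4 * b n * (d (Suc n) + d (n - 1))\<bar>" unfolding eq by linarith
  also have "\<bar>4 * b n * (d (Suc n) + d (n - 1))\<bar> = 4 * b n * \<bar>d (Suc n) + d (n - 1)\<bar>"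
    using b by (simp add: abs_mult)
  also have "\<dots> \<le> 4 * b n * (\<bar>d (Suc n)\<bar> + \<bar>d (n - 1)\<bar>)"
    using b by (intro mult_left_mono) auto
  also have "\<dots> \<le> (2 / 5 * D) * (\<bar>d (Suc n)\<bar> + \<bar>d (n - 1)\<bar>)"
    using D10 by (intro mult_right_mono) auto
  finally have "\<bar>d n\<bar> \<le> (\<bar>r\<bar> + 2 / 5 * D * (\<bar>d (Suc n)\<bar> + \<bar>d (n - 1)\<bar>)) / D"
    using D by (simp add: pos_le_divide_eq)
  also have "\<dots> = \<bar>r\<bar> / D + 2 / 5 * (\<bar>d (Suc n)\<bar> + \<bar>d (n - 1)\<bar>)"
    using D by (simp add: add_divide_distrib)
  also have "\<bar>r\<bar> / D \<le> \<bar>r\<bar> / (4 * b n)"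
    using D b by (intro divide_left_mono) auto
  finally show ?thesis by (simp add: e_def d_def)
qed

text \<open>An a posteriori estimate: \<open>\<phi>\<close> has to dominate the scaled residual in
  the contraction inequality and the error at the single index \<open>N - 1\<close>. The a priori
  bounds provide the growth condition that replaces a boundary value at infinity.\<close>

lemma freud_beta_approximation:
  fixes b \<phi> :: "nat \<Rightarrow> real"
  assumes st: "s \<le> t" "0 \<le> t" and N: "0 < N"
    and b: "\<And>n. n \<ge> N \<Longrightarrow> 0 < b n" "\<And>n. n \<ge> N \<Longrightarrow> b n * freud_beta s n \<le> real n / 6"
    and b_growth: "\<And>n. n \<ge> N \<Longrightarrow> b n \<le> C * (1 + sqrt (real n))"
    and \<phi>: "\<And>n. n \<ge> N \<Longrightarrow> 2 / 5 * (\<phi> (Suc n) + \<phi> (n - 1)) +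
        \<bar>b n * (4 * (b (Suc n) + b n + b (n - 1)) - 2 * s) - real n\<bar> / (4 * b n) \<le> \<phi> n"
    and \<phi>0: "\<And>n. 0 \<le> \<phi> n"
    and bdry: "\<bar>freud_beta s (N - 1) - b (N - 1)\<bar> \<le> \<phi> (N - 1)"
    and n: "n \<ge> N - 1"
  shows "\<bar>freud_beta s n - b n\<bar> \<le> \<phi> n"
proof (rule discrete_comparison[where q = "2 / 5" and N = N and e = "\<lambda>n. \<bar>freud_beta s n - b n\<bar>" and
    \<rho> = "\<lambda>n. \<bar>b n * (4 * (b (Suc n) + b n + b (n - 1)) - 2 * s) - real n\<bar> / (4 * b n)" and C = "t + 1 + \<bar>C\<bar>"])
  fix n assume n: "n \<ge> N"
  show "\<bar>freud_beta s n - b n\<bar> \<le> 2 / 5 * (\<bar>freud_beta s (Suc n) - b (Suc n)\<bar> + \<bar>freud_beta s (n - 1) - b (n - 1)\<bar>)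
     + \<bar>b n * (4 * (b (Suc n) + b n + b (n - 1)) - 2 * s) - real n\<bar> / (4 * b n)"
    using n N b by (intro freud_beta_contraction) auto
  have "freud_beta s n \<le> (t + sqrt (real n)) / 2" by (rule freud_beta_le[OF st])
  also have "\<dots> \<le> t + sqrt (real n)" using st by simp
  also have "\<dots> \<le> t * (1 + sqrt (real n)) + 1 * (1 + sqrt (real n))"
    using st by (intro add_mono) (auto simp: mult_le_cancel_left1)
  finally have "freud_beta s n \<le> (t + 1) * (1 + sqrt (real n))" by (simp only: distrib_right)
  moreover have "C * (1 + sqrt (real n)) \<le> \<bar>C\<bar> * (1 + sqrt (real n))"
    by (intro mult_right_mono) auto
  ultimately have "freud_beta s n + b n \<le> (t + 1 + \<bar>C\<bar>) * (1 + sqrt (real n))"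
    using b_growth[OF n] unfolding distrib_right by linarith
  thus "\<bar>freud_beta s n - b n\<bar> \<le> (t + 1 + \<bar>C\<bar>) * (1 + sqrt (real n))"
    using b(1)[OF n] freud_beta_nonneg[of s n] by linarith
qed (use N \<phi> \<phi>0 bdry n in auto)

text \<open>Purely algebraic: with x, u, v the three roots, (2x - u - v)(2x + u + v) = (u - v)^2 and
  (u - v)(u + v) = 2h, while (u + v)^2 >= 2A. The argument includes the endpoint h = A, which occurs
  for n = 1 and s = 0.\<close>

lemma sqrt_second_difference:
  fixes A h :: real
  assumes "0 \<le> h" "h \<le> A" "0 < A"
  shows "\<bar>sqrt (A + h) + sqrt (A - h) - 2 * sqrt A\<bar> \<le> h\<^sup>2 / (A * sqrt A)"
proof -
  define x u v where "x = sqrt A" and "u = sqrt (A + h)" and "v = sqrt (A - h)"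
  have pos: "0 < x" "0 < u" "0 \<le> v" using assms by (simp_all add: x_def u_def v_def)
  have sq: "x\<^sup>2 = A" "u\<^sup>2 = A + h" "v\<^sup>2 = A - h" using assms by (simp_all add: x_def u_def v_def)
  have prod: "(2 * x - u - v) * (2 * x + u + v) = (u - v)\<^sup>2"
  proof -
    have "(2 * x - u - v) * (2 * x + u + v) = 4 * x\<^sup>2 - 2 * u\<^sup>2 - 2 * v\<^sup>2 + (u - v)\<^sup>2"
      by (simp add: power2_eq_square algebra_simps)
    thus ?thesis by (simp add: sq)
  qed
  have uv2: "(u - v)\<^sup>2 * (u + v)\<^sup>2 = 4 * h\<^sup>2"
  proof -
    have "(u - v) * (u + v) = u\<^sup>2 - v\<^sup>2" by (simp add: power2_eq_square algebra_simps)
    hence "(u - v) * (u + v) = 2 * h" by (simp add: sq)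
    thus ?thesis by (simp flip: power_mult_distrib)
  qed
  have "(u - v)\<^sup>2 * (2 * A) \<le> (u - v)\<^sup>2 * (u + v)\<^sup>2"
    using pos sq by (intro mult_left_mono) (simp_all add: power2_sum)
  hence le: "(u - v)\<^sup>2 * A \<le> 2 * h\<^sup>2" unfolding uv2 by (simp add: mult.commute)
  have nonneg: "0 \<le> 2 * x - u - v"
    using prod pos by (metis add_pos_pos add_pos_nonneg mult_pos_pos not_le
        mult_less_0_iff zero_le_power2 zero_less_numeral)
  have "(2 * x - u - v) * (2 * x) \<le> (u - v)\<^sup>2"
    using nonneg pos prod mult_left_mono[of "2 * x" "2 * x + u + v" "2 * x - u - v"] by simp
  hence "(2 * x - u - v) * (2 * x) * A \<le> 2 * h\<^sup>2"
    using assms by (intro order_trans[OF mult_right_mono le]) auto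
  also have "(2 * x - u - v) * (2 * x) * A = 2 * ((2 * x - u - v) * (A * x))" by simp
  finally have "(2 * x - u - v) * (A * x) \<le> h\<^sup>2" by simp
  hence "2 * x - u - v \<le> h\<^sup>2 / (A * x)" using assms pos by (simp add: pos_le_divide_eq)
  thus ?thesis using nonneg by (simp add: x_def u_def v_def)
qed

text \<open>The positive root of the string equation in which \<open>\<beta>\<^sub>n\<^sub>\<plusminus>\<^sub>1\<close> are replaced by \<open>\<beta>\<^sub>n\<close>.\<close>
definition planar_beta :: "real \<Rightarrow> nat \<Rightarrow> real"
  where "planar_beta s n = (s + sqrt (s\<^sup>2 + 12 * real n)) / 12"

lemma planar_beta_eq: "planar_beta s n * (12 * planar_beta s n - 2 * s) = real n"
proof -
  let ?r = "sqrt (s\<^sup>2 + 12 * real n)"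
  have "(s + r) / 12 * (12 * ((s + r) / 12) - 2 * s) = (r\<^sup>2 - s\<^sup>2) / 12" for r
    by (simp add: power2_eq_square field_simps)
  hence "planar_beta s n * (12 * planar_beta s n - 2 * s) = (?r\<^sup>2 - s\<^sup>2) / 12"
    unfolding planar_beta_def .
  thus ?thesis by simp
qed

lemma planar_beta_pos: "0 < n \<Longrightarrow> 0 < planar_beta s n"
proof -
  assume "0 < n"
  hence "sqrt (s\<^sup>2) < sqrt (s\<^sup>2 + 12 * real n)" by (intro real_sqrt_less_mono) simp
  thus ?thesis by (simp add: planar_beta_def)
qed

lemma planar_beta_nonneg: "0 \<le> planar_beta s n"
  using planar_beta_pos[of n s] by (cases "n = 0") (auto simp: planar_beta_def)

text \<open>The factor 7/4 is a rational number above sqrt 3, as the quadratic inequality demands,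
  and below 2, so that the product with the a priori bound on beta_n is eventually at most
  n/6.\<close>

lemma planar_beta_le:
  assumes "s \<le> t" "0 \<le> t"
  shows "planar_beta s n \<le> (t + 7 / 4 * sqrt (real n)) / 6"
proof (cases "n = 0")
  case False
  let ?b = "planar_beta s n"
  have b: "0 < ?b" using False by (simp add: planar_beta_pos)
  have "?b * (12 * ?b - 2 * t) \<le> ?b * (12 * ?b - 2 * s)"
    using b assms by (intro mult_left_mono) auto
  also have "\<dots> = sqrt (real n) * sqrt (real n)" by (simp add: planar_beta_eq)
  finally have le: "?b * (12 * ?b - 2 * t) \<le> sqrt (real n) * sqrt (real n)" .
  show ?thesis
  proof (rule ccontr)
    assume "\<not> ?thesis"
    hence *: "t + 7 / 4 * sqrt (real n) < 6 * ?b" by simp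
    have pos: "0 < sqrt (real n)" using False by simp
    have "7 / 4 * sqrt (real n) < 6 * ?b" "7 / 4 * sqrt (real n) < 6 * ?b - t"
      using * assms by linarith+
    hence "7 / 4 * sqrt (real n) * (7 / 4 * sqrt (real n)) < (6 * ?b) * (6 * ?b - t)"
      by (rule mult_strict_mono) (use b pos in auto)
    also have "\<dots> = 3 * (?b * (12 * ?b - 2 * t))" by (simp add: algebra_simps)
    also have "\<dots> \<le> 3 * (sqrt (real n) * sqrt (real n))" using le by (rule mult_left_mono) simp
    finally show False by simp
  qed
qed (use assms in \<open>simp add: planar_beta_def\<close>)

text \<open>The residual of the planar value in the string equation is 4 times that value times this
  second difference. The power A^(3/2) is split: A gives the decay in \<open>s\<close>, sqrt A the
  decay in \<open>n\<close>.\<close>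

lemma planar_beta_second_difference:
  assumes "0 < n"
  shows "\<bar>planar_beta s (Suc n) + planar_beta s (n - 1) - 2 * planar_beta s n\<bar>
    \<le> 4 / ((1 + s\<^sup>2) * sqrt (real n))"
proof -
  define A where "A = s\<^sup>2 + 12 * real n"
  have n1: "1 \<le> real n" using assms by simp
  have A: "12 \<le> A" "1 + s\<^sup>2 \<le> A" using n1 unfolding A_def by (simp_all add: add_increasing)
  have e: "s\<^sup>2 + 12 * real (Suc n) = A + 12" "s\<^sup>2 + 12 * real (n - 1) = A - 12"
    using assms by (simp_all add: A_def of_nat_diff)
  have "planar_beta s (Suc n) + planar_beta s (n - 1) - 2 * planar_beta s n =
      (sqrt (A + 12) + sqrt (A - 12) - 2 * sqrt A) / 12"
    unfolding planar_beta_def e A_def[symmetric] by (simp add: field_simps)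
  hence "\<bar>planar_beta s (Suc n) + planar_beta s (n - 1) - 2 * planar_beta s n\<bar> =
      \<bar>sqrt (A + 12) + sqrt (A - 12) - 2 * sqrt A\<bar> / 12"
    by (simp only: abs_divide abs_numeral)
  also have "\<dots> \<le> (12\<^sup>2 / (A * sqrt A)) / 12"
    using A by (intro divide_right_mono sqrt_second_difference) auto
  also have "\<dots> = 12 / (A * sqrt A)" by simp
  also have "\<dots> \<le> 12 / ((1 + s\<^sup>2) * (3 * sqrt (real n)))"
  proof (intro divide_left_mono mult_mono A)
    have "3 * sqrt (real n) = sqrt (9 * real n)" by (simp add: real_sqrt_mult)
    also have "\<dots> \<le> sqrt A" unfolding A_def by (intro real_sqrt_le_mono) (simp add: add_increasing)
    finally show "3 * sqrt (real n) \<le> sqrt A" .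
  qed (use A n1 in \<open>auto intro!: mult_pos_pos add_pos_nonneg\<close>)
  also have "\<dots> = 4 / ((1 + s\<^sup>2) * sqrt (real n))" by simp
  finally show ?thesis .
qed

text \<open>Supplies the starting value of the comparison with the required decay in
  \<open>s\<close>. For s = -T <= -1 both quantities are n/(2T) up to O(T^(-3)); for the remaining
  \<open>s\<close> both are bounded.\<close>

lemma freud_beta_minus_planar_beta_bound:
  assumes "0 \<le> t"
  shows "\<exists>K\<ge>0. \<forall>s\<le>t. \<bar>freud_beta s n - planar_beta s n\<bar> \<le> K / (1 + s\<^sup>2)"
proof -
  define K1 where "K1 = ((t + sqrt (real n)) / 2 + (t + 7 / 4 * sqrt (real n)) / 6) * (1 + (t + 1)\<^sup>2)"
  define K2 where "K2 = 3 * (real n + 1)\<^sup>2"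
  have K: "0 \<le> K1" "0 \<le> K2" using assms by (simp_all add: K1_def K2_def)
  have "\<bar>freud_beta s n - planar_beta s n\<bar> \<le> (K1 + K2) / (1 + s\<^sup>2)" if s: "s \<le> t" for s
  proof (cases "s \<le> - 1")
    case True
    define T where "T = - s"
    have T: "1 \<le> T" "s = - T" using True by (simp_all add: T_def)
    let ?b = "planar_beta s n"
    have eq: "?b * (12 * ?b + 2 * T) = real n" using planar_beta_eq[of s n] T by simp
    have "?b * (2 * T) \<le> ?b * (12 * ?b + 2 * T)"
      using planar_beta_nonneg by (intro mult_left_mono) auto
    hence "?b * (2 * T) \<le> real n" unfolding eq .
    hence up: "?b \<le> real n / (2 * T)" using T by (simp add: pos_le_divide_eq)
    have "real n / (2 * T) = ?b + 6 * ?b\<^sup>2 / T"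
      using T by (subst eq[symmetric]) (simp add: field_simps power2_eq_square)
    also have "6 * ?b\<^sup>2 / T \<le> 6 * ((real n + 1) / (2 * T))\<^sup>2 / T"
      using up planar_beta_nonneg[of s n] T
      by (intro divide_right_mono mult_left_mono power_mono order_trans[OF up] ) auto
    also have "\<dots> = 3 * (real n + 1)\<^sup>2 / (2 * T ^ 3)"
      using T by (simp add: field_simps power2_eq_square power3_eq_cube)
    finally have lo: "real n / (2 * T) - 3 * (real n + 1)\<^sup>2 / (2 * T ^ 3) \<le> ?b" by simp
    have "\<bar>freud_beta s n - ?b\<bar> \<le> 3 * (real n + 1)\<^sup>2 / (2 * T ^ 3)"
      using freud_beta_bounds_negative[of T n] up lo T by (simp add: abs_le_iff)
    also have "\<dots> \<le> 3 * (real n + 1)\<^sup>2 / (1 + s\<^sup>2)"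
    proof (intro divide_left_mono)
      have "1 \<le> T ^ 3" using T by (intro one_le_power)
      moreover have "T\<^sup>2 \<le> T ^ 3" using T by (intro power_increasing) auto
      moreover have "s\<^sup>2 = T\<^sup>2" using T by simp
      ultimately show "1 + s\<^sup>2 \<le> 2 * T ^ 3" by linarith
    qed (use T in \<open>auto intro!: mult_pos_pos add_pos_nonneg\<close>)
    also have "\<dots> \<le> (K1 + K2) / (1 + s\<^sup>2)"
      using K by (intro divide_right_mono) (auto simp: K2_def)
    finally show ?thesis .
  next
    case False
    have "\<bar>s\<bar> \<le> t + 1" using False s assms by auto
    hence "s\<^sup>2 \<le> (t + 1)\<^sup>2" by (metis abs_ge_zero power2_abs power_mono)
    moreover have "\<bar>freud_beta s n - planar_beta s n\<bar> \<le> freud_beta s n + planar_beta s n"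
      using freud_beta_nonneg[of s n] planar_beta_nonneg[of s n] by (simp add: abs_le_iff)
    hence "\<bar>freud_beta s n - planar_beta s n\<bar> \<le> (t + sqrt (real n)) / 2 + (t + 7 / 4 * sqrt (real n)) / 6"
      by (rule order_trans) (intro add_mono freud_beta_le planar_beta_le s assms)
    ultimately have "\<bar>freud_beta s n - planar_beta s n\<bar> * (1 + s\<^sup>2) \<le> K1"
      unfolding K1_def using assms by (intro mult_mono) auto
    hence "\<bar>freud_beta s n - planar_beta s n\<bar> * (1 + s\<^sup>2) \<le> K1 + K2" using K by simp
    moreover have "0 < 1 + s\<^sup>2" by (intro add_pos_nonneg) auto
    ultimately show ?thesis by (simp add: pos_le_divide_eq)
  qed
  thus ?thesis using K by (intro exI[of _ "K1 + K2"]) auto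
qed

lemma freud_beta_planar_approximation:
  assumes t: "0 \<le> t"
  shows "\<exists>K N. 0 \<le> K \<and> 0 < N \<and> (\<forall>s\<le>t. \<forall>n\<ge>N. \<bar>freud_beta s n - planar_beta s n\<bar> \<le> K / ((1 + s\<^sup>2) * sqrt (real n)))"
proof -
  have "\<forall>\<^sub>F n::nat in sequentially. (t + sqrt (real n)) * (t + 7 / 4 * sqrt (real n)) \<le> 2 * real n"
    using t by real_asymp
  \<comment> \<open>The two neighbours cost a factor close to 4/5. Allowing 9/10 leaves 1/10 of the
    bound for the residual.\<close>
  moreover have "\<forall>\<^sub>F n::nat in sequentially. 2 / 5 * (1 / sqrt (real n + 1) + 1 / sqrt (real n - 1)) \<le> 9 / 10 / sqrt (real n)"
    by real_asymp
  ultimately have "\<forall>\<^sub>F n::nat in sequentially. (t + sqrt (real n)) * (t + 7 / 4 * sqrt (real n)) \<le> 2 * real n \<and>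
      2 / 5 * (1 / sqrt (real n + 1) + 1 / sqrt (real n - 1)) \<le> 9 / 10 / sqrt (real n)"
    by (rule eventually_conj)
  then obtain N0 where N0: "\<And>n. n \<ge> N0 \<Longrightarrow> (t + sqrt (real n)) * (t + 7 / 4 * sqrt (real n)) \<le> 2 * real n"
      "\<And>n. n \<ge> N0 \<Longrightarrow> 2 / 5 * (1 / sqrt (real n + 1) + 1 / sqrt (real n - 1)) \<le> 9 / 10 / sqrt (real n)"
    by (auto simp: eventually_sequentially)
  define N where "N = N0 + 2"
  obtain K0 where K0: "0 \<le> K0" "\<And>s. s \<le> t \<Longrightarrow> \<bar>freud_beta s (N - 1) - planar_beta s (N - 1)\<bar> \<le> K0 / (1 + s\<^sup>2)"
    using freud_beta_minus_planar_beta_bound[OF t, of "N - 1"] by blast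
  \<comment> \<open>The summand 40 makes the residual constant 4 at most K/10; the other summand
    makes the bound valid at the starting index \<open>N - 1\<close>, which is positive.\<close>
  define K where "K = 40 + K0 * sqrt (real (N - 1))"
  have K: "40 \<le> K" using K0(1) by (simp add: K_def)
  have "\<bar>freud_beta s n - planar_beta s n\<bar> \<le> K / ((1 + s\<^sup>2) * sqrt (real n))"
    if s: "s \<le> t" and n: "n \<ge> N - 1" for s n
  proof (rule freud_beta_approximation[where N = N and C = "t + 1", OF s t])
    have s1: "0 < 1 + s\<^sup>2" by (intro add_pos_nonneg) auto
    show "0 < N" by (simp add: N_def)
    show "0 < planar_beta s n" if "n \<ge> N" for n using that by (intro planar_beta_pos) (simp add: N_def)
    show "planar_beta s n * freud_beta s n \<le> real n / 6" if "n \<ge> N" for n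
    proof -
      have "planar_beta s n * freud_beta s n \<le> ((t + 7 / 4 * sqrt (real n)) / 6) * ((t + sqrt (real n)) / 2)"
        using t freud_beta_nonneg by (intro mult_mono planar_beta_le freud_beta_le s t) auto
      also have "\<dots> = ((t + sqrt (real n)) * (t + 7 / 4 * sqrt (real n))) / 12" by simp
      also have "\<dots> \<le> (2 * real n) / 12" using that by (intro divide_right_mono N0(1)) (auto simp: N_def)
      finally show ?thesis by simp
    qed
    show "planar_beta s n \<le> (t + 1) * (1 + sqrt (real n))" for n
    proof -
      have *: "p \<le> (t + 7 / 4 * x) / 6 \<Longrightarrow> 0 \<le> x \<Longrightarrow> p \<le> t + x" for p x :: real
        using t by (simp add: field_simps)
      have "planar_beta s n \<le> t + sqrt (real n)"
        by (rule *[OF planar_beta_le[OF s t]]) simp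
      also have "\<dots> \<le> t * (1 + sqrt (real n)) + 1 * (1 + sqrt (real n))"
        using t by (intro add_mono) (auto simp: mult_le_cancel_left1)
      finally show ?thesis by (simp only: distrib_right)
    qed
    show "0 \<le> K / ((1 + s\<^sup>2) * sqrt (real n))" for n using K s1 by simp
    show "\<bar>freud_beta s (N - 1) - planar_beta s (N - 1)\<bar> \<le> K / ((1 + s\<^sup>2) * sqrt (real (N - 1)))"
    proof -
      have "0 < sqrt (real (N - 1))" by (simp add: N_def)
      hence "K0 / (1 + s\<^sup>2) = K0 * sqrt (real (N - 1)) / ((1 + s\<^sup>2) * sqrt (real (N - 1)))" by simp
      also have "\<dots> \<le> K / ((1 + s\<^sup>2) * sqrt (real (N - 1)))"
        using s1 by (intro divide_right_mono) (auto simp: K_def)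
      finally show ?thesis using K0(2)[OF s] by simp
    qed
    fix n assume "n \<ge> N"
    hence n: "0 < n" "n \<ge> N0" "real (n - 1) = real n - 1" by (auto simp: N_def)
    have b: "0 < planar_beta s n" using n by (intro planar_beta_pos) simp
    have "planar_beta s n * (4 * (planar_beta s (Suc n) + planar_beta s n + planar_beta s (n - 1)) - 2 * s) - real n
        = (4 * planar_beta s n) * (planar_beta s (Suc n) + planar_beta s (n - 1) - 2 * planar_beta s n)"
      using planar_beta_eq[of s n] by (simp add: algebra_simps)
    hence "\<bar>planar_beta s n * (4 * (planar_beta s (Suc n) + planar_beta s n + planar_beta s (n - 1)) - 2 * s) - real n\<bar>
        / (4 * planar_beta s n) = \<bar>planar_beta s (Suc n) + planar_beta s (n - 1) - 2 * planar_beta s n\<bar>"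
      using b by (simp add: abs_mult)
    also have "\<dots> \<le> 4 / ((1 + s\<^sup>2) * sqrt (real n))" using n by (intro planar_beta_second_difference)
    also have "\<dots> \<le> (K / 10) / ((1 + s\<^sup>2) * sqrt (real n))" using K s1 by (intro divide_right_mono) auto
    also have "\<dots> = K / (1 + s\<^sup>2) * (1 / 10 / sqrt (real n))" by simp
    finally have r: "\<bar>planar_beta s n * (4 * (planar_beta s (Suc n) + planar_beta s n + planar_beta s (n - 1)) - 2 * s) - real n\<bar>
        / (4 * planar_beta s n) \<le> K / (1 + s\<^sup>2) * (1 / 10 / sqrt (real n))" .
    have "2 / 5 * (K / ((1 + s\<^sup>2) * sqrt (real (Suc n))) + K / ((1 + s\<^sup>2) * sqrt (real (n - 1)))) =
        K / (1 + s\<^sup>2) * (2 / 5 * (1 / sqrt (real n + 1) + 1 / sqrt (real n - 1)))"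
    proof -
      have *: "K / ((1 + s\<^sup>2) * y) = K / (1 + s\<^sup>2) * (1 / y)" for y by simp
      show ?thesis unfolding n(3) * of_nat_Suc
        by (simp only: distrib_left mult_ac add.commute[of 1])
    qed
    also have "\<dots> \<le> K / (1 + s\<^sup>2) * (9 / 10 / sqrt (real n))"
      using K s1 n by (intro mult_left_mono N0(2)) auto
    finally have "2 / 5 * (K / ((1 + s\<^sup>2) * sqrt (real (Suc n))) + K / ((1 + s\<^sup>2) * sqrt (real (n - 1)))) +
      \<bar>planar_beta s n * (4 * (planar_beta s (Suc n) + planar_beta s n + planar_beta s (n - 1)) - 2 * s) - real n\<bar>
        / (4 * planar_beta s n) \<le> K / (1 + s\<^sup>2) * (9 / 10 / sqrt (real n)) + K / (1 + s\<^sup>2) * (1 / 10 / sqrt (real n))"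
      using r by (rule add_mono)
    also have "\<dots> = K / ((1 + s\<^sup>2) * sqrt (real n))" by (simp flip: distrib_left add_divide_distrib)
    finally show "2 / 5 * (K / ((1 + s\<^sup>2) * sqrt (real (Suc n))) + K / ((1 + s\<^sup>2) * sqrt (real (n - 1)))) +
      \<bar>planar_beta s n * (4 * (planar_beta s (Suc n) + planar_beta s n + planar_beta s (n - 1)) - 2 * s) - real n\<bar>
        / (4 * planar_beta s n) \<le> K / ((1 + s\<^sup>2) * sqrt (real n))" .
  qed (rule n)
  moreover have "0 < N" by (simp add: N_def)
  ultimately show ?thesis using K by (intro exI[of _ K] exI[of _ N]) auto
qed

section \<open>Integration over the parameter and the constant term\<close>

definition planar_primitive :: "real \<Rightarrow> real \<Rightarrow> real"
  where "planar_primitive a s = s\<^sup>2 / 12 + (s * sqrt (s\<^sup>2 + a) + a * ln (s + sqrt (s\<^sup>2 + a))) / 12"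

lemma planar_primitive_deriv:
  assumes "0 < a"
  shows "(planar_primitive a has_real_derivative (s + sqrt (s\<^sup>2 + a)) / 6) (at s)"
proof -
  define r where "r = sqrt (s\<^sup>2 + a)"
  have pos: "0 < s\<^sup>2 + a" using assms by (intro add_nonneg_pos) auto
  hence r: "0 < r" "r\<^sup>2 = s\<^sup>2 + a" by (simp_all add: r_def)
  have "sqrt (s\<^sup>2) < r" unfolding r_def using assms by (intro real_sqrt_less_mono) simp
  hence sr: "0 < s + r" by simp
  define R where "R = (\<lambda>s. sqrt (s\<^sup>2 + a))"
  have R: "R s = r" by (simp add: R_def r_def)
  have dR: "(R has_real_derivative s / r) (at s)"
    unfolding R_def using pos by (auto intro!: derivative_eq_intros simp: r_def field_simps)
  have pp: "planar_primitive a = (\<lambda>s. s\<^sup>2 / 12 + (s * R s + a * ln (s + R s)) / 12)"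
    by (simp add: planar_primitive_def R_def fun_eq_iff)
  have "(planar_primitive a has_real_derivative
      2 * s / 12 + (r + s * (s / r) + a * ((1 + s / r) / (s + r))) / 12) (at s)"
    unfolding pp using sr by (auto intro!: derivative_eq_intros dR simp: R mult_ac)
  also have "1 + s / r = (s + r) / r" using r by (simp add: add_divide_distrib)
  also have "(s + r) / r / (s + r) = 1 / r" using sr by simp
  also have "r + s * (s / r) + a * (1 / r) = 2 * r"
    using r by (simp add: field_simps power2_eq_square)
  also have "2 * s / 12 + 2 * r / 12 = (s + r) / 6" by simp
  finally show ?thesis by (simp add: r_def)
qed

lemma planar_primitive_at_minus_infinity:
  assumes "0 < a"
  shows "((\<lambda>T. planar_primitive a (- T) + a / 12 * ln T) \<longlongrightarrow> a / 12 * ln (a / 2) - a / 24) at_top"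
proof -
  have "((\<lambda>T. T\<^sup>2 - T * sqrt (T\<^sup>2 + a)) \<longlongrightarrow> - a / 2) at_top"
    using assms by real_asymp
  moreover have "((\<lambda>T. ln (T + sqrt (T\<^sup>2 + a)) - ln T) \<longlongrightarrow> ln 2) at_top"
    using assms by real_asymp
  ultimately have "((\<lambda>T. (T\<^sup>2 - T * sqrt (T\<^sup>2 + a)) / 12 + a / 12 * ln a - a / 12 * (ln (T + sqrt (T\<^sup>2 + a)) - ln T)) \<longlongrightarrow>
      (- a / 2) / 12 + a / 12 * ln a - a / 12 * ln 2) at_top"
    by (intro tendsto_intros) auto
  also have "(- a / 2) / 12 + a / 12 * ln a - a / 12 * ln 2 = a / 12 * ln (a / 2) - a / 24"
    using assms by (simp add: ln_divide_pos algebra_simps)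
  finally show ?thesis
  proof (rule Lim_transform_eventually)
    show "\<forall>\<^sub>F T in at_top. (T\<^sup>2 - T * sqrt (T\<^sup>2 + a)) / 12 + a / 12 * ln a - a / 12 * (ln (T + sqrt (T\<^sup>2 + a)) - ln T) =
      planar_primitive a (- T) + a / 12 * ln T"
      using eventually_gt_at_top[of 0]
    proof eventually_elim
      case (elim T)
      let ?r = "sqrt (T\<^sup>2 + a)"
      have r: "?r\<^sup>2 = T\<^sup>2 + a" using assms by simp
      have "sqrt (T\<^sup>2) < ?r" using assms by (intro real_sqrt_less_mono) simp
      hence "T < ?r" using elim by simp
      \<comment> \<open>The conjugate factor avoids the cancellation in -T + sqrt(T^2 + a), which
        tends to 0.\<close>
      moreover have "(- T + ?r) * (T + ?r) = a"
        using r by (simp add: power2_eq_square algebra_simps)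
      ultimately have "ln a = ln (- T + ?r) + ln (T + ?r)"
        using elim by (subst ln_mult_pos[symmetric]) auto
      hence eq: "ln (- T + ?r) = ln a - ln (T + ?r)" by simp
      show ?case unfolding planar_primitive_def power2_minus eq
        by (simp add: algebra_simps add_divide_distrib diff_divide_distrib)
    qed
  qed
qed

text \<open>The planar values at n and n + 1 have radicands A - 6 and A + 6, symmetric about A = s^2
  + 12 (n + 1/2), so replacing their sum by the midpoint value costs only a second difference. The
  same shift makes a/12 equal to n + 1/2 for a = 12 n + 6, the exponent with which h_n decays in
  |s|.\<close>

lemma freud_beta_sum_approximation:
  assumes t: "0 \<le> t"
  shows "\<exists>K N. 0 \<le> K \<and> 0 < N \<and> (\<forall>s\<le>t. \<forall>n\<ge>N.
    \<bar>freud_beta s (Suc n) + freud_beta s n - (s + sqrt (s\<^sup>2 + (12 * real n + 6))) / 6\<bar>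
      \<le> K / sqrt (real n) * inverse (1 + s\<^sup>2))"
proof -
  obtain K N where K: "0 \<le> K" "0 < N" "\<And>s n. s \<le> t \<Longrightarrow> n \<ge> N \<Longrightarrow>
      \<bar>freud_beta s n - planar_beta s n\<bar> \<le> K / ((1 + s\<^sup>2) * sqrt (real n))"
    using freud_beta_planar_approximation[OF t] by blast
  have "\<bar>freud_beta s (Suc n) + freud_beta s n - (s + sqrt (s\<^sup>2 + (12 * real n + 6))) / 6\<bar>
      \<le> (2 * K + 3) / sqrt (real n) * inverse (1 + s\<^sup>2)" if s: "s \<le> t" and n: "n \<ge> N" for s n
  proof -
    define A where "A = s\<^sup>2 + (12 * real n + 6)"
    have n1: "1 \<le> real n" using n K by simp
    have s1: "0 < 1 + s\<^sup>2" by (intro add_pos_nonneg) auto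
    have A: "6 \<le> A" "1 + s\<^sup>2 \<le> A" using n1 unfolding A_def by (simp_all add: add_increasing)
    have e: "s\<^sup>2 + 12 * real (Suc n) = A + 6" "s\<^sup>2 + 12 * real n = A - 6" by (simp_all add: A_def)
    have "planar_beta s (Suc n) + planar_beta s n - (s + sqrt A) / 6 =
        (sqrt (A + 6) + sqrt (A - 6) - 2 * sqrt A) / 12"
      unfolding planar_beta_def e by (simp add: field_simps)
    hence "\<bar>planar_beta s (Suc n) + planar_beta s n - (s + sqrt A) / 6\<bar> =
        \<bar>sqrt (A + 6) + sqrt (A - 6) - 2 * sqrt A\<bar> / 12"
      by (simp only: abs_divide abs_numeral)
    also have "\<dots> \<le> (6\<^sup>2 / (A * sqrt A)) / 12"
      using A by (intro divide_right_mono sqrt_second_difference) auto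
    also have "\<dots> = 3 / (A * sqrt A)" by simp
    also have "\<dots> \<le> 3 / ((1 + s\<^sup>2) * sqrt (real n))"
    proof (intro divide_left_mono mult_mono A)
      show "sqrt (real n) \<le> sqrt A" unfolding A_def by (intro real_sqrt_le_mono) (simp add: add_increasing)
    qed (use A n1 s1 in auto)
    finally have 1: "\<bar>planar_beta s (Suc n) + planar_beta s n - (s + sqrt A) / 6\<bar> \<le> 3 / ((1 + s\<^sup>2) * sqrt (real n))" .
    have "\<bar>freud_beta s (Suc n) - planar_beta s (Suc n)\<bar> \<le> K / ((1 + s\<^sup>2) * sqrt (real (Suc n)))"
      using s n by (intro K) auto
    also have "\<dots> \<le> K / ((1 + s\<^sup>2) * sqrt (real n))"
      using K n1 s1 by (intro divide_left_mono mult_left_mono) auto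
    finally have 2: "\<bar>freud_beta s (Suc n) - planar_beta s (Suc n)\<bar> \<le> K / ((1 + s\<^sup>2) * sqrt (real n))" .
    have 3: "\<bar>freud_beta s n - planar_beta s n\<bar> \<le> K / ((1 + s\<^sup>2) * sqrt (real n))"
      using s n by (intro K) auto
    have "\<bar>freud_beta s (Suc n) + freud_beta s n - (s + sqrt A) / 6\<bar> \<le>
        K / ((1 + s\<^sup>2) * sqrt (real n)) + K / ((1 + s\<^sup>2) * sqrt (real n)) + 3 / ((1 + s\<^sup>2) * sqrt (real n))"
      using 1 2 3 by linarith
    also have "\<dots> = (2 * K + 3) / ((1 + s\<^sup>2) * sqrt (real n))"
      by (simp only: add_divide_distrib[symmetric] mult_2)
    also have "\<dots> = (2 * K + 3) / sqrt (real n) * inverse (1 + s\<^sup>2)"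
      by (simp add: divide_inverse mult_ac)
    finally show ?thesis by (simp only: A_def)
  qed
  thus ?thesis using K by (intro exI[of _ "2 * K + 3"] exI[of _ N]) auto
qed

text \<open>The slope error c/(1 + s^2) has primitive c arctan, so integrating from -T to t costs at
  most c pi for every T. As T tends to infinity the divergent terms in ln T cancel because a/12 = n
  + 1/2.\<close>

lemma ln_freud_norm_leading:
  "\<exists>K N. 0 < N \<and> (\<forall>n\<ge>N. \<bar>ln (freud_norm t n) - (planar_primitive (12 * real n + 6) t
      + (ln pi / 2 + ln (fact n) - real n * ln 2)
      - ((12 * real n + 6) / 12 * ln ((12 * real n + 6) / 2) - (12 * real n + 6) / 24))\<bar> \<le> K / sqrt (real n))"
proof -
  obtain K N where K: "0 \<le> K" "0 < N" "\<And>s n. s \<le> \<bar>t\<bar> \<Longrightarrow> n \<ge> N \<Longrightarrow>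
    \<bar>freud_beta s (Suc n) + freud_beta s n - (s + sqrt (s\<^sup>2 + (12 * real n + 6))) / 6\<bar>
      \<le> K / sqrt (real n) * inverse (1 + s\<^sup>2)"
    using freud_beta_sum_approximation[of "\<bar>t\<bar>"] by auto
  have "\<bar>ln (freud_norm t n) - (planar_primitive (12 * real n + 6) t
      + (ln pi / 2 + ln (fact n) - real n * ln 2)
      - ((12 * real n + 6) / 12 * ln ((12 * real n + 6) / 2) - (12 * real n + 6) / 24))\<bar> \<le> (K * pi) / sqrt (real n)"
    if n: "n \<ge> N" for n
  proof -
    define a where "a = 12 * real n + 6"
    define c where "c = K / sqrt (real n)"
    define L where "L s = ln (freud_norm s n)" for s
    have a: "0 < a" by (simp add: a_def)
    have c: "0 \<le> c" using K by (simp add: c_def)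
    have bnd: "\<bar>freud_beta s (Suc n) + freud_beta s n - (s + sqrt (s\<^sup>2 + a)) / 6\<bar> \<le> c * inverse (1 + s\<^sup>2)"
      if "s \<le> \<bar>t\<bar>" for s
      using K(3)[OF that n] by (simp only: a_def c_def)
    have main: "\<bar>L t - L (- T) - (planar_primitive a t - planar_primitive a (- T))\<bar> \<le> c * pi"
      if T: "- T \<le> t" for T
    proof -
      obtain M where "\<forall>s\<in>{- T..\<bar>t\<bar>}. \<forall>s'\<in>{- T..\<bar>t\<bar>}. \<bar>s' - s\<bar> \<le> 1 \<longrightarrow>
        L s' - L s \<le> (freud_beta s (Suc n) + freud_beta s n) * (s' - s) + M * (s' - s)\<^sup>2"
        using ln_freud_norm_variation[of "\<bar>t\<bar>" "- T" n] unfolding L_def by auto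
      hence M: "L s' - L s \<le> (freud_beta s (Suc n) + freud_beta s n) * (s' - s) + M * (s' - s)\<^sup>2"
        if "s \<in> {- T..t}" "s' \<in> {- T..t}" "\<bar>s' - s\<bar> \<le> 1" for s s' using that by auto
      have ne: "1 + x\<^sup>2 \<noteq> 0" for x :: real using zero_le_power2[of x] by linarith
      have cont: "continuous_on {- T..t} (\<lambda>s. (s + sqrt (s\<^sup>2 + a)) / 6 + e * inverse (1 + s\<^sup>2))" for e
        using ne by (intro continuous_intros) auto
      have der: "((\<lambda>s. planar_primitive a s + e * arctan s) has_real_derivative
          (s + sqrt (s\<^sup>2 + a)) / 6 + e * inverse (1 + s\<^sup>2)) (at s)" for e s
        by (intro DERIV_add DERIV_cmult planar_primitive_deriv a DERIV_arctan)
      \<comment> \<open>The slope error is integrated exactly by adding a multiple of arctan to the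
        primitive; the lower estimate uses the opposite sign.\<close>
      have up: "L t - L (- T) \<le> (planar_primitive a t + c * arctan t) - (planar_primitive a (- T) + c * arctan (- T))"
        using T
      proof (rule increment_le_of_slope_le[OF _ M der cont])
        fix s assume "s \<in> {- T..t}"
        hence "s \<le> \<bar>t\<bar>" by auto
        from bnd[OF this]
        show "freud_beta s (Suc n) + freud_beta s n \<le> (s + sqrt (s\<^sup>2 + a)) / 6 + c * inverse (1 + s\<^sup>2)"
          by linarith
      qed auto
      have lo: "(planar_primitive a t + (- c) * arctan t) - (planar_primitive a (- T) + (- c) * arctan (- T)) \<le> L t - L (- T)"
        using T
      proof (rule increment_ge_of_slope_ge[OF _ M der cont])
        fix s assume "s \<in> {- T..t}"
        hence "s \<le> \<bar>t\<bar>" by auto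
        from bnd[OF this]
        show "(s + sqrt (s\<^sup>2 + a)) / 6 + (- c) * inverse (1 + s\<^sup>2) \<le> freud_beta s (Suc n) + freud_beta s n"
          by linarith
      qed auto
      have "arctan t - arctan (- T) \<le> pi"
        using arctan_bounded[of t] arctan_bounded[of "- T"] by linarith
      hence "c * (arctan t - arctan (- T)) \<le> c * pi" using c by (rule mult_left_mono)
      thus ?thesis using up lo by (simp add: algebra_simps abs_le_iff)
    qed
    have lim: "((\<lambda>T. \<bar>L t - planar_primitive a t - ((L (- T) + (real n + 1 / 2) * ln T) -
        (planar_primitive a (- T) + a / 12 * ln T))\<bar>) \<longlongrightarrow>
        \<bar>L t - planar_primitive a t - ((ln pi / 2 + ln (fact n) - real n * ln 2) - (a / 12 * ln (a / 2) - a / 24))\<bar>) at_top"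
      unfolding L_def
      by (intro tendsto_rabs tendsto_diff tendsto_const ln_freud_norm_at_minus_infinity
          planar_primitive_at_minus_infinity a)
    have "\<bar>L t - planar_primitive a t - ((ln pi / 2 + ln (fact n) - real n * ln 2) - (a / 12 * ln (a / 2) - a / 24))\<bar> \<le> c * pi"
    proof (rule tendsto_upperbound[OF lim])
      show "\<forall>\<^sub>F T in at_top. \<bar>L t - planar_primitive a t - ((L (- T) + (real n + 1 / 2) * ln T) -
        (planar_primitive a (- T) + a / 12 * ln T))\<bar> \<le> c * pi"
        using eventually_ge_at_top[of "- t"]
      proof eventually_elim
        case (elim T)
        have a12: "a / 12 = real n + 1 / 2" by (simp add: a_def)
        have eq: "L t - planar_primitive a t - ((L (- T) + (real n + 1 / 2) * ln T) - (planar_primitive a (- T) + a / 12 * ln T))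
          = L t - L (- T) - (planar_primitive a t - planar_primitive a (- T))"
          unfolding a12 by simp
        show ?case unfolding eq using elim by (intro main) simp
      qed
    qed simp
    thus ?thesis by (simp add: L_def a_def c_def algebra_simps)
  qed
  thus ?thesis using K(2) by blast
qed

section \<open>Stirling's formula from the Wallis product\<close>

lemma prod_wallis_eq_fact:
  "(\<Prod>k = 1..n. (4 * (real k)\<^sup>2) / (4 * (real k)\<^sup>2 - 1)) =
     2 ^ (4 * n) * fact n ^ 4 / ((fact (2 * n))\<^sup>2 * (2 * real n + 1))"
proof (induction n)
  case (Suc n)
  have 1: "4 * (real (Suc n))\<^sup>2 - 1 = (2 * real n + 1) * (2 * real n + 3)"
    by (simp add: power2_eq_square algebra_simps)
  have 2: "fact (2 * Suc n) = 2 * (real n + 1) * ((2 * real n + 1) * fact (2 * n) :: real)"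
    by (simp add: algebra_simps)
  have 3: "fact (Suc n) = (real n + 1) * (fact n :: real)"
    by (simp add: algebra_simps)
  have 4: "2 * real (Suc n) + 1 = 2 * real n + 3" "real (Suc n) = real n + 1" by simp_all
  have 6: "2 * (real n + 1) + 1 = 2 * real n + 3" by simp
  have 5: "(2::real) ^ (4 * Suc n) = 16 * 2 ^ (4 * n)" by (simp add: power_add)
  define x where "x = real n"
  have x: "0 \<le> x" by (simp add: x_def)
  define f g where "f = (fact n :: real)" and "g = (fact (2 * n) :: real)"
  have fg: "0 < f" "0 < g" by (simp_all add: f_def g_def)
  have nz: "2 * x + 1 \<noteq> 0" "2 * x + 3 \<noteq> 0" "x + 1 \<noteq> 0" using x by auto
  have eq: "2 ^ (4 * n) * f ^ 4 / (g\<^sup>2 * (2 * x + 1)) * (4 * (x + 1)\<^sup>2 / ((2 * x + 1) * (2 * x + 3))) =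
      16 * 2 ^ (4 * n) * ((x + 1) * f) ^ 4 / ((2 * (x + 1) * ((2 * x + 1) * g))\<^sup>2 * (2 * x + 3))"
  proof -
    have "p * f ^ 4 / (g\<^sup>2 * u) * (4 * y\<^sup>2 / (u * v)) = 16 * p * (y * f) ^ 4 / ((2 * y * (u * g))\<^sup>2 * v)"
      if "u \<noteq> 0" "v \<noteq> 0" "y \<noteq> 0" for p u v y :: real
      using that fg by (simp add: divide_simps) (simp add: power2_eq_square power4_eq_xxxx)
    from this[OF nz] show ?thesis .
  qed
  have "(\<Prod>k = 1..Suc n. (4 * (real k)\<^sup>2) / (4 * (real k)\<^sup>2 - 1)) =
      (\<Prod>k = 1..n. (4 * (real k)\<^sup>2) / (4 * (real k)\<^sup>2 - 1)) * (4 * (real (Suc n))\<^sup>2 / (4 * (real (Suc n))\<^sup>2 - 1))"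
    by (subst prod.cl_ivl_Suc) simp
  also have "\<dots> = 2 ^ (4 * n) * f ^ 4 / (g\<^sup>2 * (2 * x + 1)) * (4 * (x + 1)\<^sup>2 / ((2 * x + 1) * (2 * x + 3)))"
    unfolding Suc 1 unfolding 4 by (simp only: x_def f_def g_def)
  also note eq
  also have "16 * 2 ^ (4 * n) * ((x + 1) * f) ^ 4 / ((2 * (x + 1) * ((2 * x + 1) * g))\<^sup>2 * (2 * x + 3)) =
      2 ^ (4 * Suc n) * fact (Suc n) ^ 4 / ((fact (2 * Suc n))\<^sup>2 * (2 * real (Suc n) + 1))"
    unfolding 2 3 4 5 by (simp only: x_def f_def g_def 6)
  finally show ?case .
qed simp

text \<open>The increments of \<open>d\<close> are O(n^(-2)), so \<open>d\<close> converges. Its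
  limit c is found from 4 d(n) - 2 d(2n), which is the logarithm of the Wallis product up to terms
  tending to -2 ln 2: this gives 2 c - 2 ln 2 = ln (pi/2). The convention ln 0 = 0 enters only
  through \<open>d 0\<close>, which cancels.\<close>

lemma ln_fact_stirling:
  "(\<lambda>n. ln (fact n) - ((real n + 1 / 2) * ln (real n) - real n)) \<longlonglongrightarrow> ln (2 * pi) / 2"
proof -
  define d where "d n = ln (fact n) - ((real n + 1 / 2) * ln (real n) - real n)" for n
  have "ln (fact (Suc n)) = ln (real n + 1) + ln (fact n)" for n
    unfolding fact_Suc by (subst ln_mult_pos) (auto simp: add.commute)
  hence diff: "d (Suc n) - d n = 1 - (real n + 1 / 2) * (ln (real n + 1) - ln (real n))" for n
    by (simp add: d_def algebra_simps del: fact_Suc)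
  have bigo: "(\<lambda>n. 1 - (real n + 1 / 2) * (ln (real n + 1) - ln (real n))) \<in> O(\<lambda>n. 1 / real n ^ 2)"
    by real_asymp
  have "summable (\<lambda>n. norm (1 / real n ^ 2))"
    using inverse_power_summable[of 2, where ?'a = real] by (simp add: inverse_eq_divide)
  hence "summable (\<lambda>n. d (Suc n) - d n)"
    unfolding diff using bigo by (rule summable_comparison_test_bigo)
  hence "(\<lambda>n. \<Sum>k<n. d (Suc k) - d k) \<longlonglongrightarrow> (\<Sum>n. d (Suc n) - d n)"
    by (rule summable_LIMSEQ)
  hence "(\<lambda>n. (d n - d 0) + d 0) \<longlonglongrightarrow> (\<Sum>n. d (Suc n) - d n) + d 0"
    unfolding sum_lessThan_telescope by (intro tendsto_add tendsto_const)
  then obtain c where c: "d \<longlonglongrightarrow> c" by (auto simp: fun_eq_iff)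
  hence c2: "(\<lambda>n. d (2 * n)) \<longlonglongrightarrow> c"
    by (rule filterlim_compose) (rule filterlim_subseq, simp add: strict_mono_def)
  have "(\<lambda>n. ln (\<Prod>k = 1..n. (4 * (real k)\<^sup>2) / (4 * (real k)\<^sup>2 - 1))) \<longlonglongrightarrow> ln (pi / 2)"
    using wallis by (intro tendsto_ln) auto
  moreover have "(\<lambda>n. ln (\<Prod>k = 1..n. (4 * (real k)\<^sup>2) / (4 * (real k)\<^sup>2 - 1))) \<longlonglongrightarrow> 4 * c - 2 * c - 2 * ln 2"
  proof (rule Lim_transform_eventually)
    have "(\<lambda>n. ln (real n) - ln 2 - ln (2 * real n + 1)) \<longlonglongrightarrow> - 2 * ln 2"
      by real_asymp
    from tendsto_add[OF tendsto_diff[OF tendsto_mult_left[OF c, of 4] tendsto_mult_left[OF c2, of 2]] this]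
    show "(\<lambda>n. 4 * d n - 2 * d (2 * n) + (ln (real n) - ln 2 - ln (2 * real n + 1))) \<longlonglongrightarrow> 4 * c - 2 * c - 2 * ln 2"
      by simp
    show "\<forall>\<^sub>F n in sequentially. 4 * d n - 2 * d (2 * n) + (ln (real n) - ln 2 - ln (2 * real n + 1)) =
        ln (\<Prod>k = 1..n. (4 * (real k)\<^sup>2) / (4 * (real k)\<^sup>2 - 1))"
      using eventually_gt_at_top[of 0]
    proof eventually_elim
      case (elim n)
      have "ln (\<Prod>k = 1..n. (4 * (real k)\<^sup>2) / (4 * (real k)\<^sup>2 - 1)) =
          real (4 * n) * ln 2 + 4 * ln (fact n) - (2 * ln (fact (2 * n)) + ln (2 * real n + 1))"
        unfolding prod_wallis_eq_fact
        by (simp add: ln_divide_pos ln_mult_pos ln_realpow add_pos_nonneg del: of_nat_mult)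
      moreover have "ln (real (2 * n)) = ln 2 + ln (real n)" using elim by (simp add: ln_mult_pos)
      ultimately show ?case unfolding d_def by (simp add: algebra_simps)
    qed
  qed
  ultimately have "4 * c - 2 * c - 2 * ln 2 = ln (pi / 2)" by (rule LIMSEQ_unique[symmetric])
  hence "c = ln (2 * pi) / 2" by (simp add: ln_divide_pos ln_mult_pos)
  with c have "d \<longlonglongrightarrow> ln (2 * pi) / 2" by (simp only:)
  thus ?thesis unfolding d_def[abs_def] .
qed

definition ln_norm_expansion :: "real \<Rightarrow> nat \<Rightarrow> real"
  where "ln_norm_expansion t n = real n * ln (real n) / 2 - 1 / 2 * (1 + ln 12) * real n
       + real n powr (1 / 2) * t / sqrt 3 + ln (real n) / 4
       + t ^ 2 / 12 - ln 12 / 4 + ln (2 * pi)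
       + t * (t ^ 2 + 18) / (72 * sqrt 3 * real n powr (1 / 2))
       - t * (t ^ 4 + 20 * t ^ 2 + 120) / (5760 * sqrt 3 * real n powr (3 / 2))
       + (t ^ 2 + 6) / (288 * real n ^ 2)"

lemma planar_primitive_at_infinity:
  "((\<lambda>a. planar_primitive a t - (t\<^sup>2 / 12 + a * ln a / 24 + t * sqrt a / 6)) \<longlongrightarrow> 0) at_top"
proof -
  have "((\<lambda>a. t * sqrt (t * t + a) + a * ln (t + sqrt (t * t + a)) - a * ln a / 2 - 2 * t * sqrt a) \<longlongrightarrow> 0) at_top"
    by real_asymp
  hence "((\<lambda>a. 1 / 12 * (t * sqrt (t\<^sup>2 + a) + a * ln (t + sqrt (t\<^sup>2 + a)) - a * ln a / 2 - 2 * t * sqrt a)) \<longlongrightarrow> 0) at_top"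
    unfolding power2_eq_square by (rule tendsto_mult_right_zero)
  thus ?thesis by (simp add: planar_primitive_def algebra_simps add_divide_distrib diff_divide_distrib)
qed

text \<open>The difference splits into null sequences: \<open>S\<close> is the Stirling error,
  \<open>Q\<close> the error in expanding the primitive, and \<open>V\<close> collects the terms of
  negative order in the expansion.\<close>

lemma planar_constant_asymptotics:
  "(\<lambda>n. planar_primitive (12 * real n + 6) t + (ln pi / 2 + ln (fact n) - real n * ln 2)
      - ((12 * real n + 6) / 12 * ln ((12 * real n + 6) / 2) - (12 * real n + 6) / 24)
      - ln_norm_expansion t n) \<longlonglongrightarrow> 0"
proof (rule Lim_transform_eventually)
  define S where "S n = ln (fact n) - ((real n + 1 / 2) * ln (real n) - real n) - ln (2 * pi) / 2" for n
  have S: "S \<longlonglongrightarrow> 0"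
    unfolding S_def using tendsto_diff[OF ln_fact_stirling tendsto_const[of "ln (2 * pi) / 2"]] by simp
  define Q where "Q n = planar_primitive (12 * real n + 6) t -
      (t\<^sup>2 / 12 + (12 * real n + 6) * ln (12 * real n + 6) / 24 + t * sqrt (12 * real n + 6) / 6)" for n
  have "filterlim (\<lambda>n. 12 * real n + 6) at_top sequentially" by real_asymp
  hence Q: "Q \<longlonglongrightarrow> 0"
    unfolding Q_def by (rule filterlim_compose[OF planar_primitive_at_infinity])
  \<comment> \<open>\<open>R\<close> and \<open>U\<close> come from replacing n + 1/2 by n in the
    logarithmic and in the square root term; the shift in the former contributes -1/4, which is
    compensated here.\<close>
  define R where "R n = (real n + 1 / 2) / 2 * (ln (real n) - ln (real n + 1 / 2)) + 1 / 4" for n :: nat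
  have R: "R \<longlonglongrightarrow> 0" unfolding R_def by real_asymp
  define U where "U n = t / sqrt 3 * (sqrt (real n + 1 / 2) - sqrt (real n))" for n :: nat
  have U: "U \<longlonglongrightarrow> 0"
    unfolding U_def by (intro tendsto_mult_right_zero) real_asymp
  define V where "V n = t * (t ^ 2 + 18) / (72 * sqrt 3) * (1 / real n powr (1 / 2))
       - t * (t ^ 4 + 20 * t ^ 2 + 120) / (5760 * sqrt 3) * (1 / real n powr (3 / 2))
       + (t ^ 2 + 6) / 288 * (1 / real n ^ 2)" for n
  have "(\<lambda>n. 1 / real n powr (1 / 2)) \<longlonglongrightarrow> 0" "(\<lambda>n. 1 / real n powr (3 / 2)) \<longlonglongrightarrow> 0" "(\<lambda>n. 1 / real n ^ 2) \<longlonglongrightarrow> 0"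
    by real_asymp+
  hence "V \<longlonglongrightarrow> t * (t ^ 2 + 18) / (72 * sqrt 3) * 0 - t * (t ^ 4 + 20 * t ^ 2 + 120) / (5760 * sqrt 3) * 0 + (t ^ 2 + 6) / 288 * 0"
    unfolding V_def by (intro tendsto_intros)
  hence V: "V \<longlonglongrightarrow> 0" by simp
  show "(\<lambda>n. S n + Q n + R n + U n - V n) \<longlonglongrightarrow> 0"
    using tendsto_diff[OF tendsto_add[OF tendsto_add[OF tendsto_add[OF S Q] R] U] V] by simp
  show "\<forall>\<^sub>F n in sequentially. S n + Q n + R n + U n - V n =
      planar_primitive (12 * real n + 6) t + (ln pi / 2 + ln (fact n) - real n * ln 2)
      - ((12 * real n + 6) / 12 * ln ((12 * real n + 6) / 2) - (12 * real n + 6) / 24)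
      - ln_norm_expansion t n"
    using eventually_gt_at_top[of 0]
  proof eventually_elim
    case (elim n)
    define m where "m = real n + 1 / 2"
    have m: "0 < m" "12 * real n + 6 = 12 * m" by (simp_all add: m_def)
    have l12: "ln 12 = 2 * ln 2 + ln (3::real)"
      using ln_mult_pos[of "2 * 2" "3::real"] ln_mult_pos[of 2 "2::real"] by simp
    have l6: "ln (12 * m / 2) = ln 2 + ln 3 + ln m"
      using m ln_mult_pos[of 6 m] ln_mult_pos[of 2 "3::real"] by simp
    have l12m: "ln (12 * m) = 2 * ln 2 + ln 3 + ln m" using m ln_mult_pos[of 12 m] l12 by simp
    have "sqrt (12 * m) = 2 * sqrt 3 * sqrt m"
      using real_sqrt_mult[of 4 3] by (simp add: real_sqrt_mult)
    also have "\<dots> = 6 / sqrt 3 * sqrt m" by (simp add: field_simps)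
    finally have s12: "sqrt (12 * m) = 6 / sqrt 3 * sqrt m" .
    have V: "V n = t * (t ^ 2 + 18) / (72 * sqrt 3 * real n powr (1 / 2))
       - t * (t ^ 4 + 20 * t ^ 2 + 120) / (5760 * sqrt 3 * real n powr (3 / 2))
       + (t ^ 2 + 6) / (288 * real n ^ 2)" by (simp add: V_def)
    have p: "real n powr (1 / 2) = sqrt (real n)" by (simp add: powr_half_sqrt)
    have l2pi: "ln (2 * pi) = ln 2 + ln pi" by (simp add: ln_mult_pos)
    have n: "real n = m - 1 / 2" by (simp add: m_def)
    show ?case
      unfolding S_def Q_def R_def U_def ln_norm_expansion_def m(2) l12m l6 s12 l2pi m_def[symmetric]
      unfolding V p l12
      unfolding m_def by (simp add: algebra_simps add_divide_distrib diff_divide_distrib)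
  qed
qed

lemma ln_freud_norm_limit: "(\<lambda>n. ln (freud_norm t n) - ln_norm_expansion t n) \<longlonglongrightarrow> 0"
proof -
  let ?E = "\<lambda>n. planar_primitive (12 * real n + 6) t + (ln pi / 2 + ln (fact n) - real n * ln 2)
      - ((12 * real n + 6) / 12 * ln ((12 * real n + 6) / 2) - (12 * real n + 6) / 24)"
  obtain K N where K: "\<And>n. n \<ge> N \<Longrightarrow> \<bar>ln (freud_norm t n) - ?E n\<bar> \<le> K / sqrt (real n)"
    using ln_freud_norm_leading[of t] by blast
  have "(\<lambda>n. ln (freud_norm t n) - ?E n) \<longlonglongrightarrow> 0"
  proof (rule Lim_null_comparison)
    show "\<forall>\<^sub>F n in sequentially. norm (ln (freud_norm t n) - ?E n) \<le> K * (1 / sqrt (real n))"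
      using eventually_ge_at_top[of N] by eventually_elim (use K in simp)
    show "(\<lambda>n. K * (1 / sqrt (real n))) \<longlonglongrightarrow> 0"
      by (intro tendsto_mult_right_zero) real_asymp
  qed
  from tendsto_add[OF this planar_constant_asymptotics[of t]] show ?thesis by simp
qed

section \<open>The expansion at a fixed parameter\<close>

text \<open>The coefficients of \<open>W = beta_series t v\<close> come from inserting \<open>\<beta>\<^sub>n = W / (12 v)\<close> with \<open>v = (12 n)\<^sup>-\<^sup>1\<^sup>/\<^sup>2\<close> into the string
  equation: after expansion of the second difference of \<open>\<beta>\<close> it reads
  \<open>W (W - 12 v\<^sup>4 + 18 t\<^sup>2 v\<^sup>6 - 2 t v) = 1 + O(v\<^sup>7)\<close>.\<close>
definition beta_series :: "real \<Rightarrow> real \<Rightarrow> real"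
  where "beta_series t v = 1 + t * v + t ^ 2 / 2 * v ^ 2 + (6 - t ^ 4 / 8) * v ^ 4 + 6 * t * v ^ 5
    + (t ^ 6 / 16 - 9 * t ^ 2) * v ^ 6"

definition ln_beta_series :: "real \<Rightarrow> real \<Rightarrow> real"
  where "ln_beta_series t v = t * v - t ^ 3 / 6 * v ^ 3 + 6 * v ^ 4 + 3 * t ^ 5 / 40 * v ^ 5 - 12 * t ^ 2 * v ^ 6"

text \<open>Clearing the denominator 16 leaves integer coefficients for the polynomial identities
  below.\<close>

lemma beta_series_eq: "beta_series t v = (16 + 16 * t * v + 8 * t ^ 2 * v ^ 2 + (96 - 2 * t ^ 4) * v ^ 4 + 96 * t * v ^ 5
    + (t ^ 6 - 144 * t ^ 2) * v ^ 6) / 16"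
  unfolding beta_series_def by (simp add: field_simps)

lemma beta_series_near_0:
  "\<exists>\<delta>>0. \<forall>v. 0 \<le> v \<and> v \<le> \<delta> \<longrightarrow> 1 / 2 \<le> beta_series t v"
proof -
  have "isCont (beta_series t) 0" unfolding beta_series_def[abs_def] by (intro continuous_intros)
  hence "(beta_series t \<longlongrightarrow> 1) (at 0)" by (simp add: isCont_def beta_series_def)
  hence "\<forall>\<^sub>F v in at 0. 1 / 2 < beta_series t v" by (rule order_tendstoD) simp
  then obtain d where d: "0 < d" "\<And>v. v \<noteq> 0 \<Longrightarrow> dist v 0 < d \<Longrightarrow> 1 / 2 < beta_series t v"
    unfolding eventually_at by blast
  have "1 / 2 \<le> beta_series t v" if "0 \<le> v" "v \<le> d / 2" for v
  proof (cases "v = 0")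
    case False
    thus ?thesis using d(2)[of v] that d(1) by (simp add: dist_real_def)
  qed (simp add: beta_series_def)
  thus ?thesis using d(1) by (intro exI[of _ "d / 2"]) auto
qed

text \<open>The series \<open>L = ln_beta_series t v\<close> is determined by \<open>W' = L' W\<close> up to order \<open>v\<^sup>6\<close>, so the derivative of
  \<open>ln W - L\<close> vanishes to order 6 at the origin.\<close>
lemma ln_beta_series:
  "\<exists>C \<delta>. 0 < \<delta> \<and> (\<forall>v. 0 \<le> v \<and> v \<le> \<delta> \<longrightarrow> \<bar>ln (beta_series t v) - ln_beta_series t v\<bar> \<le> C * v ^ 7)"
proof -
  obtain \<delta> where \<delta>: "0 < \<delta>" "\<And>v. 0 \<le> v \<Longrightarrow> v \<le> \<delta> \<Longrightarrow> 1 / 2 \<le> beta_series t v"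
    using beta_series_near_0[of t] by blast
  \<comment> \<open>The cofactor of v^6 in W' - L' W. Only its boundedness on the interval enters
    the estimate.\<close>
  define Q where "Q v = ((10752 * t ^ 3 - 40 * t ^ 7) + (5376 * t ^ 4 - 18432) * v
    + (10 * t ^ 9 - 864 * t ^ 5 - 18432 * t) * v ^ 2 + (82944 * t ^ 2 - 1632 * t ^ 6) * v ^ 3
    + (432 * t ^ 7 + 55296 * t ^ 3 - 3 * t ^ 11) * v ^ 4 + (576 * t ^ 8 - 82944 * t ^ 4) * v ^ 5) / 128" for v
  have "continuous_on {0..\<delta>} Q" unfolding Q_def by (intro continuous_intros) auto
  hence "bounded (Q ` {0..\<delta>})" by (intro compact_imp_bounded compact_continuous_image) auto
  then obtain C where "\<forall>v\<in>{0..\<delta>}. \<bar>Q v\<bar> \<le> C"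
    by (auto simp: bounded_iff)
  hence C: "\<bar>Q v\<bar> \<le> C" if "0 \<le> v" "v \<le> \<delta>" for v
    using that by auto
  define W' where "W' v = (16 * t + 16 * t ^ 2 * v + (384 - 8 * t ^ 4) * v ^ 3 + 480 * t * v ^ 4
    + (6 * t ^ 6 - 864 * t ^ 2) * v ^ 5) / 16" for v
  define L' where "L' v = (8 * t - 4 * t ^ 3 * v ^ 2 + 192 * v ^ 3 + 3 * t ^ 5 * v ^ 4 - 576 * t ^ 2 * v ^ 5) / 8" for v
  have dW: "(beta_series t has_real_derivative W' v) (at v)" for v
    unfolding beta_series_def[abs_def] W'_def by (auto intro!: derivative_eq_intros simp: field_simps)
  have dL: "(ln_beta_series t has_real_derivative L' v) (at v)" for v
    unfolding ln_beta_series_def[abs_def] L'_def by (auto intro!: derivative_eq_intros simp: field_simps)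
  have id: "W' v - L' v * beta_series t v = v ^ 6 * Q v" for v
  proof -
    have "8 * (16 * t + 16 * t ^ 2 * v + (384 - 8 * t ^ 4) * v ^ 3 + 480 * t * v ^ 4 + (6 * t ^ 6 - 864 * t ^ 2) * v ^ 5)
      - (8 * t - 4 * t ^ 3 * v ^ 2 + 192 * v ^ 3 + 3 * t ^ 5 * v ^ 4 - 576 * t ^ 2 * v ^ 5) *
        (16 + 16 * t * v + 8 * t ^ 2 * v ^ 2 + (96 - 2 * t ^ 4) * v ^ 4 + 96 * t * v ^ 5 + (t ^ 6 - 144 * t ^ 2) * v ^ 6)
      = v ^ 6 * ((10752 * t ^ 3 - 40 * t ^ 7) + (5376 * t ^ 4 - 18432) * v
    + (10 * t ^ 9 - 864 * t ^ 5 - 18432 * t) * v ^ 2 + (82944 * t ^ 2 - 1632 * t ^ 6) * v ^ 3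
    + (432 * t ^ 7 + 55296 * t ^ 3 - 3 * t ^ 11) * v ^ 4 + (576 * t ^ 8 - 82944 * t ^ 4) * v ^ 5)"
      by algebra
    moreover have "8 * a - b * c = d * e \<Longrightarrow> a / 16 - b / 8 * (c / 16) = d * (e / 128)" for a b c d e :: real
      by simp
    ultimately show ?thesis unfolding W'_def L'_def beta_series_eq Q_def by blast
  qed
  have "\<bar>ln (beta_series t v) - ln_beta_series t v\<bar> \<le> 2 * C * v ^ 7" if v: "0 \<le> v" "v \<le> \<delta>" for v
  proof (cases "v = 0")
    case False
    let ?f = "\<lambda>v. ln (beta_series t v) - ln_beta_series t v"
    have der: "DERIV ?f x :> W' x / beta_series t x - L' x" if "0 \<le> x" "x \<le> v" for x
    proof -
      have "0 < beta_series t x" using \<delta>(2)[of x] that v by simp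
      hence "DERIV (\<lambda>v. ln (beta_series t v)) x :> inverse (beta_series t x) * W' x"
        by (intro DERIV_chain2[where g = "beta_series t" and f = ln] DERIV_ln dW)
      from DERIV_diff[OF this dL] show ?thesis by (simp add: divide_inverse mult.commute)
    qed
    \<comment> \<open>Both \<open>ln W\<close> and the series vanish at 0, so the mean value theorem
      adds one factor v to the order 6 of the derivative.\<close>
    obtain z where z: "0 < z" "z < v" "?f v - ?f 0 = (v - 0) * (W' z / beta_series t z - L' z)"
      using MVT2[of 0 v ?f "\<lambda>x. W' x / beta_series t x - L' x"] der False v by auto
    have W: "1 / 2 \<le> beta_series t z" using \<delta>(2)[of z] z v by simp
    have "W' z / beta_series t z - L' z = (W' z - L' z * beta_series t z) / beta_series t z"
      using W by (simp add: field_simps)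
    hence eq: "?f v = v * (z ^ 6 * Q z / beta_series t z)"
      using z(3) by (simp add: id) (simp add: beta_series_def ln_beta_series_def)
    have "\<bar>z ^ 6 * Q z / beta_series t z\<bar> = z ^ 6 * \<bar>Q z\<bar> / beta_series t z"
      using W z by (simp add: abs_mult)
    also have "\<dots> \<le> (v ^ 6 * C) / (1 / 2)"
    proof (rule frac_le)
      show "z ^ 6 * \<bar>Q z\<bar> \<le> v ^ 6 * C"
        using z v C[of z] by (intro mult_mono power_mono) auto
      show "0 \<le> v ^ 6 * C" using C[of 0] \<delta>(1) v by (intro mult_nonneg_nonneg) auto
    qed (use W in auto)
    also have "\<dots> = 2 * C * v ^ 6" by simp
    finally have "\<bar>z ^ 6 * Q z / beta_series t z\<bar> \<le> 2 * C * v ^ 6" .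
    hence "v * \<bar>z ^ 6 * Q z / beta_series t z\<bar> \<le> v * (2 * C * v ^ 6)"
      using v by (intro mult_left_mono)
    moreover have "\<bar>?f v\<bar> = v * \<bar>z ^ 6 * Q z / beta_series t z\<bar>"
      unfolding eq abs_mult[of v] using v by simp
    moreover have "v * (2 * C * v ^ 6) = 2 * C * v ^ 7" by (simp add: power_numeral_reduce)
    ultimately show ?thesis by simp
  qed (simp add: beta_series_def ln_beta_series_def)
  thus ?thesis using \<delta>(1) by blast
qed

section \<open>The truncated series as a sequence in n\<close>

definition vn :: "nat \<Rightarrow> real" where "vn n = 1 / sqrt (12 * real n)"

lemma vn_tendsto: "vn \<longlonglongrightarrow> 0"
  unfolding vn_def by real_asymp

lemma vn_pos: "0 < n \<Longrightarrow> 0 < vn n"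
  by (simp add: vn_def)

lemma real_eq_vn: "0 < n \<Longrightarrow> real n = 1 / (12 * vn n ^ 2)"
  by (simp add: vn_def power_divide)

lemma continuous_vn_bigo_1:
  assumes "isCont f 0"
  shows "(\<lambda>n. f (vn n) :: real) \<in> O(\<lambda>_. 1)"
proof (rule bigoI_tendsto[where c = "f 0"])
  show "(\<lambda>n. f (vn n) / 1) \<longlonglongrightarrow> f 0"
    using isCont_tendsto_compose[OF assms vn_tendsto] by simp
qed simp

definition freud_series :: "real \<Rightarrow> nat \<Rightarrow> real"
  where "freud_series t n = beta_series t (vn n) / (12 * vn n)"

definition second_diff :: "(nat \<Rightarrow> real) \<Rightarrow> nat \<Rightarrow> real"
  where "second_diff g n = g (Suc n) + g (n - 1) - 2 * g n"

lemma cmult_bigo: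
  fixes c :: real
  shows "f \<in> O[F](g) \<Longrightarrow> (\<lambda>x. c * f x) \<in> O[F](g)"
  by (cases "c = 0") auto

lemma bigo_eventually_eq:
  "eventually (\<lambda>x. f x = g x) F \<Longrightarrow> g \<in> O[F](h) \<Longrightarrow> f \<in> O[F](h)"
  using landau_o.big.in_cong[of f g F h] by simp

text \<open>Second differences gain a factor n^(-2). Only those of sqrt(12 n) and v are larger than
  n^(-3): their leading terms, the second derivatives in n, are -36 v^3 and 108 v^5.\<close>

lemma second_diff_bigo:
  "(\<lambda>n. second_diff (\<lambda>n. sqrt (12 * real n)) n + 36 * vn n ^ 3) \<in> O(\<lambda>n. real n powr (- 3))"
  "(\<lambda>n. second_diff vn n - 108 * vn n ^ 5) \<in> O(\<lambda>n. real n powr (- 3))"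
  "(\<lambda>n. second_diff (\<lambda>n. vn n ^ 3) n) \<in> O(\<lambda>n. real n powr (- 3))"
  "(\<lambda>n. second_diff (\<lambda>n. vn n ^ 4) n) \<in> O(\<lambda>n. real n powr (- 3))"
  "(\<lambda>n. second_diff (\<lambda>n. vn n ^ 5) n) \<in> O(\<lambda>n. real n powr (- 3))"
proof -
  have ev: "\<forall>\<^sub>F n in sequentially. real (n - 1) = real n - 1"
    using eventually_ge_at_top[of 1] by eventually_elim (simp add: of_nat_diff)
  have *: "f \<in> O(\<lambda>n. real n powr (- 3))"
    if "g \<in> O(\<lambda>n. real n powr (- 3))" "\<And>n. real (n - 1) = real n - 1 \<Longrightarrow> f n = g n" for f g :: "nat \<Rightarrow> real"
  proof -
    have "\<forall>\<^sub>F n in sequentially. f n = g n" using ev by eventually_elim (rule that(2))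
    thus ?thesis using that(1) by (rule bigo_eventually_eq)
  qed
  show "(\<lambda>n. second_diff (\<lambda>n. sqrt (12 * real n)) n + 36 * vn n ^ 3) \<in> O(\<lambda>n. real n powr (- 3))"
  proof (rule *)
    have "(\<lambda>n. sqrt (real n + 1) + sqrt (real n - 1) - 2 * sqrt (real n) + 1 / 4 * (1 / sqrt (real n)) ^ 3)
      \<in> O(\<lambda>n. real n powr (- 3))" by real_asymp
    thus "(\<lambda>n. sqrt 12 * (sqrt (real n + 1) + sqrt (real n - 1) - 2 * sqrt (real n) + 1 / 4 * (1 / sqrt (real n)) ^ 3))
      \<in> O(\<lambda>n. real n powr (- 3))" by (rule cmult_bigo)
    fix n assume n: "real (n - 1) = real n - 1"
    have "36 * (1 / sqrt 12) ^ 3 = 3 / sqrt 12" by (simp add: power3_eq_cube)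
    also have "\<dots> = sqrt 12 / 4" by (simp add: field_simps)
    finally have e: "36 * (1 / sqrt 12) ^ 3 = sqrt 12 / 4" .
    have "36 * (1 / (sqrt 12 * x)) ^ 3 = 36 * (1 / sqrt 12) ^ 3 * (1 / x) ^ 3" for x :: real
      by (simp add: power_mult_distrib power_divide)
    hence "36 * (1 / (sqrt 12 * x)) ^ 3 = sqrt 12 * (1 / 4 * (1 / x) ^ 3)" for x :: real
      unfolding e by simp
    thus "second_diff (\<lambda>n. sqrt (12 * real n)) n + 36 * vn n ^ 3 =
      sqrt 12 * (sqrt (real n + 1) + sqrt (real n - 1) - 2 * sqrt (real n) + 1 / 4 * (1 / sqrt (real n)) ^ 3)"
      unfolding second_diff_def vn_def n of_nat_Suc real_sqrt_mult by (simp only:) (simp add: algebra_simps)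
  qed
  show "(\<lambda>n. second_diff vn n - 108 * vn n ^ 5) \<in> O(\<lambda>n. real n powr (- 3))"
  proof (rule *)
    have "(\<lambda>n. 1 / sqrt (real n + 1) + 1 / sqrt (real n - 1) - 2 * (1 / sqrt (real n)) - 3 / 4 * (1 / sqrt (real n)) ^ 5)
      \<in> O(\<lambda>n. real n powr (- 3))" by real_asymp
    thus "(\<lambda>n. 1 / sqrt 12 * (1 / sqrt (real n + 1) + 1 / sqrt (real n - 1) - 2 * (1 / sqrt (real n)) - 3 / 4 * (1 / sqrt (real n)) ^ 5))
      \<in> O(\<lambda>n. real n powr (- 3))" by (rule cmult_bigo)
    fix n assume n: "real (n - 1) = real n - 1"
    have "x ^ 5 = x\<^sup>2 * x\<^sup>2 * x" for x :: real by (simp add: eval_nat_numeral)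
    from this[of "sqrt 12"] have e: "108 * (1 / sqrt 12) ^ 5 = 1 / sqrt 12 * (3 / 4)" by (simp add: power_divide)
    have "108 * (1 / (sqrt 12 * x)) ^ 5 = 108 * (1 / sqrt 12) ^ 5 * (1 / x) ^ 5" for x :: real
      by (simp add: power_mult_distrib power_divide)
    hence e5: "108 * (1 / (sqrt 12 * x)) ^ 5 = 1 / sqrt 12 * (3 / 4 * (1 / x) ^ 5)" for x :: real
      unfolding e by simp
    have e1: "1 / (sqrt 12 * x) = 1 / sqrt 12 * (1 / x)" for x :: real by simp
    have gen: "k * x + k * y - 2 * (k * z) - k * w = k * (x + y - 2 * z - w)" for k x y z w :: real
      by (simp add: algebra_simps)
    show "second_diff vn n - 108 * vn n ^ 5 =
      1 / sqrt 12 * (1 / sqrt (real n + 1) + 1 / sqrt (real n - 1) - 2 * (1 / sqrt (real n)) - 3 / 4 * (1 / sqrt (real n)) ^ 5)"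
      unfolding second_diff_def vn_def n of_nat_Suc real_sqrt_mult e5 unfolding e1 gen by (simp only: add.commute)
  qed
  have pw: "second_diff (\<lambda>n. vn n ^ k) n =
      (1 / sqrt 12) ^ k * ((1 / sqrt (real n + 1)) ^ k + (1 / sqrt (real n - 1)) ^ k - 2 * (1 / sqrt (real n)) ^ k)"
    if n: "real (n - 1) = real n - 1" for n k
  proof -
    have gen: "(c * x) ^ k + (c * y) ^ k - 2 * (c * z) ^ k = c ^ k * (x ^ k + y ^ k - 2 * z ^ k)" for c x y z :: real
      by (simp add: power_mult_distrib algebra_simps)
    have e1: "1 / (sqrt 12 * x) = 1 / sqrt 12 * (1 / x)" for x :: real by simp
    show ?thesis
      unfolding second_diff_def vn_def n of_nat_Suc real_sqrt_mult unfolding e1 gen by (simp only: add.commute)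
  qed
  have "(\<lambda>n. (1 / sqrt (real n + 1)) ^ 3 + (1 / sqrt (real n - 1)) ^ 3 - 2 * (1 / sqrt (real n)) ^ 3)
    \<in> O(\<lambda>n. real n powr (- 3))" by real_asymp
  thus "(\<lambda>n. second_diff (\<lambda>n. vn n ^ 3) n) \<in> O(\<lambda>n. real n powr (- 3))"
    by (rule *[OF cmult_bigo pw])
  have "(\<lambda>n. (1 / sqrt (real n + 1)) ^ 4 + (1 / sqrt (real n - 1)) ^ 4 - 2 * (1 / sqrt (real n)) ^ 4)
    \<in> O(\<lambda>n. real n powr (- 3))" by real_asymp
  thus "(\<lambda>n. second_diff (\<lambda>n. vn n ^ 4) n) \<in> O(\<lambda>n. real n powr (- 3))"
    by (rule *[OF cmult_bigo pw])
  have "(\<lambda>n. (1 / sqrt (real n + 1)) ^ 5 + (1 / sqrt (real n - 1)) ^ 5 - 2 * (1 / sqrt (real n)) ^ 5)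
    \<in> O(\<lambda>n. real n powr (- 3))" by real_asymp
  thus "(\<lambda>n. second_diff (\<lambda>n. vn n ^ 5) n) \<in> O(\<lambda>n. real n powr (- 3))"
    by (rule *[OF cmult_bigo pw])
qed

lemma freud_series_expand:
  assumes "0 < n"
  shows "freud_series t n = (sqrt (12 * real n) + t + t ^ 2 / 2 * vn n + (6 - t ^ 4 / 8) * vn n ^ 3
    + 6 * t * vn n ^ 4 + (t ^ 6 / 16 - 9 * t ^ 2) * vn n ^ 5) / 12"
proof -
  have v: "0 < vn n" using assms by (rule vn_pos)
  have S: "sqrt (12 * real n) = 1 / vn n" by (simp add: vn_def)
  have gen: "(1 + t * v + a * v ^ 2 + b * v ^ 4 + c * v ^ 5 + d * v ^ 6) / (12 * v) =
      (1 / v + t + a * v + b * v ^ 3 + c * v ^ 4 + d * v ^ 5) / 12" if "v \<noteq> 0" for a b c d v :: real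
    using that by (simp add: add_divide_distrib power_numeral_reduce)
  show ?thesis unfolding freud_series_def beta_series_def S by (rule gen) (use v in simp)
qed

text \<open>The constants are 36/12 = 3 from the square root and (t^2/2) (108/12) = 9 t^2/2 from the
  term in v. Multiplied by 4 v they become the terms -12 v^4 and 18 t^2 v^6 of the equation that
  determines W.\<close>

lemma freud_series_second_diff:
  "(\<lambda>n. second_diff (freud_series t) n + 3 * vn n ^ 3 - 9 / 2 * t ^ 2 * vn n ^ 5) \<in> O(\<lambda>n. real n powr (- 3))"
proof -
  define a b c d where "a = t ^ 2 / 2" and "b = 6 - t ^ 4 / 8" and "c = 6 * t" and "d = t ^ 6 / 16 - 9 * t ^ 2"
  let ?f = "\<lambda>n. 1 / 12 * (second_diff (\<lambda>n. sqrt (12 * real n)) n + 36 * vn n ^ 3)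
    + a / 12 * (second_diff vn n - 108 * vn n ^ 5)
    + b / 12 * second_diff (\<lambda>n. vn n ^ 3) n + c / 12 * second_diff (\<lambda>n. vn n ^ 4) n
    + d / 12 * second_diff (\<lambda>n. vn n ^ 5) n"
  have f: "?f \<in> O(\<lambda>n. real n powr (- 3))"
    by (rule sum_in_bigo(1)[OF sum_in_bigo(1)[OF sum_in_bigo(1)[OF sum_in_bigo(1)
      [OF cmult_bigo[OF second_diff_bigo(1)] cmult_bigo[OF second_diff_bigo(2)]] cmult_bigo[OF second_diff_bigo(3)]]
      cmult_bigo[OF second_diff_bigo(4)]] cmult_bigo[OF second_diff_bigo(5)]])
  have "\<forall>\<^sub>F n in sequentially. second_diff (freud_series t) n + 3 * vn n ^ 3 - 9 / 2 * t ^ 2 * vn n ^ 5 = ?f n"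
    \<comment> \<open>The expansion of the series is valid for positive indices only, and it is used
      at n - 1.\<close>
    using eventually_ge_at_top[of 2]
  proof eventually_elim
    case (elim n)
    have expand: "freud_series t k = (sqrt (12 * real k) + t + a * vn k + b * vn k ^ 3 + c * vn k ^ 4 + d * vn k ^ 5) / 12"
      if "0 < k" for k
      unfolding a_def b_def c_def d_def by (rule freud_series_expand[OF that])
    have k: "0 < Suc n" "0 < n - 1" "0 < n" using elim by auto
    have a: "9 / 2 * t ^ 2 = 9 * a" by (simp add: a_def)
    have gen: "(S1 + t + a * V1 + b * X1 + c * Y1 + d * Z1) / 12 + (S2 + t + a * V2 + b * X2 + c * Y2 + d * Z2) / 12
        - 2 * ((S3 + t + a * V3 + b * X3 + c * Y3 + d * Z3) / 12) + 3 * p - 9 * a * q =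
      1 / 12 * (S1 + S2 - 2 * S3 + 36 * p) + a / 12 * (V1 + V2 - 2 * V3 - 108 * q) + b / 12 * (X1 + X2 - 2 * X3)
        + c / 12 * (Y1 + Y2 - 2 * Y3) + d / 12 * (Z1 + Z2 - 2 * Z3)"
      for S1 S2 S3 V1 V2 V3 X1 X2 X3 Y1 Y2 Y3 Z1 Z2 Z3 p q :: real
      by (simp add: field_simps)
    show ?case unfolding second_diff_def a expand[OF k(1)] expand[OF k(2)] expand[OF k(3)]
      by (rule gen)
  qed
  thus ?thesis using f by (rule bigo_eventually_eq)
qed

lemma isCont_beta_series: "isCont (beta_series t) x"
  unfolding beta_series_def[abs_def] by (intro continuous_intros)

lemma beta_series_vn_tendsto: "(\<lambda>n. beta_series t (vn n)) \<longlonglongrightarrow> 1"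
  using isCont_tendsto_compose[OF isCont_beta_series vn_tendsto, of t] by (simp add: beta_series_def)

lemma freud_series_pos: "\<forall>\<^sub>F n in sequentially. 0 < freud_series t n"
  using order_tendstoD(1)[OF beta_series_vn_tendsto zero_less_one, of t] eventually_gt_at_top[of 0]
  by eventually_elim (simp add: freud_series_def vn_pos)

text \<open>7/24 is slightly above 1/sqrt 12, and half of it stays below 1/6. The product with the a
  priori bound (|t| + sqrt n)/2 is therefore eventually at most n/6, as the contraction
  requires.\<close>

lemma freud_series_le: "\<forall>\<^sub>F n in sequentially. freud_series t n \<le> 7 / 24 * sqrt (real n)"
proof -
  have "\<forall>\<^sub>F n in sequentially. beta_series t (vn n) < 101 / 100"
    by (rule order_tendstoD(2)[OF beta_series_vn_tendsto]) simp
  thus ?thesis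
  proof eventually_elim
    case (elim n)
    have "sqrt 12 \<le> 350 / 101" by (rule real_le_lsqrt) (simp_all add: power2_eq_square)
    have "freud_series t n = beta_series t (vn n) * (sqrt 12 * sqrt (real n)) / 12"
      by (simp add: freud_series_def vn_def real_sqrt_mult)
    also have "\<dots> \<le> 101 / 100 * (350 / 101 * sqrt (real n)) / 12"
      using elim \<open>sqrt 12 \<le> _\<close> by (intro divide_right_mono mult_mono) auto
    finally show ?case by simp
  qed
qed

text \<open>The residual has two sources: the error in the second difference, and the defect v^7
  Q(v) of W in its truncated equation. The scaling by n = 1/(12 v^2) and the division by 4 b = W/(3
  v) turn the latter into v^6 Q/(4 W), again O(n^(-3)).\<close>

lemma freud_series_residual:
  "(\<lambda>n. \<bar>freud_series t n * (4 * (freud_series t (Suc n) + freud_series t n + freud_series t (n - 1)) - 2 * t) - real n\<bar>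
      / (4 * freud_series t n)) \<in> O(\<lambda>n. real n powr (- 3))"
proof -
  define \<Delta> where "\<Delta> n = second_diff (freud_series t) n + 3 * vn n ^ 3 - 9 / 2 * t ^ 2 * vn n ^ 5" for n
  define Q where "Q v = (6144 * t ^ 3 + (20 * t ^ 8 - 9216) * v - 384 * t ^ 5 * v ^ 2 + (36864 * t ^ 2 - 4 * t ^ 10) * v ^ 3
    + 192 * t ^ 7 * v ^ 4 + (t ^ 12 - 20736 * t ^ 4) * v ^ 5) / 256" for v
  have id: "beta_series t v * (beta_series t v - 12 * v ^ 4 + 18 * t ^ 2 * v ^ 6 - 2 * t * v) - 1 = v ^ 7 * Q v" for v
  proof -
    let ?W = "16 + 16 * t * v + 8 * t ^ 2 * v ^ 2 + (96 - 2 * t ^ 4) * v ^ 4 + 96 * t * v ^ 5 + (t ^ 6 - 144 * t ^ 2) * v ^ 6"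
    have "?W * (?W - 16 * (12 * v ^ 4) + 16 * (18 * t ^ 2 * v ^ 6) - 16 * (2 * t * v)) - 256 =
      v ^ 7 * (6144 * t ^ 3 + (20 * t ^ 8 - 9216) * v - 384 * t ^ 5 * v ^ 2 + (36864 * t ^ 2 - 4 * t ^ 10) * v ^ 3
      + 192 * t ^ 7 * v ^ 4 + (t ^ 12 - 20736 * t ^ 4) * v ^ 5)"
      by algebra
    moreover have "w * (w - 16 * a + 16 * b - 16 * c) - 256 = d * e \<Longrightarrow>
        w / 16 * (w / 16 - a + b - c) - 1 = d * (e / 256)" for w a b c d e :: real
      by (simp add: field_simps)
    ultimately show ?thesis unfolding beta_series_eq Q_def by blast
  qed
  let ?g = "\<lambda>n. \<Delta> n + 1 / 4 * (vn n ^ 6 * (Q (vn n) / beta_series t (vn n)))"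
  have "(\<lambda>n. vn n ^ 6) \<in> O(\<lambda>n. real n powr (- 3))"
    unfolding vn_def by real_asymp
  moreover have "(\<lambda>n. Q (vn n) / beta_series t (vn n)) \<in> O(\<lambda>_. 1)"
    by (rule continuous_vn_bigo_1[of "\<lambda>v. Q v / beta_series t v"])
      (auto intro!: continuous_intros isCont_beta_series simp: Q_def beta_series_def)
  ultimately have "(\<lambda>n. vn n ^ 6 * (Q (vn n) / beta_series t (vn n))) \<in> O(\<lambda>n. real n powr (- 3) * 1)"
    by (rule landau_o.big.mult)
  hence g: "?g \<in> O(\<lambda>n. real n powr (- 3))"
    unfolding \<Delta>_def by (intro sum_in_bigo(1) cmult_bigo freud_series_second_diff) simp_all
  have "\<forall>\<^sub>F n in sequentially. \<bar>freud_series t n * (4 * (freud_series t (Suc n) + freud_series t n + freud_series t (n - 1)) - 2 * t) - real n\<bar>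
      / (4 * freud_series t n) = \<bar>?g n\<bar>"
    using freud_series_pos[of t] eventually_gt_at_top[of 0]
  proof eventually_elim
    case (elim n)
    define v b W where "v = vn n" and "b = freud_series t n" and "W = beta_series t v"
    have v: "0 < v" using elim by (simp add: v_def vn_pos)
    have b: "b = W / (12 * v)" by (simp add: b_def freud_series_def v_def W_def)
    have W: "0 < W" using elim v b by (simp add: b_def[symmetric] zero_less_divide_iff)
    have sum: "freud_series t (Suc n) + freud_series t n + freud_series t (n - 1) =
        3 * b + (\<Delta> n - 3 * v ^ 3 + 9 / 2 * t ^ 2 * v ^ 5)"
      by (simp add: \<Delta>_def second_diff_def b_def v_def)
    have "b * (4 * (3 * b + (\<Delta> n - 3 * v ^ 3 + 9 / 2 * t ^ 2 * v ^ 5)) - 2 * t) - 1 / (12 * v ^ 2) =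
        4 * b * \<Delta> n + (W * (W - 12 * v ^ 4 + 18 * t ^ 2 * v ^ 6 - 2 * t * v) - 1) / (12 * v ^ 2)"
      unfolding b using v by (simp add: field_simps power_numeral_reduce)
    also have "\<dots> = 4 * b * \<Delta> n + v ^ 7 * Q v / (12 * v ^ 2)"
      unfolding W_def id ..
    also have "v ^ 7 * Q v / (12 * v ^ 2) = 4 * b * (1 / 4 * (v ^ 6 * (Q v / W)))"
      unfolding b using v W by (simp add: field_simps power_numeral_reduce)
    also have "4 * b * \<Delta> n + 4 * b * (1 / 4 * (v ^ 6 * (Q v / W))) = 4 * b * ?g n"
      by (simp add: distrib_left v_def W_def)
    finally have "freud_series t n * (4 * (freud_series t (Suc n) + freud_series t n + freud_series t (n - 1)) - 2 * t) - real n
        = 4 * b * ?g n"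
      unfolding sum using real_eq_vn[of n] elim by (simp add: b_def[symmetric] v_def)
    thus ?case using elim by (simp add: abs_mult b_def)
  qed
  moreover have "(\<lambda>n. \<bar>?g n\<bar>) \<in> O(\<lambda>n. real n powr (- 3))"
    using g by simp
  ultimately show ?thesis by (rule bigo_eventually_eq)
qed

text \<open>Comparison with K/n^3. As in the planar case the neighbours take 9/10 of the bound and
  the residual 1/10, so K >= 10 C; the second summand of \<open>K\<close> covers the starting
  index.\<close>

lemma freud_beta_series: "(\<lambda>n. freud_beta t n - freud_series t n) \<in> O(\<lambda>n. real n powr (- 3))"
proof -
  obtain C where C: "0 < C" "\<forall>\<^sub>F n in sequentially. norm (\<bar>freud_series t n * (4 * (freud_series t (Suc n) + freud_series t n + freud_series t (n - 1)) - 2 * t) - real n\<bar>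
      / (4 * freud_series t n)) \<le> C * norm (real n powr (- 3))"
    using freud_series_residual by (rule landau_o.bigE)
  have "\<forall>\<^sub>F n in sequentially. 7 * sqrt (real n) * (\<bar>t\<bar> + sqrt (real n)) \<le> 8 * real n"
    by real_asymp
  moreover have "\<forall>\<^sub>F n::nat in sequentially. 2 / 5 * (1 / (real n + 1) ^ 3 + 1 / (real n - 1) ^ 3) \<le> 9 / 10 / real n ^ 3"
    by real_asymp
  ultimately have "\<forall>\<^sub>F n in sequentially. 7 * sqrt (real n) * (\<bar>t\<bar> + sqrt (real n)) \<le> 8 * real n \<and>
      2 / 5 * (1 / (real n + 1) ^ 3 + 1 / (real n - 1) ^ 3) \<le> 9 / 10 / real n ^ 3 \<and>
      0 < freud_series t n \<and> freud_series t n \<le> 7 / 24 * sqrt (real n) \<and>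
      norm (\<bar>freud_series t n * (4 * (freud_series t (Suc n) + freud_series t n + freud_series t (n - 1)) - 2 * t) - real n\<bar>
      / (4 * freud_series t n)) \<le> C * norm (real n powr (- 3))"
    using freud_series_pos[of t] freud_series_le[of t] C(2) by eventually_elim blast
  then obtain N0 where N0: "\<And>n. n \<ge> N0 \<Longrightarrow> 7 * sqrt (real n) * (\<bar>t\<bar> + sqrt (real n)) \<le> 8 * real n"
      "\<And>n. n \<ge> N0 \<Longrightarrow> 2 / 5 * (1 / (real n + 1) ^ 3 + 1 / (real n - 1) ^ 3) \<le> 9 / 10 / real n ^ 3"
      "\<And>n. n \<ge> N0 \<Longrightarrow> 0 < freud_series t n" "\<And>n. n \<ge> N0 \<Longrightarrow> freud_series t n \<le> 7 / 24 * sqrt (real n)"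
      "\<And>n. n \<ge> N0 \<Longrightarrow> norm (\<bar>freud_series t n * (4 * (freud_series t (Suc n) + freud_series t n + freud_series t (n - 1)) - 2 * t) - real n\<bar>
      / (4 * freud_series t n)) \<le> C * norm (real n powr (- 3))"
    unfolding eventually_sequentially by blast
  define N where "N = N0 + 2"
  define K where "K = 10 * C + \<bar>freud_beta t (N - 1) - freud_series t (N - 1)\<bar> * real (N - 1) ^ 3"
  have K: "10 * C \<le> K" "0 \<le> K" using C(1) by (simp_all add: K_def)
  have main: "\<bar>freud_beta t n - freud_series t n\<bar> \<le> K / real n ^ 3" if n: "n \<ge> N - 1" for n
  proof (rule freud_beta_approximation[where N = N and C = 1 and t = "\<bar>t\<bar>"])
    show "0 < N" by (simp add: N_def)
    show "0 \<le> K / real n ^ 3" for n using K by simp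
    show "\<bar>freud_beta t (N - 1) - freud_series t (N - 1)\<bar> \<le> K / real (N - 1) ^ 3"
    proof -
      have "0 < real (N - 1) ^ 3" by (simp add: N_def)
      thus ?thesis using C(1) by (simp add: K_def pos_le_divide_eq)
    qed
    fix n assume "n \<ge> N"
    hence n: "n \<ge> N0" "0 < n" "real (n - 1) = real n - 1" by (auto simp: N_def)
    show b0: "0 < freud_series t n" by (rule N0(3)[OF n(1)])
    have "freud_series t n * freud_beta t n \<le> (7 / 24 * sqrt (real n)) * ((\<bar>t\<bar> + sqrt (real n)) / 2)"
      using N0(4)[OF n(1)] b0 freud_beta_nonneg by (intro mult_mono freud_beta_le) auto
    also have "\<dots> = (7 * sqrt (real n) * (\<bar>t\<bar> + sqrt (real n))) / 48" by simp
    also have "\<dots> \<le> (8 * real n) / 48" by (intro divide_right_mono N0(1)[OF n(1)]) simp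
    finally show "freud_series t n * freud_beta t n \<le> real n / 6" by simp
    have "freud_series t n \<le> 7 / 24 * sqrt (real n)" by (rule N0(4)[OF n(1)])
    also have "\<dots> \<le> 1 * (1 + sqrt (real n))" by (simp add: field_simps add_increasing)
    finally show "freud_series t n \<le> 1 * (1 + sqrt (real n))" .
    have "\<bar>freud_series t n * (4 * (freud_series t (Suc n) + freud_series t n + freud_series t (n - 1)) - 2 * t) - real n\<bar>
      / (4 * freud_series t n) \<le> C * norm (real n powr (- 3))"
      by (rule order_trans[OF abs_ge_self N0(5)[OF n(1), unfolded real_norm_def[of "_ / _"]]])
    also have "real n powr (- 3) = 1 / real n ^ 3"
      using n(2) by (simp add: powr_minus powr_numeral inverse_eq_divide)
    also have "C * norm (1 / real n ^ 3) = C * (1 / real n ^ 3)" by simp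
    also have "\<dots> \<le> (K / 10) * (1 / real n ^ 3)"
      by (rule mult_right_mono) (use K in auto)
    also have "\<dots> = K * (1 / 10 / real n ^ 3)" by simp
    finally have r: "\<bar>freud_series t n * (4 * (freud_series t (Suc n) + freud_series t n + freud_series t (n - 1)) - 2 * t) - real n\<bar>
      / (4 * freud_series t n) \<le> K * (1 / 10 / real n ^ 3)" .
    have "2 / 5 * (K / real (Suc n) ^ 3 + K / real (n - 1) ^ 3) = K * (2 / 5 * (1 / (real n + 1) ^ 3 + 1 / (real n - 1) ^ 3))"
      unfolding n(3) of_nat_Suc by (simp add: distrib_left add.commute)
    also have "\<dots> \<le> K * (9 / 10 / real n ^ 3)"
      using K n by (intro mult_left_mono N0(2)) auto
    finally have "2 / 5 * (K / real (Suc n) ^ 3 + K / real (n - 1) ^ 3) +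
      \<bar>freud_series t n * (4 * (freud_series t (Suc n) + freud_series t n + freud_series t (n - 1)) - 2 * t) - real n\<bar>
      / (4 * freud_series t n) \<le> K * (9 / 10 / real n ^ 3) + K * (1 / 10 / real n ^ 3)"
      using r by (rule add_mono)
    also have "\<dots> = K / real n ^ 3" by (simp flip: distrib_left add_divide_distrib)
    finally show "2 / 5 * (K / real (Suc n) ^ 3 + K / real (n - 1) ^ 3) +
      \<bar>freud_series t n * (4 * (freud_series t (Suc n) + freud_series t n + freud_series t (n - 1)) - 2 * t) - real n\<bar>
      / (4 * freud_series t n) \<le> K / real n ^ 3" .
  qed (use n in auto)
  show ?thesis
  proof (rule landau_o.bigI[where c = "K + 1"])
    show "\<forall>\<^sub>F n in sequentially. norm (freud_beta t n - freud_series t n) \<le> (K + 1) * norm (real n powr (- 3))"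
      using eventually_ge_at_top[of N]
    proof eventually_elim
      case (elim n)
      have "real n powr (- 3) = 1 / real n ^ 3"
        using elim by (simp add: powr_minus powr_numeral inverse_eq_divide N_def)
      moreover have "K / real n ^ 3 \<le> (K + 1) / real n ^ 3" by (intro divide_right_mono) auto
      with main[of n] elim have "\<bar>freud_beta t n - freud_series t n\<bar> \<le> (K + 1) / real n ^ 3" by linarith
      ultimately show ?case by simp
    qed
  qed (use K in simp)
qed

text \<open>Since b_n has size sqrt n, the absolute error O(n^(-3)) is a relative error O(n^(-7/2)).
  Truncating the logarithm at v^7 costs the same order.\<close>

lemma ln_freud_beta_series:
  "(\<lambda>n. ln (freud_beta t n) - (ln (real n) / 2 - ln 12 / 2 + ln_beta_series t (vn n))) \<in> O(\<lambda>n. real n powr (- 7 / 2))"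
proof -
  let ?b = "freud_series t"
  define x where "x n = freud_beta t n / ?b n - 1" for n
  have "(\<lambda>n. 1 / ?b n) \<in> O(\<lambda>n. real n powr (- 1 / 2))"
  proof -
    have "(\<lambda>n. 12 * vn n) \<in> O(\<lambda>n. real n powr (- 1 / 2))" unfolding vn_def by real_asymp
    moreover have "(\<lambda>n. 1 / beta_series t (vn n)) \<in> O(\<lambda>_. 1)"
      by (rule continuous_vn_bigo_1[of "\<lambda>v. 1 / beta_series t v"])
        (auto intro!: continuous_intros isCont_beta_series simp: beta_series_def)
    ultimately have "(\<lambda>n. 12 * vn n * (1 / beta_series t (vn n))) \<in> O(\<lambda>n. real n powr (- 1 / 2) * 1)"
      by (rule landau_o.big.mult)
    thus ?thesis by (simp add: freud_series_def)
  qed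
  hence "(\<lambda>n. (freud_beta t n - ?b n) * (1 / ?b n)) \<in> O(\<lambda>n. real n powr (- 3) * real n powr (- 1 / 2))"
    by (rule landau_o.big.mult[OF freud_beta_series])
  moreover have "(\<lambda>n. real n powr (- 3) * real n powr (- 1 / 2)) = (\<lambda>n. real n powr (- 7 / 2))"
    by (simp flip: powr_add)
  ultimately have q: "(\<lambda>n. (freud_beta t n - ?b n) * (1 / ?b n)) \<in> O(\<lambda>n. real n powr (- 7 / 2))"
    by (simp only:)
  have "\<forall>\<^sub>F n in sequentially. x n = (freud_beta t n - ?b n) * (1 / ?b n)"
    using freud_series_pos[of t] by eventually_elim (simp add: x_def diff_divide_distrib)
  from bigo_eventually_eq[OF this q] have x: "x \<in> O(\<lambda>n. real n powr (- 7 / 2))" .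
  have "(\<lambda>n. real n powr (- 7 / 2)) \<in> o(\<lambda>_. 1)" by real_asymp
  with x have "x \<in> o(\<lambda>_. 1)" by (rule landau_o.big_small_trans)
  from smalloD_tendsto[OF this] have x0: "x \<longlonglongrightarrow> 0" by simp
  have 1: "(\<lambda>n. ln (1 + x n)) \<in> O(\<lambda>n. real n powr (- 7 / 2))"
  proof (rule landau_o.big.trans[OF _ x])
    have "\<forall>\<^sub>F n in sequentially. \<bar>x n\<bar> < 1 / 2"
      using tendstoD[OF x0, of "1 / 2"] by simp
    hence "\<forall>\<^sub>F n in sequentially. norm (ln (1 + x n)) \<le> 2 * norm (x n)"
    proof eventually_elim
      case (elim n)
      have "\<bar>ln (1 + x n) - x n\<bar> \<le> 2 * (x n)\<^sup>2" using elim by (intro abs_ln_one_plus_x_minus_x_bound) simp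
      also have "(x n)\<^sup>2 = \<bar>x n\<bar> * \<bar>x n\<bar>" by (simp add: power2_eq_square)
      also have "2 * (\<bar>x n\<bar> * \<bar>x n\<bar>) \<le> 2 * (1 / 2 * \<bar>x n\<bar>)" using elim by (intro mult_left_mono mult_right_mono) auto
      finally show ?case by simp
    qed
    thus "(\<lambda>n. ln (1 + x n)) \<in> O(x)" by (rule landau_o.bigI[rotated]) simp
  qed
  obtain C \<delta> where C: "0 < \<delta>" "\<And>v. 0 \<le> v \<Longrightarrow> v \<le> \<delta> \<Longrightarrow> \<bar>ln (beta_series t v) - ln_beta_series t v\<bar> \<le> C * v ^ 7"
    using ln_beta_series[of t] by blast
  have 2: "(\<lambda>n. ln (beta_series t (vn n)) - ln_beta_series t (vn n)) \<in> O(\<lambda>n. real n powr (- 7 / 2))"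
  proof (rule landau_o.big.trans)
    have "\<forall>\<^sub>F n in sequentially. vn n < \<delta>" using vn_tendsto C(1) by (rule order_tendstoD)
    hence "\<forall>\<^sub>F n in sequentially. norm (ln (beta_series t (vn n)) - ln_beta_series t (vn n)) \<le> (\<bar>C\<bar> + 1) * norm (vn n ^ 7)"
      using eventually_gt_at_top[of 0]
    proof eventually_elim
      case (elim n)
      have v: "0 < vn n" using elim by (simp add: vn_pos)
      have "\<bar>ln (beta_series t (vn n)) - ln_beta_series t (vn n)\<bar> \<le> C * vn n ^ 7" using elim v by (intro C) auto
      also have "\<dots> \<le> (\<bar>C\<bar> + 1) * vn n ^ 7" using v by (intro mult_right_mono) auto
      finally show ?case using v by simp
    qed
    thus "(\<lambda>n. ln (beta_series t (vn n)) - ln_beta_series t (vn n)) \<in> O(\<lambda>n. vn n ^ 7)"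
      by (rule landau_o.bigI[rotated]) simp
    show "(\<lambda>n. vn n ^ 7) \<in> O(\<lambda>n. real n powr (- 7 / 2))" unfolding vn_def by real_asymp
  qed
  have "\<forall>\<^sub>F n in sequentially. ln (freud_beta t n) - (ln (real n) / 2 - ln 12 / 2 + ln_beta_series t (vn n)) =
      ln (1 + x n) + (ln (beta_series t (vn n)) - ln_beta_series t (vn n))"
    using freud_series_pos[of t] eventually_gt_at_top[of 0]
  proof eventually_elim
    case (elim n)
    have v: "0 < vn n" using elim by (simp add: vn_pos)
    have W: "0 < beta_series t (vn n)" using elim v by (simp add: freud_series_def zero_less_divide_iff)
    have "ln (1 + x n) = ln (freud_beta t n) - ln (?b n)"
      using elim by (simp add: x_def ln_divide_pos freud_beta_pos)
    moreover have "?b n = beta_series t (vn n) * sqrt (real n / 12)"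
    proof -
      have "1 / (12 * vn n) = sqrt (12 * real n) / 12" by (simp add: vn_def)
      also have "\<dots> = sqrt (real n / 12)"
        by (rule real_sqrt_unique[symmetric]) (simp_all add: power_divide)
      finally have e: "1 / (12 * vn n) = sqrt (real n / 12)" .
      show ?thesis unfolding freud_series_def e[symmetric] by simp
    qed
    hence "ln (?b n) = ln (beta_series t (vn n)) + (ln (real n) / 2 - ln 12 / 2)"
      using W elim by (simp add: ln_mult_pos ln_sqrt ln_divide_pos diff_divide_distrib)
    ultimately show ?case by simp
  qed
  moreover have "(\<lambda>n. ln (1 + x n) + (ln (beta_series t (vn n)) - ln_beta_series t (vn n))) \<in> O(\<lambda>n. real n powr (- 7 / 2))"
    by (rule sum_in_bigo(1)[OF 1 2])
  ultimately show ?thesis by (rule bigo_eventually_eq)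
qed

text \<open>This is where the coefficients of the claimed expansion are verified. Each elementary
  function has its backward difference expanded separately, with remainders \<open>r1\<close> to
  \<open>r6\<close> free of \<open>t\<close>; what is left is an identity between polynomials in
  1/q, where q = sqrt n.\<close>

lemma ln_norm_expansion_diff:
  "(\<lambda>n. ln_norm_expansion t n - ln_norm_expansion t (n - 1) - (ln (real n) / 2 - ln 12 / 2 + ln_beta_series t (vn n)))
    \<in> O(\<lambda>n. real n powr (- 7 / 2))"
proof -
  define r1 where "r1 n = real n * ln (real n) - (real n - 1) * ln (real n - 1)
      - (ln (real n) + 1 - 1 / (2 * real n) - 1 / (6 * real n ^ 2) - 1 / (12 * real n ^ 3))" for n :: nat
  define r2 where "r2 n = ln (real n) - ln (real n - 1) - (1 / real n + 1 / (2 * real n ^ 2) + 1 / (3 * real n ^ 3))" for n :: nat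
  define r3 where "r3 n = real n powr (1 / 2) - (real n - 1) powr (1 / 2)
      - (1 / 2 * real n powr (- 1 / 2) + 1 / 8 * real n powr (- 3 / 2) + 1 / 16 * real n powr (- 5 / 2))" for n :: nat
  define r4 where "r4 n = 1 / real n powr (1 / 2) - 1 / (real n - 1) powr (1 / 2)
      - (- 1 / 2 * real n powr (- 3 / 2) - 3 / 8 * real n powr (- 5 / 2))" for n :: nat
  define r5 where "r5 n = 1 / real n powr (3 / 2) - 1 / (real n - 1) powr (3 / 2) - (- 3 / 2 * real n powr (- 5 / 2))" for n :: nat
  define r6 where "r6 n = 1 / real n ^ 2 - 1 / (real n - 1) ^ 2 - (- 2 / real n ^ 3)" for n :: nat
  have r1: "r1 \<in> O(\<lambda>n. real n powr (- 7 / 2))" unfolding r1_def by real_asymp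
  have r2: "r2 \<in> O(\<lambda>n. real n powr (- 7 / 2))" unfolding r2_def by real_asymp
  have r3: "r3 \<in> O(\<lambda>n. real n powr (- 7 / 2))" unfolding r3_def by real_asymp
  have r4: "r4 \<in> O(\<lambda>n. real n powr (- 7 / 2))" unfolding r4_def by real_asymp
  have r5: "r5 \<in> O(\<lambda>n. real n powr (- 7 / 2))" unfolding r5_def by real_asymp
  have r6: "r6 \<in> O(\<lambda>n. real n powr (- 7 / 2))" unfolding r6_def by real_asymp
  let ?a = "t / sqrt 3" and ?b = "t * (t ^ 2 + 18) / (72 * sqrt 3)"
    and ?c = "- (t * (t ^ 4 + 20 * t ^ 2 + 120) / (5760 * sqrt 3))" and ?d = "(t ^ 2 + 6) / 288"
  let ?g = "\<lambda>n. 1 / 2 * r1 n + 1 / 4 * r2 n + ?a * r3 n + ?b * r4 n + ?c * r5 n + ?d * r6 n"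
  have g: "?g \<in> O(\<lambda>n. real n powr (- 7 / 2))"
    by (rule sum_in_bigo(1)[OF sum_in_bigo(1)[OF sum_in_bigo(1)[OF sum_in_bigo(1)[OF sum_in_bigo(1)
      [OF cmult_bigo[OF r1] cmult_bigo[OF r2]] cmult_bigo[OF r3]] cmult_bigo[OF r4]] cmult_bigo[OF r5]] cmult_bigo[OF r6]])
  have "\<forall>\<^sub>F n in sequentially. ln_norm_expansion t n - ln_norm_expansion t (n - 1) -
      (ln (real n) / 2 - ln 12 / 2 + ln_beta_series t (vn n)) = ?g n"
    using eventually_gt_at_top[of 1]
  proof eventually_elim
    case (elim n)
    have n1: "real (n - 1) = real n - 1" using elim by (simp add: of_nat_diff)
    define q where "q = sqrt (real n)"
    have q: "0 < q" "real n = q ^ 2" using elim by (simp_all add: q_def)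
    define s where "s = sqrt (3::real)"
    have s: "0 < s" "s ^ 2 = 3" by (simp_all add: s_def)
    have half: "real n powr (1 / 2) = q" by (simp add: powr_half_sqrt q_def)
    have pw: "real n powr (- 1 / 2) = 1 / q" "real n powr (- 3 / 2) = 1 / q ^ 3" "real n powr (- 5 / 2) = 1 / q ^ 5"
    proof -
      have *: "real n powr (- (real k / 2)) = 1 / q ^ k" for k
      proof -
        have "real n powr (- (real k / 2)) = inverse ((real n powr (1 / 2)) powr real k)"
          by (simp add: powr_powr powr_minus)
        thus ?thesis unfolding half using q by (simp add: powr_realpow inverse_eq_divide)
      qed
      show "real n powr (- 1 / 2) = 1 / q" "real n powr (- 3 / 2) = 1 / q ^ 3" "real n powr (- 5 / 2) = 1 / q ^ 5"
        using *[of 1] *[of 3] *[of 5] by simp_all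
    qed
    have v: "vn n = 1 / (2 * s * q)"
      using real_sqrt_mult[of 4 3] by (simp add: vn_def real_sqrt_mult q_def s_def)
    have s3: "s ^ 3 = 3 * s" "s ^ 4 = 9" "s ^ 5 = 9 * s" "s ^ 6 = 27"
      using s(2) by (simp_all add: power_numeral_reduce power2_eq_square)
    have L: "ln_beta_series t (vn n) = t / s * (1 / (2 * q)) - t ^ 3 / s * (1 / (144 * q ^ 3)) + 1 / (24 * q ^ 4)
      + t ^ 5 / s * (1 / (3840 * q ^ 5)) - t ^ 2 * (1 / (144 * q ^ 6))"
      unfolding ln_beta_series_def v power_divide power_mult_distrib s3 s(2) by simp
    have npow: "real n ^ 2 = q ^ 4" "real n ^ 3 = q ^ 6" unfolding q(2) by (simp_all flip: power_mult)
    define X1 Y1 X2 Y2 X3 Y3 X4 Y4 X5 Y5 X6 Y6 where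
      "X1 = real n * ln (real n)" and "Y1 = (real n - 1) * ln (real n - 1)" and
      "X2 = ln (real n)" and "Y2 = ln (real n - 1)" and
      "X3 = real n powr (1 / 2)" and "Y3 = (real n - 1) powr (1 / 2)" and
      "X4 = 1 / real n powr (1 / 2)" and "Y4 = 1 / (real n - 1) powr (1 / 2)" and
      "X5 = 1 / real n powr (3 / 2)" and "Y5 = 1 / (real n - 1) powr (3 / 2)" and
      "X6 = 1 / real n ^ 2" and "Y6 = 1 / (real n - 1) ^ 2"
    have "ln_norm_expansion t n - ln_norm_expansion t (n - 1) = 1 / 2 * (X1 - Y1) - 1 / 2 * (1 + ln 12)
        + 1 / 4 * (X2 - Y2) + ?a * (X3 - Y3) + ?b * (X4 - Y4) + ?c * (X5 - Y5) + ?d * (X6 - Y6)"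
    proof -
      have e: "ln_norm_expansion t m = 1 / 2 * (real m * ln (real m)) - 1 / 2 * (1 + ln 12) * real m + ?a * real m powr (1 / 2)
        + 1 / 4 * ln (real m) + t ^ 2 / 12 - ln 12 / 4 + ln (2 * pi) + ?b * (1 / real m powr (1 / 2))
        + ?c * (1 / real m powr (3 / 2)) + ?d * (1 / real m ^ 2)" for m
        by (simp add: ln_norm_expansion_def)
      show ?thesis
        unfolding e n1 X1_def X2_def X3_def X4_def X5_def X6_def Y1_def Y2_def Y3_def Y4_def Y5_def Y6_def
        by (simp only: right_diff_distrib)
    qed
    moreover have "?g n = 1 / 2 * (X1 - Y1 - (X2 + 1 - 1 / (2 * q ^ 2) - 1 / (6 * q ^ 4) - 1 / (12 * q ^ 6)))
        + 1 / 4 * (X2 - Y2 - (1 / q ^ 2 + 1 / (2 * q ^ 4) + 1 / (3 * q ^ 6)))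
        + ?a * (X3 - Y3 - (1 / 2 * (1 / q) + 1 / 8 * (1 / q ^ 3) + 1 / 16 * (1 / q ^ 5)))
        + ?b * (X4 - Y4 - (- 1 / 2 * (1 / q ^ 3) - 3 / 8 * (1 / q ^ 5)))
        + ?c * (X5 - Y5 - (- 3 / 2 * (1 / q ^ 5))) + ?d * (X6 - Y6 - (- 2 / q ^ 6))"
      unfolding r1_def r2_def r3_def r4_def r5_def r6_def pw npow
        X1_def X2_def X3_def X4_def X5_def X6_def Y1_def Y2_def Y3_def Y4_def Y5_def Y6_def
      unfolding q(2) ..
    \<comment> \<open>The truncated expansions must reproduce the series of ln beta_n exactly, power
      by power of 1/q; the factors 1/sqrt 3 are kept as the symbol \<open>k\<close>.\<close>
    moreover have "- 1 / 2 * (1 + ln 12) - (X2 / 2 - ln 12 / 2 + ln_beta_series t (vn n)) =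
        - (1 / 2 * (X2 + 1 - 1 / (2 * q ^ 2) - 1 / (6 * q ^ 4) - 1 / (12 * q ^ 6)))
        - 1 / 4 * (1 / q ^ 2 + 1 / (2 * q ^ 4) + 1 / (3 * q ^ 6))
        - ?a * (1 / 2 * (1 / q) + 1 / 8 * (1 / q ^ 3) + 1 / 16 * (1 / q ^ 5))
        - ?b * (- 1 / 2 * (1 / q ^ 3) - 3 / 8 * (1 / q ^ 5))
        - ?c * (- 3 / 2 * (1 / q ^ 5)) - ?d * (- 2 / q ^ 6)"
    proof -
      define y where "y = 1 / q"
      define k where "k = 1 / s"
      have y: "1 / (c * q ^ i) = 1 / c * y ^ i" "1 / q ^ i = y ^ i" "c / q ^ i = c * y ^ i" "1 / q = y" "1 / (c * q) = 1 / c * y" for c i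
        by (simp_all add: y_def power_divide)
      have k: "?a = t * k" "?b = t * (t ^ 2 + 18) / 72 * k" "?c = - (t * (t ^ 4 + 20 * t ^ 2 + 120) / 5760 * k)"
        "t / s = t * k" "t ^ 3 / s = t ^ 3 * k" "t ^ 5 / s = t ^ 5 * k"
        by (simp_all add: k_def s_def)
      show ?thesis unfolding L k y by (simp add: field_simps power_numeral_reduce)
    qed
    ultimately show ?case unfolding X2_def[symmetric] by (simp only: right_diff_distrib)
  qed
  thus ?thesis using g by (rule bigo_eventually_eq)
qed

text \<open>The decrement of n^(-5/2) is asymptotically 5/2 n^(-7/2), so it eventually dominates (n
  + 1)^(-7/2) without an extra constant. Telescoping bounds |A(n + m) - A(n)| uniformly in m, and m
  tends to infinity with A(n + m) tending to 0.\<close>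

lemma tendsto_0_bigo_from_differences:
  fixes A :: "nat \<Rightarrow> real"
  assumes lim: "A \<longlonglongrightarrow> 0"
    and diff: "(\<lambda>n. A n - A (n - 1)) \<in> O(\<lambda>n. real n powr (- 7 / 2))"
  shows "A \<in> O(\<lambda>n. real n powr (- 5 / 2))"
proof -
  obtain C where C: "0 < C" "\<forall>\<^sub>F n in sequentially. norm (A n - A (n - 1)) \<le> C * norm (real n powr (- 7 / 2))"
    using diff by (rule landau_o.bigE)
  have "\<forall>\<^sub>F n::nat in sequentially. (real n + 1) powr (- 7 / 2) \<le> real n powr (- 5 / 2) - (real n + 1) powr (- 5 / 2)"
    by real_asymp
  then obtain N1 where N1: "\<And>n. n \<ge> N1 \<Longrightarrow> (real n + 1) powr (- 7 / 2) \<le> real n powr (- 5 / 2) - (real n + 1) powr (- 5 / 2)"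
    unfolding eventually_sequentially by blast
  obtain N2 where N2: "\<And>n. n \<ge> N2 \<Longrightarrow> norm (A n - A (n - 1)) \<le> C * norm (real n powr (- 7 / 2))"
    using C(2) unfolding eventually_sequentially by blast
  have step: "\<bar>A (Suc n) - A n\<bar> \<le> C * real n powr (- 5 / 2) - C * real (Suc n) powr (- 5 / 2)" if "n \<ge> N1 + N2" for n
  proof -
    have "\<bar>A (Suc n) - A n\<bar> \<le> C * (real n + 1) powr (- 7 / 2)"
      using N2[of "Suc n"] that by (simp add: add.commute)
    also have "\<dots> \<le> C * (real n powr (- 5 / 2) - (real n + 1) powr (- 5 / 2))"
      using N1[of n] that C(1) by (intro mult_left_mono) auto
    finally show ?thesis by (simp add: right_diff_distrib add.commute)
  qed
  have tail: "\<bar>A (n + m) - A n\<bar> \<le> C * real n powr (- 5 / 2) - C * real (n + m) powr (- 5 / 2)" if "n \<ge> N1 + N2" for n m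
  proof (induction m)
    case (Suc m)
    thus ?case using step[of "n + m"] that by simp
  qed simp
  have "\<bar>A n\<bar> \<le> C * real n powr (- 5 / 2)" if n: "n \<ge> N1 + N2" for n
  proof -
    have "(\<lambda>m. A (m + n)) \<longlonglongrightarrow> 0" using lim by (rule LIMSEQ_ignore_initial_segment)
    hence "(\<lambda>m. \<bar>A (n + m) - A n\<bar>) \<longlonglongrightarrow> \<bar>0 - A n\<bar>"
      unfolding add.commute[of n] by (intro tendsto_intros)
    hence "\<bar>0 - A n\<bar> \<le> C * real n powr (- 5 / 2)"
    proof (rule tendsto_upperbound)
      have "0 \<le> C * real (n + m) powr (- 5 / 2)" for m using C(1) by simp
      hence "\<bar>A (n + m) - A n\<bar> \<le> C * real n powr (- 5 / 2)" for m
        using tail[OF n, of m] by (smt (verit))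
      thus "\<forall>\<^sub>F m in sequentially. \<bar>A (n + m) - A n\<bar> \<le> C * real n powr (- 5 / 2)" by simp
    qed simp
    thus ?thesis by simp
  qed
  thus ?thesis using C(1) by (intro landau_o.bigI[of C]) (auto simp: eventually_sequentially)
qed

theorem corollary2p5:
  fixes t :: real and P :: "nat \<Rightarrow> real poly"
  assumes "monic_orthogonal_polys t P"
  shows "(\<lambda>n::nat. ln (norm_sq t (P n)) -
      (real n * ln (real n) / 2 - 1 / 2 * (1 + ln 12) * real n
       + real n powr (1 / 2) * t / sqrt 3 + ln (real n) / 4
       + t ^ 2 / 12 - ln 12 / 4 + ln (2 * pi)
       + t * (t ^ 2 + 18) / (72 * sqrt 3 * real n powr (1 / 2))
       - t * (t ^ 4 + 20 * t ^ 2 + 120) / (5760 * sqrt 3 * real n powr (3 / 2))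
       + (t ^ 2 + 6) / (288 * real n ^ 2)))
    \<in> O[sequentially](\<lambda>n. real n powr (- 5 / 2))"
proof -
  let ?A = "\<lambda>n. ln (freud_norm t n) - ln_norm_expansion t n"
  have "?A \<in> O(\<lambda>n. real n powr (- 5 / 2))"
  proof (rule tendsto_0_bigo_from_differences[OF ln_freud_norm_limit])
    \<comment> \<open>Successive differences of ln h_n are ln beta_n, so the two estimates, made
      against the same series, can be subtracted.\<close>
    have "\<forall>\<^sub>F n in sequentially. ?A n - ?A (n - 1) =
        (ln (freud_beta t n) - (ln (real n) / 2 - ln 12 / 2 + ln_beta_series t (vn n))) -
        (ln_norm_expansion t n - ln_norm_expansion t (n - 1) - (ln (real n) / 2 - ln 12 / 2 + ln_beta_series t (vn n)))"
      using eventually_gt_at_top[of 0]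
    proof eventually_elim
      case (elim n)
      thus ?case using ln_freud_norm_Suc[of t "n - 1"] by simp
    qed
    thus "(\<lambda>n. ?A n - ?A (n - 1)) \<in> O(\<lambda>n. real n powr (- 7 / 2))"
      by (rule bigo_eventually_eq) (intro sum_in_bigo(2) ln_freud_beta_series ln_norm_expansion_diff)
  qed
  thus ?thesis
    by (simp add: norm_sq_eq_freud_norm[OF assms] ln_norm_expansion_def)
qed

end
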